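(* $\mathcal S_{P_1}(\mathcal K,\kappa)=\mathcal S_{HS}(\mathcal K,\kappa)\cdot\mathcal S_{diag}(\mathcal K,\kappa)$. The orbits of the action of $\mathcal S_{P_1}^0(\mathcal K,\kappa)$ on $\mathcal S_{P_1}(\mathcal K,\kappa)$ by left multiplication are the subsets $\mathcal S_{P_1}^n(\mathcal K,\kappa)$, $n\in\mathbb N\cup\{\infty\}$. They coincide with the connected components of $\mathcal S_{P_1}(\mathcal K,\kappa)$ (in the topology of the metric $\delta_{P_1}$).
   Context: Let $\mathcal K$ be an infinite-dimensional complex vector space with a nondegenerate hermitian sesquilinear form $\kappa$ (linear in the second argument) and an antilinear involution $f\mapsto f^*$ with $\kappa(f^*,g^* )=-\kappa(g,f)$. For operators $A$ put $\overline Af=(A(f^* ))^*$. A basis projection is a linear operator $P$ with $P^2=P$, $\kappa(f,Pg)=\kappa(Pf,g)$, $P+\overline P=\mathbf 1$, and $\kappa(f,Pf)>0$ whenever $Pf\ne0$. Fix a basis projection $P_1$, put $P_2=\mathbf 1-P_1$, $C=P_1-P_2$; $\mathcal K$ is assumed to be (after completion) a separable Hilbert space for the inner product $\langle f,g\rangle_{P_1}=\kappa(f,Cg)$. $A_{mn}=P_mAP_n$. $A^*$ is the Hilbert space adjoint and $A^\dagger=CA^*C$. $\mathcal S(\mathcal K,\kappa)=\{V\in\mathfrak B(\mathcal K):\overline V=V,\ V^\dagger V=\mathbf 1\}$, with $-\operatorname{ind}V=\dim\ker V^\dagger$ (even or infinite); $\mathcal S_{P_1}(\mathcal K,\kappa)=\{V\in\mathcal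 S(\mathcal K,\kappa):V_{12}\text{ Hilbert–Schmidt}\}$, a topological semigroup for the metric $\delta_{P_1}(V,V')=\|V-V'\|+\|V_{12}-V'_{12}\|_{HS}$; $\mathcal S_{P_1}^n(\mathcal K,\kappa)=\{V\in\mathcal S_{P_1}(\mathcal K,\kappa):\operatorname{ind}V=-2n\}$ for $n\in\mathbb N\cup\{\infty\}$, $0\in\mathbb N$ ($\mathcal S_{P_1}^0$ is a group); $\mathcal S_{HS}(\mathcal K,\kappa)=\{V\in\mathcal S(\mathcal K,\kappa):V-\mathbf 1\text{ Hilbert–Schmidt}\}$; $\mathcal S_{diag}(\mathcal K,\kappa)=\{V\in\mathcal S(\mathcal K,\kappa):[P_1,V]=0\}$. *)

theory Defs
  imports "HOL-Analysis.Analysis" "HOL-Library.Extended_Nat"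
begin

locale hermitian_involution_space = vector_space scaleC
  for scaleC :: "complex \<Rightarrow> 'k::ab_group_add \<Rightarrow> 'k" +
  fixes \<kappa> :: "'k \<Rightarrow> 'k \<Rightarrow> complex"
    and star :: "'k \<Rightarrow> 'k"
  assumes infinite_dimensional: "\<not> (\<exists>B. finite B \<and> local.span B = UNIV)"
    and kappa_add_right: "\<kappa> f (g + h) = \<kappa> f g + \<kappa> f h"
    and kappa_scale_right: "\<kappa> f (scaleC c g) = c * \<kappa> f g"
    and kappa_hermitian: "\<kappa> g f = cnj (\<kappa> f g)"
    and kappa_nondegenerate: "(\<And>g. \<kappa> f g = 0) \<Longrightarrow> f = 0"
    and star_add: "star (f + g) = star f + star g"
    and star_scale: "star (scaleC c f) = scaleC (cnj c) (star f)"
    and star_star: "star (star f) = f"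
    and kappa_star: "\<kappa> (star f) (star g) = - \<kappa> g f"
begin

definition bar :: "('k \<Rightarrow> 'k) \<Rightarrow> 'k \<Rightarrow> 'k"
  where "bar A f = star (A (star f))"

text \<open>In the last clause \<open>\<kappa> f (P f)\<close> is a real number, since \<open>\<kappa>\<close> is hermitian and
  \<open>P\<close> is symmetric with respect to \<open>\<kappa>\<close>.\<close>

definition basis_projection :: "('k \<Rightarrow> 'k) \<Rightarrow> bool"
  where "basis_projection P \<longleftrightarrow>
    Vector_Spaces.linear scaleC scaleC P \<and>
    P \<circ> P = P \<and>
    (\<forall>f g. \<kappa> f (P g) = \<kappa> (P f) g) \<and>
    (\<forall>f. P f + bar P f = f) \<and>
    (\<forall>f. P f \<noteq> 0 \<longrightarrow> Re (\<kappa> f (P f)) > 0)"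

text \<open>The dimension of a complex subspace as an extended natural number
  (\<open>dim\<close> alone does not tell dimension zero from infinite dimension).\<close>

definition edim :: "'k set \<Rightarrow> enat"
  where "edim U = (if \<exists>B. finite B \<and> U \<subseteq> local.span B then enat (local.dim U) else \<infinity>)"

end

locale basis_projection_space = hermitian_involution_space scaleC \<kappa> star
  for scaleC :: "complex \<Rightarrow> 'k::ab_group_add \<Rightarrow> 'k"
    and \<kappa> :: "'k \<Rightarrow> 'k \<Rightarrow> complex"
    and star :: "'k \<Rightarrow> 'k" +
  fixes P1 :: "'k \<Rightarrow> 'k"
  assumes P1: "basis_projection P1"
begin

definition P2 :: "'k \<Rightarrow> 'k"
  where "P2 f = f - P1 f"

definition C :: "'k \<Rightarrow> 'k"
  where "C f = P1 f - P2 f"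

definition ip :: "'k \<Rightarrow> 'k \<Rightarrow> complex"
  where "ip f g = \<kappa> f (C g)"

definition block12 :: "('k \<Rightarrow> 'k) \<Rightarrow> 'k \<Rightarrow> 'k"
  where "block12 A f = P1 (A (P2 f))"

definition adj :: "('k \<Rightarrow> 'k) \<Rightarrow> 'k \<Rightarrow> 'k"
  where "adj A = (THE B. \<forall>f g. ip (B f) g = ip f (A g))"

definition dagger :: "('k \<Rightarrow> 'k) \<Rightarrow> 'k \<Rightarrow> 'k"
  where "dagger A = C \<circ> adj A \<circ> C"

text \<open>Minus the index of an injective operator: the dimension of the kernel of \<open>dagger A\<close>.\<close>

definition neg_ind :: "('k \<Rightarrow> 'k) \<Rightarrow> enat"
  where "neg_ind A = edim {f. dagger A f = 0}"

end

text \<open>The space, already completed, as a separable Hilbert space for \<open>ip\<close>. The sort of \<open>'k\<close>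
  supplies the real Hilbert space structure, in particular the norm and the topology. The two
  assumptions say that it underlies the complex Hilbert space with inner product \<open>ip\<close>;
  thus \<open>(norm f)\<^sup>2 = ip f f\<close>.\<close>

locale selfdual_hilbert_space = basis_projection_space scaleC \<kappa> star P1
  for scaleC :: "complex \<Rightarrow> 'k::{real_inner, complete_space, second_countable_topology} \<Rightarrow> 'k"
    and \<kappa> :: "'k \<Rightarrow> 'k \<Rightarrow> complex"
    and star :: "'k \<Rightarrow> 'k"
    and P1 :: "'k \<Rightarrow> 'k" +
  assumes scaleR_eq: "r *\<^sub>R f = scaleC (of_real r) f"
    and inner_eq: "f \<bullet> g = Re (ip f g)"
begin

definition orthonormal_basis :: "'k set \<Rightarrow> bool"
  where "orthonormal_basis E \<longleftrightarrow>
    (\<forall>e\<in>E. \<forall>e'\<in>E. ip e e' = (if e = e' then 1 else 0)) \<and> closure (local.span E) = UNIV"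

definition hilbert_schmidt :: "('k \<Rightarrow> 'k) \<Rightarrow> bool"
  where "hilbert_schmidt A \<longleftrightarrow>
    Vector_Spaces.linear scaleC scaleC A \<and> bounded_linear A \<and>
    (\<exists>E. orthonormal_basis E \<and> (\<lambda>e. (norm (A e))\<^sup>2) summable_on E)"

text \<open>The value does not depend on the orthonormal basis.\<close>

definition hs_norm :: "('k \<Rightarrow> 'k) \<Rightarrow> real"
  where "hs_norm A = sqrt (\<Sum>\<^sub>\<infinity>e\<in>(SOME E. orthonormal_basis E). (norm (A e))\<^sup>2)"

text \<open>The elements of the type \<open>'k \<Rightarrow>\<^sub>L 'k\<close> are bounded operators that are only real-linear;
  complex linearity is required separately.\<close>

definition S :: "('k \<Rightarrow>\<^sub>L 'k) set"
  where "S = {V. Vector_Spaces.linear scaleC scaleC (blinfun_apply V) \<and>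
    bar (blinfun_apply V) = blinfun_apply V \<and>
    dagger (blinfun_apply V) \<circ> blinfun_apply V = id}"

definition S_P1 :: "('k \<Rightarrow>\<^sub>L 'k) set"
  where "S_P1 = {V \<in> S. hilbert_schmidt (block12 (blinfun_apply V))}"

definition \<delta> :: "('k \<Rightarrow>\<^sub>L 'k) \<Rightarrow> ('k \<Rightarrow>\<^sub>L 'k) \<Rightarrow> real"
  where "\<delta> V V' = norm (V - V') +
    hs_norm (\<lambda>f. block12 (blinfun_apply V) f - block12 (blinfun_apply V') f)"

definition S_P1_ind :: "enat \<Rightarrow> ('k \<Rightarrow>\<^sub>L 'k) set"
  where "S_P1_ind n = {V \<in> S_P1. neg_ind (blinfun_apply V) = 2 * n}"

definition S_HS :: "('k \<Rightarrow>\<^sub>L 'k) set"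
  where "S_HS = {V \<in> S. hilbert_schmidt (\<lambda>f. V f - f)}"

definition S_diag :: "('k \<Rightarrow>\<^sub>L 'k) set"
  where "S_diag = {V \<in> S. P1 \<circ> blinfun_apply V = blinfun_apply V \<circ> P1}"

end

end

theory Submission
  imports Defs
begin

text \<open>Write \<open>V = a + b\<close> for the even and odd parts of \<open>V\<close> with respect to \<open>C\<close>. Preservation of \<open>\<kappa>\<close>
  gives \<open>a\<^sup>* a = 1 + b\<^sup>* b\<close>, so that \<open>b = Z a\<close> for a strict contraction \<open>Z\<close>, which is
  Hilbert-Schmidt if \<open>V\<^sub>1\<^sub>2\<close> is. The idea is to undo \<open>Z\<close> by group elements. For a selfadjoint odd
  Hilbert-Schmidt operator \<open>z\<close> with \<open>\<parallel>z\<parallel> < 1\<close> that commutes with the involution, the operator \<open>(1 + z) (1 - z\<^sup>2)\<^sup>-\<^sup>1\<^sup>/\<^sup>2\<close> belongs to the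
  group and differs from \<open>1\<close> by a Hilbert-Schmidt operator; it is the Cayley transform
  \<open>(1 + X) (1 - X)\<^sup>-\<^sup>1\<close> of the operator \<open>X\<close> with \<open>2 X = z (1 + X\<^sup>2)\<close>. Since \<open>Z\<close> is only given on the
  range of \<open>a\<close>, two such steps are made: the first one uses the compression of \<open>Z\<close> to the range of
  \<open>a\<close> and makes the ranges of \<open>a\<close> and \<open>b\<close> orthogonal, and after that \<open>Z + Z\<^sup>*\<close> is still a strict
  contraction, so that a second step removes \<open>b\<close> (\<open>factorization\<close>). This is the product
  decomposition.

  For a diagonal \<open>W\<close> the kernel of \<open>W\<^sup>\<dagger>\<close> is the orthogonal sum of its intersection with the range
  \<open>H1\<close> of \<open>P1\<close> and of the image of that intersection under the involution. Its dimension is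
  therefore even or infinite, it is the only invariant of \<open>W\<close> under multiplication by diagonal
  unitaries (\<open>diagonal_transitive\<close>), and every value occurs (\<open>diagonal_exists\<close>). Multiplication by
  the group does not change the index, so the orbits are the sets of constant index.

  These sets are open, because the kernels of \<open>V\<^sup>\<dagger>\<close> and \<open>V'\<^sup>\<dagger>\<close> embed into each other if \<open>V\<close> and
  \<open>V'\<close> are close in norm (\<open>neg_ind_locally_constant\<close>). They are connected, because all group
  elements used above are products of Cayley transforms: \<open>t \<mapsto> (1 + t X) (1 - t X)\<^sup>-\<^sup>1\<close> is a path
  from \<open>1\<close> inside the group (\<open>cayley_path\<close>), and a diagonal unitary is a product of two Cayley
  transforms (\<open>diagonal_unitary_cayley\<close>), which takes the place of its logarithm.\<close>

section \<open>Bounded operators on a real Hilbert space\<close>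

text \<open>By the parallelogram law every sequence in \<open>M\<close> that minimizes the distance to \<open>f\<close> is Cauchy; its
  limit is the foot of the perpendicular.\<close>

lemma closed_subspace_projection:
  fixes M :: "'a::{real_inner, complete_space} set"
  assumes M: "subspace M" and cl: "closed M"
  shows "\<exists>m\<in>M. \<forall>k\<in>M. (f - m) \<bullet> k = 0"
proof -
  have ne: "M \<noteq> {}" using subspace_0[OF M] by blast
  define d where "d = infdist f M"
  have d0: "0 \<le> d" by (simp add: d_def infdist_nonneg)
  have "\<exists>m\<in>M. dist f m < d + 1 / (real n + 1)" for n
  proof -
    have "(INF a\<in>M. dist f a) < d + 1 / (real n + 1)"
      using ne by (simp add: d_def infdist_notempty)
    then show ?thesis
      using ne by (subst (asm) cINF_less_iff) auto
  qed
  then obtain m where mM: "\<And>n. m n \<in> M" and md: "\<And>n. dist f (m n) < d + 1 / (real n + 1)"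
    by metis
  define r where "r n = (2 * d + 1) / (real n + 1)" for n :: nat
  have sq: "(norm (f - m n))\<^sup>2 \<le> d\<^sup>2 + r n" for n
  proof -
    have "(norm (f - m n))\<^sup>2 \<le> (d + 1 / (real n + 1))\<^sup>2"
      using md[of n] by (intro power_mono) (auto simp: dist_norm)
    also have "\<dots> = d\<^sup>2 + 2 * d * (1 / (real n + 1)) + (1 / (real n + 1))\<^sup>2"
      by (simp add: power2_sum)
    also have "(1 / (real n + 1))\<^sup>2 \<le> 1 / (real n + 1)"
      using power_decreasing[of 1 2 "1 / (real n + 1)"] by simp
    finally show ?thesis by (simp add: r_def add_divide_distrib)
  qed
  have par: "(norm (m i - m j))\<^sup>2 \<le> 2 * (r i + r j)" for i j
  proof -
    let ?h = "(1/2) *\<^sub>R (m i + m j)"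
    have "?h \<in> M" using M mM by (simp add: subspace_add subspace_scale)
    then have "d \<le> norm (f - ?h)" unfolding d_def using infdist_le[of ?h M f] by (simp add: dist_norm)
    then have "d\<^sup>2 \<le> (norm (f - ?h))\<^sup>2" using d0 by (intro power_mono) auto
    moreover have "(norm (m i - m j))\<^sup>2 = 2 * (norm (f - m i))\<^sup>2 + 2 * (norm (f - m j))\<^sup>2 - 4 * (norm (f - ?h))\<^sup>2"
      unfolding power2_norm_eq_inner by (simp add: inner_simps inner_commute algebra_simps)
    moreover have "t \<le> 2 * (p + q)"
      if "c \<le> k" "t = 2 * u + 2 * v - 4 * k" "u \<le> c + p" "v \<le> c + q" for t p q c k u v :: real
      using that by argo
    ultimately show ?thesis using sq[of i] sq[of j] by blast
  qed
  have "Cauchy m"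
  proof (rule metric_CauchyI)
    fix e :: real assume e: "0 < e"
    define N where "N = nat \<lceil>4 * (2 * d + 1) / e\<^sup>2\<rceil>"
    have "dist (m i) (m j) < e" if "i \<ge> N" "j \<ge> N" for i j
    proof -
      have N: "4 * (2 * d + 1) / e\<^sup>2 < real n + 1" if "n \<ge> N" for n
        using that unfolding N_def by linarith
      have b: "r n < e\<^sup>2 / 4" if "n \<ge> N" for n
        using N[OF that] e d0 by (simp add: r_def field_simps)
      have "(norm (m i - m j))\<^sup>2 < e\<^sup>2"
        using par[of i j] b[OF that(1)] b[OF that(2)] by simp
      then show ?thesis using e by (simp add: dist_norm power2_less_imp_less)
    qed
    then show "\<exists>N. \<forall>i\<ge>N. \<forall>j\<ge>N. dist (m i) (m j) < e" by blast
  qed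
  then obtain l where l: "m \<longlonglongrightarrow> l"
    using Cauchy_convergent convergent_def by blast
  have lM: "l \<in> M" using closed_sequentially[OF cl] mM l by blast
  have "dist f l \<le> d"
  proof (rule LIMSEQ_le)
    show "(\<lambda>n. dist f (m n)) \<longlonglongrightarrow> dist f l" by (intro tendsto_intros l)
    have "(\<lambda>n. d + inverse (real (Suc n))) \<longlonglongrightarrow> d + 0"
      by (intro tendsto_intros LIMSEQ_inverse_real_of_nat)
    then show "(\<lambda>n. d + 1 / (real n + 1)) \<longlonglongrightarrow> d" by (simp add: inverse_eq_divide add.commute)
    show "\<exists>N. \<forall>n\<ge>N. dist f (m n) \<le> d + 1 / (real n + 1)" using md by (auto intro: less_imp_le)
  qed
  then have min: "\<forall>z\<in>M. dist f l \<le> dist f z"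
    unfolding d_def using infdist_le order_trans by blast
  have le: "(f - l) \<bullet> k \<le> 0" if "k \<in> M" for k
    using any_closest_point_dot[OF subspace_imp_convex[OF M] cl lM _ min, of "l + k"] M lM that
    by (simp add: subspace_add)
  have "(f - l) \<bullet> k = 0" if "k \<in> M" for k
    using le[OF that] le[of "- k"] M that by (simp add: subspace_neg)
  then show ?thesis using lM by blast
qed

text \<open>The orthogonal complement of the kernel of a nonzero functional is the line spanned by \<open>z - m\<close>,
  where \<open>m\<close> is the foot of the perpendicular from a vector \<open>z\<close> outside the kernel.\<close>

lemma riesz_representation:
  fixes \<phi> :: "'a::{real_inner, complete_space} \<Rightarrow> real"
  assumes \<phi>: "bounded_linear \<phi>"
  shows "\<exists>y. \<forall>x. \<phi> x = y \<bullet> x"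
proof (cases "\<forall>x. \<phi> x = 0")
  case True
  then show ?thesis by (intro exI[of _ 0]) simp
next
  case False
  then obtain z where z: "\<phi> z \<noteq> 0" by blast
  interpret \<phi>: bounded_linear \<phi> by fact
  let ?M = "{x. \<phi> x = 0}"
  have "subspace ?M" by (auto simp: subspace_def \<phi>.add \<phi>.scaleR \<phi>.zero)
  moreover have "closed ?M"
    using \<phi>.continuous_on[OF continuous_on_id, of UNIV] by (intro closed_Collect_eq) auto
  ultimately obtain m where m: "\<phi> m = 0" and orth: "\<forall>k. \<phi> k = 0 \<longrightarrow> (z - m) \<bullet> k = 0"
    using closed_subspace_projection[of ?M z] by auto
  define w where "w = z - m"
  have w: "\<phi> w = \<phi> z" by (simp add: w_def \<phi>.diff m)
  have "w \<bullet> w \<noteq> 0" using w z by (auto simp: \<phi>.zero)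
  have "\<phi> x = ((\<phi> w / (w \<bullet> w)) *\<^sub>R w) \<bullet> x" for x
  proof -
    have "\<phi> (x - (\<phi> x / \<phi> w) *\<^sub>R w) = 0" using w z by (simp add: \<phi>.diff \<phi>.scaleR)
    then have "w \<bullet> (x - (\<phi> x / \<phi> w) *\<^sub>R w) = 0" using orth w_def by blast
    then have "w \<bullet> x = (\<phi> x / \<phi> w) * (w \<bullet> w)"
      by (simp add: inner_diff_right)
    then show ?thesis using w z \<open>w \<bullet> w \<noteq> 0\<close> by simp
  qed
  then show ?thesis by blast
qed

type_synonym 'a endo = "'a \<Rightarrow>\<^sub>L 'a"

text \<open>The adjoint for the real inner product. Real-linear operators are the common framework for complex
  linear operators and the antilinear involution, and for an operator that commutes with
  multiplication by \<open>\<i>\<close> the real adjoint is the complex one.\<close>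

definition hadj :: "'a::{real_inner, complete_space} endo \<Rightarrow> 'a endo"
  where "hadj A = (SOME B. \<forall>f g. blinfun_apply B f \<bullet> g = f \<bullet> blinfun_apply A g)"

lemma hadj_exists: "\<exists>B :: 'a::{real_inner, complete_space} endo. \<forall>f g. B f \<bullet> g = f \<bullet> blinfun_apply A g"
proof -
  have "\<exists>y. \<forall>g. f \<bullet> A g = y \<bullet> g" for f
    by (rule riesz_representation)
       (intro bounded_linear_inner_right_comp blinfun.bounded_linear_right)
  then obtain B where B: "\<And>f g. f \<bullet> A g = B f \<bullet> g" by metis
  have "bounded_linear B"
  proof (rule bounded_linear_intro[where K="norm A"])
    fix x y :: 'a and r :: real
    show "B (x + y) = B x + B y"
      by (rule vector_eq_rdot[THEN iffD1]) (auto simp: B[symmetric] inner_add_left)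
    show "B (r *\<^sub>R x) = r *\<^sub>R B x"
      by (rule vector_eq_rdot[THEN iffD1]) (auto simp: B[symmetric])
    have "(norm (B x))\<^sup>2 = x \<bullet> A (B x)" by (simp add: B power2_norm_eq_inner)
    also have "\<dots> \<le> norm x * (norm A * norm (B x))"
      by (intro order_trans[OF norm_cauchy_schwarz] mult_left_mono norm_blinfun) simp
    finally show "norm (B x) \<le> norm x * norm A"
      by (cases "norm (B x) = 0") (auto simp: power2_eq_square mult.assoc[symmetric])
  qed
  then show ?thesis
    by (intro exI[of _ "Blinfun B"]) (simp add: bounded_linear_Blinfun_apply B)
qed

lemma inner_hadj_left: "hadj A f \<bullet> g = f \<bullet> A g"
  using someI_ex[OF hadj_exists[of A]] unfolding hadj_def by blast

lemma inner_hadj_right: "f \<bullet> hadj A g = A f \<bullet> g"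
  by (metis inner_hadj_left inner_commute)

lemma hadj_unique:
  assumes "\<And>f g. B f \<bullet> g = f \<bullet> blinfun_apply A g"
  shows "B f = hadj A f"
  using assms by (intro vector_eq_rdot[THEN iffD1]) (simp add: inner_hadj_left)

lemma hadj_hadj [simp]: "hadj (hadj A) = A"
  by (rule blinfun_eqI) (metis hadj_unique inner_hadj_right)

lemma norm_hadj_le: "norm (hadj A) \<le> norm A"
proof (rule norm_blinfun_bound)
  fix x
  have "(norm (hadj A x))\<^sup>2 = x \<bullet> A (hadj A x)"
    by (simp add: inner_hadj_left power2_norm_eq_inner)
  also have "\<dots> \<le> norm x * (norm A * norm (hadj A x))"
    by (intro order_trans[OF norm_cauchy_schwarz] mult_left_mono norm_blinfun) simp
  finally show "norm (hadj A x) \<le> norm A * norm x"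
    by (cases "norm (hadj A x) = 0") (auto simp: power2_eq_square mult.assoc[symmetric] mult.commute)
qed simp

text \<open>A coercive operator is bounded below, so its range is closed, and a vector orthogonal to
  the range vanishes; hence it is invertible.\<close>

lemma coercive_inverse:
  fixes T :: "'a::{real_inner, complete_space} endo"
  assumes c: "0 < c" and co: "\<And>f. c * (f \<bullet> f) \<le> f \<bullet> T f"
  shows "\<exists>R. (\<forall>f. T (blinfun_apply R f) = f) \<and> (\<forall>f. blinfun_apply R (T f) = f) \<and> norm R \<le> 1 / c"
proof -
  have lb: "c * norm f \<le> norm (T f)" for f
  proof -
    have "c * (norm f * norm f) \<le> norm f * norm (T f)"
      using co[of f] norm_cauchy_schwarz[of f "T f"] by (simp add: power2_norm_eq_inner[symmetric] power2_eq_square)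
    then show ?thesis by (cases "norm f = 0") (auto simp: mult.left_commute)
  qed
  have inj: "f = g" if "T f = T g" for f g
    using lb[of "f - g"] that c by (simp add: blinfun.diff_right mult_le_0_iff)
  have "subspace (range T)"
    by (rule linear_subspace_image) (auto simp: bounded_linear.linear[OF blinfun.bounded_linear_right] subspace_UNIV)
  moreover have "complete (range T)"
    by (rule complete_isometric_image[OF c]) (auto simp: blinfun.bounded_linear_right lb subspace_UNIV complete_UNIV)
  ultimately have pr: "\<exists>m\<in>range T. \<forall>k\<in>range T. (f - m) \<bullet> k = 0" for f
    by (intro closed_subspace_projection complete_imp_closed)
  have surj: "\<exists>g. T g = f" for f
  proof -
    obtain g where g: "\<And>k. (f - T g) \<bullet> T k = 0" using pr[of f] by auto
    have "(f - T g) \<bullet> (f - T g) \<le> 0"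
      using co[of "f - T g"] g[of "f - T g"] c by (simp add: mult_le_0_iff)
    then have "f - T g = 0" by (metis inner_eq_zero_iff inner_ge_zero order_antisym)
    then show ?thesis by (intro exI[of _ g]) (metis eq_iff_diff_eq_0)
  qed
  then obtain R where R: "\<And>f. T (R f) = f" by metis
  have "bounded_linear R"
  proof (rule bounded_linear_intro[where K="1 / c"])
    fix x y :: 'a and r :: real
    show "R (x + y) = R x + R y" by (rule inj) (simp add: R blinfun.add_right)
    show "R (r *\<^sub>R x) = r *\<^sub>R R x" by (rule inj) (simp add: R blinfun.scaleR_right)
    show "norm (R x) \<le> norm x * (1 / c)" using lb[of "R x"] c by (simp add: R field_simps)
  qed
  then have [simp]: "blinfun_apply (Blinfun R) = R" by (simp add: bounded_linear_Blinfun_apply)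
  have "norm (Blinfun R) \<le> 1 / c"
    using lb c by (intro norm_blinfun_bound) (auto simp: field_simps, metis R mult.commute)
  then show ?thesis
    by (intro exI[of _ "Blinfun R"]) (auto simp: R intro: inj)
qed

text \<open>Iterating \<open>y \<mapsto> (x + a y\<^sup>2)/2\<close> from \<open>0\<close> converges for operators \<open>x\<close> and \<open>a\<close> of norm at most
  one, even on the boundary: the increments are dominated by those of the increasing scalar
  sequence \<open>s \<mapsto> (1 + s\<^sup>2)/2\<close>, which is bounded by one. With \<open>a = 1\<close> the limit is
  \<open>1 - sqrt (1 - x)\<close>, and with \<open>a = x\<close> it is \<open>x / (1 + sqrt (1 - x\<^sup>2))\<close>.\<close>

fun quad_iter :: "'a::real_normed_vector endo \<Rightarrow> 'a endo \<Rightarrow> nat \<Rightarrow> 'a endo" where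
  "quad_iter x a 0 = 0"
| "quad_iter x a (Suc n) = (1/2) *\<^sub>R (x + (a o\<^sub>L (quad_iter x a n o\<^sub>L quad_iter x a n)))"

lemma quad_iter_limit:
  fixes x a :: "'a::{real_normed_vector, complete_space} endo"
  assumes x: "norm x \<le> 1" and a: "norm a \<le> 1"
  shows "\<exists>y. (\<forall>f. (\<lambda>n. quad_iter x a n f) \<longlonglongrightarrow> blinfun_apply y f) \<and> norm y \<le> 1 \<and>
      (\<forall>f. y f = (1/2) *\<^sub>R (x f + a (y (y f))))"
proof -
  let ?Y = "quad_iter x a"
  define s :: "nat \<Rightarrow> real" where "s = rec_nat 0 (\<lambda>_ r. (1 + r\<^sup>2) / 2)"
  have s0: "s 0 = 0" and sS: "s (Suc n) = (1 + (s n)\<^sup>2) / 2" for n by (auto simp: s_def)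
  have s01: "0 \<le> s n \<and> s n \<le> 1" for n
  proof (induction n)
    case (Suc n)
    then show ?case using power_le_one[of "s n" 2] by (simp add: sS)
  qed (simp add: s0)
  have smono: "s n \<le> s (Suc n)" for n
    using zero_le_power2[of "1 - s n"] by (simp add: sS power2_eq_square algebra_simps)
  have nY: "norm (?Y n) \<le> s n" for n
  proof (induction n)
    case (Suc n)
    have "norm (a o\<^sub>L (?Y n o\<^sub>L ?Y n)) \<le> norm a * (norm (?Y n) * norm (?Y n))"
      by (intro order_trans[OF norm_blinfun_compose] mult_left_mono norm_blinfun_compose) simp
    also have "\<dots> \<le> 1 * (s n * s n)" using Suc a s01[of n] by (intro mult_mono) auto
    finally have "norm (x + (a o\<^sub>L (?Y n o\<^sub>L ?Y n))) \<le> 1 + s n * s n"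
      using x norm_triangle_ineq[of x "a o\<^sub>L (?Y n o\<^sub>L ?Y n)"] by linarith
    then show ?case by (simp add: sS power2_eq_square)
  qed (simp add: s0)
  have dY: "norm (?Y (Suc n) - ?Y n) \<le> s (Suc n) - s n" for n
  proof (induction n)
    case 0
    then show ?case using x by (simp add: s0 sS)
  next
    case (Suc n)
    let ?u = "?Y (Suc n)" and ?v = "?Y n"
    have eq: "?Y (Suc (Suc n)) - ?u = (1/2) *\<^sub>R (a o\<^sub>L ((?u o\<^sub>L (?u - ?v)) + ((?u - ?v) o\<^sub>L ?v)))"
    proof (rule blinfun_eqI)
      fix f
      have "(?Y (Suc (Suc n)) - ?u) f
          = (1/2) *\<^sub>R (x f + a (?u (?u f))) - (1/2) *\<^sub>R (x f + a (?v (?v f)))"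
        by (simp only: blinfun.diff_left quad_iter.simps(2) blinfun.scaleR_left blinfun.add_left
          blinfun_apply_blinfun_compose)
      also have "\<dots> = ((1/2) *\<^sub>R (a o\<^sub>L ((?u o\<^sub>L (?u - ?v)) + ((?u - ?v) o\<^sub>L ?v)))) f"
        by (simp add: blinfun.bilinear_simps scaleR_diff_right scaleR_add_right del: quad_iter.simps)
      finally show "(?Y (Suc (Suc n)) - ?u) f
          = ((1/2) *\<^sub>R (a o\<^sub>L ((?u o\<^sub>L (?u - ?v)) + ((?u - ?v) o\<^sub>L ?v)))) f" .
    qed
    have "norm ((?u o\<^sub>L (?u - ?v)) + ((?u - ?v) o\<^sub>L ?v))
        \<le> norm ?u * norm (?u - ?v) + norm (?u - ?v) * norm ?v"
      by (intro norm_triangle_le add_mono norm_blinfun_compose)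
    also have "\<dots> \<le> s (Suc n) * (s (Suc n) - s n) + (s (Suc n) - s n) * s n"
      using Suc nY[of n] nY[of "Suc n"] s01 smono by (intro add_mono mult_mono) auto
    also have "\<dots> = (s (Suc n))\<^sup>2 - (s n)\<^sup>2" by (simp add: power2_eq_square algebra_simps)
    finally have "norm (a o\<^sub>L ((?u o\<^sub>L (?u - ?v)) + ((?u - ?v) o\<^sub>L ?v))) \<le> 1 * ((s (Suc n))\<^sup>2 - (s n)\<^sup>2)"
      using a by (intro order_trans[OF norm_blinfun_compose] mult_mono) auto
    moreover have "s (Suc (Suc n)) - s (Suc n) = ((s (Suc n))\<^sup>2 - (s n)\<^sup>2) / 2"
      unfolding sS[of "Suc n"] unfolding sS[of n] by (simp add: add_divide_distrib diff_divide_distrib)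
    ultimately show ?case unfolding eq norm_scaleR by linarith
  qed
  have dYk: "norm (?Y (n + k) - ?Y n) \<le> s (n + k) - s n" for n k
  proof (induction k)
    case (Suc k)
    have "norm (?Y (n + Suc k) - ?Y n) \<le> norm (?Y (Suc (n + k)) - ?Y (n + k)) + norm (?Y (n + k) - ?Y n)"
      by (rule order_trans[OF _ norm_triangle_ineq]) (simp del: quad_iter.simps)
    then show ?case using Suc dY[of "n + k"] by (simp del: quad_iter.simps)
  qed simp
  have sC: "Cauchy s"
    using smono s01 by (intro convergent_Cauchy Bseq_monoseq_convergent)
      (auto simp: incseq_SucI monoseq_Suc intro!: BseqI'[of _ 1])
  have CY: "Cauchy (\<lambda>n. ?Y n f)" for f
  proof (rule metric_CauchyI)
    fix e :: real assume e: "0 < e"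
    have "0 < e / (norm f + 1)" using e by (simp add: add_nonneg_pos)
    then obtain N where N: "\<And>i j. i \<ge> N \<Longrightarrow> j \<ge> N \<Longrightarrow> dist (s i) (s j) < e / (norm f + 1)"
      using metric_CauchyD[OF sC] by metis
    have main: "dist (?Y i f) (?Y j f) < e" if ij: "i \<ge> N" "i \<le> j" for i j
    proof -
      obtain k where k: "j = i + k" using le_Suc_ex[OF ij(2)] by blast
      have "norm (?Y (i + k) f - ?Y i f) \<le> norm (?Y (i + k) - ?Y i) * norm f"
        by (metis blinfun.diff_left norm_blinfun)
      also have "\<dots> \<le> dist (s (i + k)) (s i) * (norm f + 1)"
        using dYk[of i k] by (intro mult_mono) (auto simp: dist_real_def)
      also have "\<dots> < e" using N[of "i + k" i] ij by (simp add: pos_less_divide_eq add_nonneg_pos)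
      finally show ?thesis by (simp add: k dist_norm norm_minus_commute)
    qed
    show "\<exists>N. \<forall>i\<ge>N. \<forall>j\<ge>N. dist (?Y i f) (?Y j f) < e"
      using main by (metis dist_commute nle_le)
  qed
  then have "\<exists>l. (\<lambda>n. ?Y n f) \<longlonglongrightarrow> l" for f using Cauchy_convergent convergent_def by blast
  then obtain y where y: "\<And>f. (\<lambda>n. ?Y n f) \<longlonglongrightarrow> y f" by metis
  have Y1: "norm (?Y n f) \<le> norm f" for n f
    using norm_blinfun[of "?Y n" f] nY[of n] s01[of n] mult_right_mono[of "norm (?Y n)" 1 "norm f"] by simp
  have y1: "norm (y f) \<le> norm f" for f
    using Lim_bounded[OF tendsto_norm[OF y[of f]], of 0 "norm f"] Y1 by simp
  have "bounded_linear y"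
  proof (rule bounded_linear_intro[where K=1])
    fix u v :: 'a and r :: real
    show "y (u + v) = y u + y v"
      using tendsto_add[OF y[of u] y[of v]] y[of "u + v"]
      by (simp add: blinfun.add_right LIMSEQ_unique del: quad_iter.simps)
    show "y (r *\<^sub>R u) = r *\<^sub>R y u"
      using tendsto_scaleR[OF tendsto_const[of r] y[of u]] y[of "r *\<^sub>R u"]
      by (simp add: blinfun.scaleR_right LIMSEQ_unique del: quad_iter.simps)
    show "norm (y u) \<le> norm u * 1" using y1 by simp
  qed
  then have [simp]: "blinfun_apply (Blinfun y) = y" by (simp add: bounded_linear_Blinfun_apply)
  have yy: "(\<lambda>n. ?Y n (?Y n f)) \<longlonglongrightarrow> y (y f)" for f
  proof -
    have "(\<lambda>n. ?Y n (?Y n f - y f)) \<longlonglongrightarrow> 0"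
    proof (rule Lim_null_comparison)
      show "\<forall>\<^sub>F n in sequentially. norm (?Y n (?Y n f - y f)) \<le> norm (?Y n f - y f)"
        using Y1 by (intro always_eventually) auto
      show "(\<lambda>n. norm (?Y n f - y f)) \<longlonglongrightarrow> 0"
        using y[of f] by (simp add: LIM_zero tendsto_norm_zero)
    qed
    from tendsto_add[OF this y[of "y f"]] show ?thesis by (simp add: blinfun.diff_right)
  qed
  have "y f = (1/2) *\<^sub>R (x f + a (y (y f)))" for f
  proof (rule LIMSEQ_unique[OF LIMSEQ_Suc[OF y[of f]]])
    have "(\<lambda>n. (1/2) *\<^sub>R (x f + a (?Y n (?Y n f)))) \<longlonglongrightarrow> (1/2) *\<^sub>R (x f + a (y (y f)))"
      by (intro tendsto_intros yy)
    then show "(\<lambda>n. ?Y (Suc n) f) \<longlonglongrightarrow> (1/2) *\<^sub>R (x f + a (y (y f)))"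
      by (simp add: blinfun.bilinear_simps)
  qed
  moreover have "norm (Blinfun y) \<le> 1" using y1 by (intro norm_blinfun_bound) auto
  ultimately show ?thesis using y by (intro exI[of _ "Blinfun y"]) auto
qed

lemma quad_iter_Suc: "quad_iter x a (Suc n) f = (1/2) *\<^sub>R (x f + a (quad_iter x a n (quad_iter x a n f)))"
  by (simp add: blinfun.bilinear_simps)

lemma quad_iter_commute:
  fixes x a B :: "'a::real_normed_vector endo"
  assumes "\<And>f. blinfun_apply B (x f) = x (B f)" "\<And>f. blinfun_apply B (a f) = a (B f)"
  shows "B (quad_iter x a n f) = quad_iter x a n (B f)"
proof (induction n arbitrary: f)
  case (Suc n)
  show ?case unfolding quad_iter_Suc by (simp add: blinfun.bilinear_simps assms Suc)
qed (simp add: blinfun.zero_right)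

lemma quad_iter_symmetric:
  fixes x a :: "'a::real_inner endo"
  assumes "\<And>f g. x f \<bullet> g = f \<bullet> x g" "\<And>f g. a f \<bullet> g = f \<bullet> a g" "\<And>f. a (x f) = x (a f)"
  shows "quad_iter x a n f \<bullet> g = f \<bullet> quad_iter x a n g"
proof (induction n arbitrary: f g)
  case (Suc n)
  have "a (quad_iter x a n h) = quad_iter x a n (a h)" for h
    by (rule quad_iter_commute) (simp_all add: assms(3))
  then show ?case unfolding quad_iter_Suc by (simp add: inner_add_left inner_add_right assms Suc)
qed simp

lemma quad_iter_limit_commute:
  fixes x a B :: "'a::real_normed_vector endo"
  assumes lim: "\<And>f. (\<lambda>n. quad_iter x a n f) \<longlonglongrightarrow> blinfun_apply y f"
    and "\<And>f. blinfun_apply B (x f) = x (B f)" "\<And>f. blinfun_apply B (a f) = a (B f)"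
  shows "B (y f) = y (B f)"
proof (rule LIMSEQ_unique)
  show "(\<lambda>n. B (quad_iter x a n f)) \<longlonglongrightarrow> B (y f)" by (intro blinfun.tendsto lim tendsto_const)
  show "(\<lambda>n. B (quad_iter x a n f)) \<longlonglongrightarrow> y (B f)" using lim quad_iter_commute[OF assms(2,3)] by simp
qed

lemma quad_iter_limit_symmetric:
  fixes x a :: "'a::real_inner endo"
  assumes lim: "\<And>f. (\<lambda>n. quad_iter x a n f) \<longlonglongrightarrow> blinfun_apply y f"
    and "\<And>f g. x f \<bullet> g = f \<bullet> x g" "\<And>f g. a f \<bullet> g = f \<bullet> a g" "\<And>f. a (x f) = x (a f)"
  shows "y f \<bullet> g = f \<bullet> y g"
proof (rule LIMSEQ_unique)
  show "(\<lambda>n. quad_iter x a n f \<bullet> g) \<longlonglongrightarrow> y f \<bullet> g" by (intro tendsto_intros lim)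
  have "(\<lambda>n. f \<bullet> quad_iter x a n g) \<longlonglongrightarrow> f \<bullet> y g" by (intro tendsto_intros lim)
  then show "(\<lambda>n. quad_iter x a n f \<bullet> g) \<longlonglongrightarrow> f \<bullet> y g" using quad_iter_symmetric[OF assms(2-4)] by simp
qed

lemma orthogonal_projection:
  fixes M :: "'a::{real_inner, complete_space} set"
  assumes M: "subspace M" and cl: "closed M"
  shows "\<exists>p. (\<forall>f. blinfun_apply p f \<in> M) \<and> (\<forall>f. \<forall>k\<in>M. (f - blinfun_apply p f) \<bullet> k = 0)"
proof -
  obtain p where pM: "\<And>f. p f \<in> M" and po: "\<And>f k. k \<in> M \<Longrightarrow> (f - p f) \<bullet> k = 0"
    using closed_subspace_projection[OF M cl] by metis
  have eqI: "u = v" if "u \<in> M" "v \<in> M" "\<And>k. k \<in> M \<Longrightarrow> u \<bullet> k = v \<bullet> k" for u v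
  proof -
    have "(u - v) \<bullet> (u - v) = 0"
      using that(3)[OF subspace_diff[OF M that(1,2)]] by (simp add: inner_diff_left)
    then show ?thesis by simp
  qed
  have pin: "p f \<bullet> k = f \<bullet> k" if "k \<in> M" for f k using po[OF that, of f] by (simp add: inner_diff_left)
  have "bounded_linear p"
  proof (rule bounded_linear_intro[where K=1])
    fix x y :: 'a and r :: real
    show "p (x + y) = p x + p y"
      using M pM by (intro eqI) (auto simp: pin inner_add_left subspace_add)
    show "p (r *\<^sub>R x) = r *\<^sub>R p x"
      using M pM by (intro eqI) (auto simp: pin subspace_scale)
    have "(norm (p x))\<^sup>2 = x \<bullet> p x" using pin[OF pM, of x x] by (simp add: power2_norm_eq_inner)
    also have "\<dots> \<le> norm x * norm (p x)" by (rule norm_cauchy_schwarz)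
    finally show "norm (p x) \<le> norm x * 1"
      by (cases "norm (p x) = 0") (auto simp: power2_eq_square)
  qed
  then show ?thesis using pM po by (intro exI[of _ "Blinfun p"]) (simp add: bounded_linear_Blinfun_apply)
qed

text \<open>A bounded operator \<open>p\<close> with these properties is the orthogonal projection onto \<open>M\<close>. It commutes with
  every operator that leaves \<open>M\<close> invariant together with its adjoint, which yields the compatibility
  with the complex structure, the involution and \<open>C\<close> whenever \<open>M\<close> is invariant under these.\<close>

locale closed_projection =
  fixes M :: "'a::{real_inner, complete_space} set" and p :: "'a endo"
  assumes M: "subspace M" and range: "\<And>f. p f \<in> M" and orth: "\<And>f k. k \<in> M \<Longrightarrow> (f - p f) \<bullet> k = 0"
begin

lemma eqI: "u = v" if "u \<in> M" "v \<in> M" "\<And>k. k \<in> M \<Longrightarrow> u \<bullet> k = v \<bullet> k"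
proof -
  have "(u - v) \<bullet> (u - v) = 0"
    using that(3)[OF subspace_diff[OF M that(1,2)]] by (simp add: inner_diff_left)
  then show ?thesis by simp
qed

lemma inner_eq: "k \<in> M \<Longrightarrow> p f \<bullet> k = f \<bullet> k"
  using orth[of k f] by (simp add: inner_diff_left)

lemma fixed: "k \<in> M \<Longrightarrow> p k = k"
  by (rule eqI) (auto simp: range inner_eq)

lemma idem: "p (p f) = p f"
  by (simp add: fixed range)

lemma symmetric: "p f \<bullet> g = f \<bullet> p g"
  by (metis inner_eq inner_commute range)

lemma commute:
  assumes "\<And>f g. T f \<bullet> g = f \<bullet> T' g" "\<And>f. f \<in> M \<Longrightarrow> T f \<in> M" "\<And>f. f \<in> M \<Longrightarrow> T' f \<in> M"
  shows "p (T f) = T (p f)"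
  by (rule eqI) (auto simp: assms range inner_eq)

end

context selfdual_hilbert_space
begin

section \<open>The complex structure, the involution and the form\<close>

definition J :: "'k \<Rightarrow> 'k" where "J f = scaleC \<i> f"

lemma P1_lin: "Vector_Spaces.linear scaleC scaleC P1" and P1_idem [simp]: "P1 (P1 f) = P1 f"
  and P1_sym: "\<kappa> f (P1 g) = \<kappa> (P1 f) g" and P1_bar: "P1 f + star (P1 (star f)) = f"
  using P1 unfolding basis_projection_def bar_def by (auto simp: fun_eq_iff)

lemma P1_add: "P1 (f + g) = P1 f + P1 g" and P1_scale: "P1 (scaleC c f) = scaleC c (P1 f)"
proof -
  interpret l: Vector_Spaces.linear scaleC scaleC P1 by (rule P1_lin)
  show "P1 (f + g) = P1 f + P1 g" "P1 (scaleC c f) = scaleC c (P1 f)" by (rule l.add l.scale)+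
qed

lemma P1_zero [simp]: "P1 0 = 0" using P1_add[of 0 0] by simp
lemma P1_minus: "P1 (- f) = - P1 f" using P1_add[of f "- f"] by (simp add: eq_neg_iff_add_eq_0 add.commute)
lemma P1_diff: "P1 (f - g) = P1 f - P1 g" using P1_add[of f "- g"] by (simp add: P1_minus)

lemma star_zero [simp]: "star 0 = 0" using star_add[of 0 0] by simp
lemma star_minus: "star (- f) = - star f"
  using star_add[of f "- f"] by (simp add: eq_neg_iff_add_eq_0 add.commute)
lemma star_diff: "star (f - g) = star f - star g" using star_add[of f "- g"] by (simp add: star_minus)
declare star_star [simp]

lemma star_inj: "star f = star g \<longleftrightarrow> f = g" by (metis star_star)

lemma P1_star: "P1 (star f) = star (P2 f)"
proof -
  have "star (P1 (star f)) = P2 f" using P1_bar[of f] by (simp add: P2_def algebra_simps)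
  then show ?thesis by (metis star_star)
qed

lemma P2_star: "P2 (star f) = star (P1 f)"
  unfolding P2_def P1_star by (simp add: P2_def star_diff)

lemma C_alt: "C f = 2 *\<^sub>R P1 f - f"
  by (simp add: C_def P2_def scaleR_2)

lemma C_C [simp]: "C (C f) = f"
  by (simp add: C_def P2_def P1_diff)

lemma C_star: "C (star f) = - star (C f)"
  by (simp add: C_def P1_star P2_star star_diff)

lemma C_add: "C (f + g) = C f + C g" by (simp add: C_def P2_def P1_add algebra_simps)
lemma C_scale: "C (scaleC c f) = scaleC c (C f)"
  by (simp add: C_def P2_def P1_scale scale_right_diff_distrib)

lemma kappa_add_left: "\<kappa> (f + g) h = \<kappa> f h + \<kappa> g h"
  by (metis complex_cnj_add kappa_add_right kappa_hermitian)

lemma kappa_scale_left: "\<kappa> (scaleC c f) g = cnj c * \<kappa> f g"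
  by (metis complex_cnj_mult kappa_hermitian kappa_scale_right)

lemma kappa_zero [simp]: "\<kappa> f 0 = 0" "\<kappa> 0 f = 0"
  using kappa_add_right[of f 0 0] kappa_add_left[of 0 0 f] by auto

lemma kappa_diff_right: "\<kappa> f (g - h) = \<kappa> f g - \<kappa> f h"
  using kappa_add_right[of f "g - h" h] by simp

lemma kappa_diff_left: "\<kappa> (f - g) h = \<kappa> f h - \<kappa> g h"
  using kappa_add_left[of "f - g" g h] by simp

lemma kappa_C: "\<kappa> (C f) g = \<kappa> f (C g)"
  by (simp add: C_def P2_def kappa_diff_left kappa_diff_right P1_sym)

lemma ip_add_left: "ip (f + g) h = ip f h + ip g h" and ip_add_right: "ip f (g + h) = ip f g + ip f h"
  by (simp_all add: ip_def kappa_add_left kappa_add_right C_add)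

lemma ip_scale_left: "ip (scaleC c f) g = cnj c * ip f g"
  and ip_scale_right: "ip f (scaleC c g) = c * ip f g"
  by (simp_all add: ip_def kappa_scale_left kappa_scale_right C_scale)

lemma ip_zero [simp]: "ip f 0 = 0" "ip 0 f = 0"
  using ip_add_right[of f 0 0] ip_add_left[of 0 0 f] by auto

lemma ip_commute: "ip g f = cnj (ip f g)"
  unfolding ip_def by (metis kappa_hermitian kappa_C)

lemma ip_star: "ip (star f) (star g) = ip g f"
proof -
  have "star (- C g) = - star (C g)" by (rule star_minus)
  then have "ip (star f) (star g) = \<kappa> (star f) (star (- C g))" by (simp add: ip_def C_star)
  also have "\<dots> = - \<kappa> (- C g) f" by (rule kappa_star)
  also have "\<dots> = \<kappa> (C g) f" using kappa_diff_left[of 0 "C g" f] by simp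
  finally show ?thesis by (simp add: kappa_C ip_def)
qed

lemma J_J [simp]: "J (J f) = - f"
  by (simp add: J_def)

lemma scaleC_alt: "scaleC c f = Re c *\<^sub>R f + Im c *\<^sub>R J f"
proof -
  have "scaleC c f = scaleC (of_real (Re c) + of_real (Im c) * \<i>) f"
    by (simp add: complex_eq mult.commute)
  also have "\<dots> = scaleC (of_real (Re c)) f + scaleC (of_real (Im c)) (scaleC \<i> f)"
    by (simp only: scale_left_distrib scale_scale)
  finally show ?thesis by (simp add: scaleR_eq J_def)
qed

lemma Im_ip: "Im (ip f g) = J f \<bullet> g"
  by (simp add: inner_eq J_def ip_scale_left)

text \<open>The complex inner product is determined by the real one and \<open>J\<close>. Consequently statements about
  operators that commute with \<open>J\<close> can be checked with the real inner product.\<close>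

lemma ip_eq: "ip f g = Complex (f \<bullet> g) (J f \<bullet> g)"
  by (rule complex_eqI) (simp_all add: Im_ip inner_eq)

lemma inner_J_J: "J f \<bullet> J g = f \<bullet> g"
  by (simp add: inner_eq J_def ip_scale_left ip_scale_right)

lemma inner_J: "J f \<bullet> g = - (f \<bullet> J g)"
  using inner_J_J[of f "J g"] by simp

lemma inner_star: "star f \<bullet> g = f \<bullet> star g"
  using ip_star[of "star f" g] by (simp add: inner_eq) (metis ip_commute complex_cnj_cnj cnj.sel(1))

lemma inner_star_star: "star f \<bullet> star g = f \<bullet> g"
  by (simp add: inner_star)

lemma inner_C: "C f \<bullet> g = f \<bullet> C g"
  by (simp add: inner_eq ip_def kappa_C)

lemma inner_P1: "P1 f \<bullet> g = f \<bullet> P1 g"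
proof -
  have "P1 h = (1/2) *\<^sub>R (C h + h)" for h by (simp add: C_alt)
  then show ?thesis by (simp add: inner_add_left inner_add_right inner_C)
qed

lemma star_scaleR: "star (r *\<^sub>R f) = r *\<^sub>R star f"
  by (simp add: scaleR_eq star_scale)

lemma J_star: "J (star f) = - star (J f)"
  by (simp add: J_def star_scale)

lemma J_add: "J (f + g) = J f + J g" by (simp add: J_def scale_right_distrib)
lemma J_scaleR: "J (r *\<^sub>R f) = r *\<^sub>R J f" by (simp add: J_def scaleR_eq mult.commute)

lemma C_J: "C (J f) = J (C f)" by (simp add: J_def C_scale)
lemma P1_J: "P1 (J f) = J (P1 f)" by (simp add: J_def P1_scale)

lemma C_scaleR: "C (r *\<^sub>R f) = r *\<^sub>R C f" by (simp add: scaleR_eq C_scale)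
lemma P1_scaleR: "P1 (r *\<^sub>R f) = r *\<^sub>R P1 f" by (simp add: scaleR_eq P1_scale)

lemma norm_C [simp]: "norm (C f) = norm f"
  by (simp add: norm_eq_sqrt_inner inner_C)

lemma norm_star [simp]: "norm (star f) = norm f"
  by (simp add: norm_eq_sqrt_inner inner_star)

lemma norm_J [simp]: "norm (J f) = norm f"
  by (simp add: norm_eq_sqrt_inner inner_J_J)

lemma norm_P1_le: "norm (P1 f) \<le> norm f"
proof -
  have "P1 f = (1/2) *\<^sub>R (C f + f)" by (simp add: C_alt)
  then have "norm (P1 f) \<le> 1/2 * (norm (C f) + norm f)"
    by (metis abs_of_nonneg half_nonnegative_int_iff mult_left_mono norm_scaleR norm_triangle_ineq
        zero_le_divide_1_iff zero_le_numeral)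
  then show ?thesis by simp
qed

lemma bounded_linear_C: "bounded_linear C"
  by (rule bounded_linear_intro[where K=1]) (simp_all add: C_add C_scaleR)
lemma bounded_linear_J: "bounded_linear J"
  by (rule bounded_linear_intro[where K=1]) (simp_all add: J_add J_scaleR)
lemma bounded_linear_star: "bounded_linear star"
  by (rule bounded_linear_intro[where K=1]) (simp_all add: star_add star_scaleR)
lemma bounded_linear_P1: "bounded_linear P1"
  by (rule bounded_linear_intro[where K=1]) (simp_all add: P1_add P1_scaleR norm_P1_le)

definition bC :: "'k endo" where "bC = Blinfun C"
definition bJ :: "'k endo" where "bJ = Blinfun J"
definition bstar :: "'k endo" where "bstar = Blinfun star"
definition bP1 :: "'k endo" where "bP1 = Blinfun P1"
definition bP2 :: "'k endo" where "bP2 = id_blinfun - bP1"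

lemma b_apply [simp]: "blinfun_apply bC = C" "blinfun_apply bJ = J" "blinfun_apply bstar = star"
  "blinfun_apply bP1 = P1" "blinfun_apply bP2 = P2"
  by (simp_all add: bC_def bJ_def bstar_def bP1_def bP2_def bounded_linear_Blinfun_apply bounded_linear_C
      bounded_linear_J bounded_linear_star bounded_linear_P1 fun_eq_iff P2_def blinfun.bilinear_simps)

lemma C_diff: "C (f - g) = C f - C g" and C_minus: "C (- f) = - C f" and C_zero [simp]: "C 0 = 0"
  using bounded_linear.linear[OF bounded_linear_C] by (simp_all add: linear_diff linear_neg linear_0)
lemma J_diff: "J (f - g) = J f - J g" and J_minus: "J (- f) = - J f" and J_zero [simp]: "J 0 = 0"
  using bounded_linear.linear[OF bounded_linear_J] by (simp_all add: linear_diff linear_neg linear_0)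

lemmas lin_simps = C_add C_diff C_minus C_scaleR J_add J_diff J_minus J_scaleR
  star_add star_diff star_minus star_scaleR P1_add P1_diff P1_minus P1_scaleR blinfun.bilinear_simps

section \<open>Admissible operators and the semigroup\<close>

text \<open>All operators to be considered commute with \<open>J\<close>, which means complex linearity. Commuting with the
  involution is a separate condition, which blocks and partial isometries on \<open>H1\<close> do not satisfy.\<close>

definition clin :: "'k endo \<Rightarrow> bool" where "clin T \<longleftrightarrow> (\<forall>f. T (J f) = J (T f))"
definition adm :: "'k endo \<Rightarrow> bool"
  where "adm T \<longleftrightarrow> (\<forall>f. T (J f) = J (T f)) \<and> (\<forall>f. T (star f) = star (T f))"

lemma linear_iff_clin: "Vector_Spaces.linear scaleC scaleC (blinfun_apply T) \<longleftrightarrow> clin T"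
proof
  assume "Vector_Spaces.linear scaleC scaleC (blinfun_apply T)"
  then interpret l: Vector_Spaces.linear scaleC scaleC "blinfun_apply T" .
  show "clin T" by (simp add: clin_def J_def l.scale)
next
  assume "clin T"
  then have "blinfun_apply T (scaleC c f) = scaleC c (T f)" for c f
    by (simp add: clin_def scaleC_alt lin_simps)
  then show "Vector_Spaces.linear scaleC scaleC (blinfun_apply T)"
    by (unfold_locales) (auto simp: lin_simps)
qed

lemma clin_hadj: "clin T \<Longrightarrow> clin (hadj T)"
  unfolding clin_def
  by (intro allI, rule vector_eq_rdot[THEN iffD1])
     (simp add: inner_hadj_left inner_J)

lemma adm_hadj: "adm T \<Longrightarrow> adm (hadj T)"
  unfolding adm_def
  by (intro allI conjI; rule vector_eq_rdot[THEN iffD1])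
     (simp_all add: inner_hadj_left inner_J inner_star)

lemma adj_eq: assumes T: "clin T" shows "adj T = hadj T"
  unfolding adj_def
proof (rule the_equality)
  show "\<forall>f g. ip (hadj T f) g = ip f (T g)"
    using T clin_hadj[OF T] by (auto simp: ip_eq inner_hadj_left clin_def) (metis inner_hadj_left)
next
  fix B assume B: "\<forall>f g. ip (B f) g = ip f (T g)"
  show "B = hadj T"
    by (rule ext, rule hadj_unique) (simp add: inner_eq B)
qed

lemma dagger_eq: "clin T \<Longrightarrow> dagger T f = C (hadj T (C f))"
  by (simp add: dagger_def adj_eq)

text \<open>The condition \<open>V\<^sup>\<dagger> V = 1\<close> says that \<open>V\<close> preserves \<open>\<kappa>\<close>; as \<open>V\<close> is complex linear, it suffices to
  preserve the real part of \<open>\<kappa>\<close>, which is \<open>f \<bullet> C g\<close>.\<close>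

lemma S_iff: "V \<in> S \<longleftrightarrow> adm V \<and> (\<forall>f g. V f \<bullet> C (V g) = f \<bullet> C g)"
proof -
  have 1: "bar V = V \<longleftrightarrow> (\<forall>f. V (star f) = star (V f))"
    by (auto simp: bar_def fun_eq_iff) (metis star_star)+
  have 2: "dagger V \<circ> V = id \<longleftrightarrow> (\<forall>f g. V f \<bullet> C (V g) = f \<bullet> C g)" if "clin V"
  proof -
    have "(dagger V \<circ> V = id) \<longleftrightarrow> (\<forall>f. C (hadj V (C (V f))) = f)"
      by (simp add: fun_eq_iff dagger_eq[OF that])
    also have "\<dots> \<longleftrightarrow> (\<forall>f. hadj V (C (V f)) = C f)" by (metis C_C)
    also have "\<dots> \<longleftrightarrow> (\<forall>f g. hadj V (C (V f)) \<bullet> g = C f \<bullet> g)"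
      using vector_eq_rdot by blast
    also have "\<dots> \<longleftrightarrow> (\<forall>f g. V f \<bullet> C (V g) = f \<bullet> C g)"
      by (simp add: inner_hadj_left inner_C)
    finally show ?thesis .
  qed
  show ?thesis unfolding S_def mem_Collect_eq linear_iff_clin 1 adm_def using 2 by (auto simp: clin_def)
qed

lemma assumes "V \<in> S" shows S_J: "V (J f) = J (V f)" and S_star: "V (star f) = star (V f)"
  and S_form: "V f \<bullet> C (V g) = f \<bullet> C g" and S_clin: "clin V" and S_adm: "adm V"
  using assms by (auto simp: S_iff adm_def clin_def)

end

lemma orthogonal_family_sum_norm:
  fixes v :: "'i \<Rightarrow> 'a::real_inner"
  assumes "finite F" "\<And>i j. i \<in> F \<Longrightarrow> j \<in> F \<Longrightarrow> i \<noteq> j \<Longrightarrow> v i \<bullet> v j = 0"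
  shows "(norm (sum v F))\<^sup>2 = (\<Sum>i\<in>F. (norm (v i))\<^sup>2)"
proof -
  have "(norm (sum v F))\<^sup>2 = (\<Sum>i\<in>F. \<Sum>j\<in>F. v j \<bullet> v i)"
    by (simp add: power2_norm_eq_inner inner_sum_left inner_sum_right)
  also have "\<dots> = (\<Sum>i\<in>F. \<Sum>j\<in>F. if j = i then v i \<bullet> v i else 0)"
    using assms by (intro sum.cong refl) auto
  finally show ?thesis using assms(1) by (simp add: power2_norm_eq_inner)
qed

text \<open>By the Pythagorean theorem the net of finite partial sums is Cauchy as soon as the
  squared norms are summable.\<close>

lemma orthogonal_family_summable:
  fixes v :: "'i \<Rightarrow> 'a::{real_inner, complete_space}"
  assumes orth: "\<And>i j. i \<in> A \<Longrightarrow> j \<in> A \<Longrightarrow> i \<noteq> j \<Longrightarrow> v i \<bullet> v j = 0"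
    and sq: "(\<lambda>i. (norm (v i))\<^sup>2) summable_on A"
  shows "v summable_on A"
proof -
  let ?q = "\<lambda>i. (norm (v i))\<^sup>2"
  obtain L where lim: "(sum ?q \<longlongrightarrow> L) (finite_subsets_at_top A)"
    using sq unfolding summable_on_def has_sum_def by blast
  have "\<exists>P. eventually P (finite_subsets_at_top A) \<and> (\<forall>F F'. P F \<and> P F' \<longrightarrow> dist (sum v F) (sum v F') < e)"
    if e: "0 < e" for e
  proof -
    have "eventually (\<lambda>F. dist (sum ?q F) L < e\<^sup>2 / 8) (finite_subsets_at_top A)"
      by (rule tendstoD[OF lim]) (use e in simp)
    then obtain G where G': "finite G \<and> G \<subseteq> A \<and>
        (\<forall>F. finite F \<and> G \<subseteq> F \<and> F \<subseteq> A \<longrightarrow> dist (sum ?q F) L < e\<^sup>2 / 8)"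
      unfolding eventually_finite_subsets_at_top ..
    then have G: "finite G" "G \<subseteq> A" by auto
    have GL: "dist (sum ?q F) L < e\<^sup>2 / 8" if "finite F" "G \<subseteq> F" "F \<subseteq> A" for F
      using G' that by blast
    have near: "dist (sum v F) (sum v G) < e / 2" if F: "finite F" "G \<subseteq> F" "F \<subseteq> A" for F
    proof -
      have "(dist (sum v F) (sum v G))\<^sup>2 = (norm (sum v (F - G)))\<^sup>2"
        using F by (simp add: dist_norm sum_diff)
      also have "\<dots> = sum ?q (F - G)"
        using F by (intro orthogonal_family_sum_norm orth) auto
      also have "\<dots> = sum ?q F - sum ?q G"
        using F by (simp add: sum_diff)
      also have "\<dots> \<le> dist (sum ?q F) L + dist (sum ?q G) L"
        unfolding dist_real_def by linarith
      also have "\<dots> < e\<^sup>2 / 8 + e\<^sup>2 / 8"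
        by (intro add_strict_mono GL F G order_refl)
      also have "\<dots> = (e / 2)\<^sup>2" by (simp add: power_divide)
      finally show ?thesis by (rule power2_less_imp_less) (use e in simp)
    qed
    show ?thesis
    proof (intro exI[of _ "\<lambda>F. finite F \<and> G \<subseteq> F \<and> F \<subseteq> A"] conjI allI impI)
      show "\<forall>\<^sub>F F in finite_subsets_at_top A. finite F \<and> G \<subseteq> F \<and> F \<subseteq> A"
        using G unfolding eventually_finite_subsets_at_top by blast
      fix F F' assume "(finite F \<and> G \<subseteq> F \<and> F \<subseteq> A) \<and> (finite F' \<and> G \<subseteq> F' \<and> F' \<subseteq> A)"
      then show "dist (sum v F) (sum v F') < e"
        using near[of F] near[of F'] dist_triangle_half_l by blast
    qed
  qed
  then have "cauchy_filter (filtermap (sum v) (finite_subsets_at_top A))"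
    by (simp add: cauchy_filter_metric_filtermap)
  then obtain L' where "(sum v \<longlongrightarrow> L') (finite_subsets_at_top A)"
    using complete_UNIV[where ?'a='a] complete_uniform[where S="UNIV::'a set"] by (force simp: filterlim_def)
  then show ?thesis using summable_on_def has_sum_def by blast
qed

lemma has_sum_in_closed_subspace:
  fixes v :: "'i \<Rightarrow> 'a::real_normed_vector"
  assumes "(v has_sum s) A" "subspace M" "closed M" "\<And>i. i \<in> A \<Longrightarrow> v i \<in> M"
  shows "s \<in> M"
proof (rule Lim_in_closed_set[OF assms(3) _ finite_subsets_at_top_neq_bot])
  show "(sum v \<longlongrightarrow> s) (finite_subsets_at_top A)" using assms(1) by (simp add: has_sum_def)
  show "\<forall>\<^sub>F F in finite_subsets_at_top A. sum v F \<in> M"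
    using assms(2,4) by (intro eventually_finite_subsets_at_top_weakI subspace_sum) auto
qed

context selfdual_hilbert_space
begin

section \<open>Orthonormal bases and dimension\<close>

definition orthonormal :: "'k set \<Rightarrow> bool"
  where "orthonormal E \<longleftrightarrow> (\<forall>e\<in>E. \<forall>e'\<in>E. ip e e' = (if e = e' then 1 else 0))"

text \<open>An orthonormal basis of a closed subspace \<open>M\<close>. Completeness is expressed by the absence of nonzero
  vectors of \<open>M\<close> orthogonal to \<open>E\<close>, so that no closure of a span is involved and a subset of a
  basis is visibly a basis of the orthogonal complement of the rest.\<close>

definition onb :: "'k set \<Rightarrow> 'k set \<Rightarrow> bool"
  where "onb M E \<longleftrightarrow> orthonormal E \<and> E \<subseteq> M \<and> (\<forall>f\<in>M. (\<forall>e\<in>E. ip e f = 0) \<longrightarrow> f = 0)"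

definition csub :: "'k set \<Rightarrow> bool"
  where "csub M \<longleftrightarrow> Real_Vector_Spaces.subspace M \<and> closed M \<and> (\<forall>f\<in>M. J f \<in> M)"

lemma csub_add: assumes "csub M" "f \<in> M" "g \<in> M" shows "f + g \<in> M"
  using assms real_vector.subspace_add unfolding csub_def by metis

lemma csub_diff: assumes "csub M" "f \<in> M" "g \<in> M" shows "f - g \<in> M"
  using assms real_vector.subspace_diff unfolding csub_def by metis

lemma csub_scaleR: assumes "csub M" "f \<in> M" shows "r *\<^sub>R f \<in> M"
  using assms real_vector.subspace_scale unfolding csub_def by metis

lemma csub_J: assumes "csub M" "f \<in> M" shows "J f \<in> M"
  using assms unfolding csub_def by simp

lemma csub_scaleC: "csub M \<Longrightarrow> f \<in> M \<Longrightarrow> scaleC c f \<in> M"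
  by (simp only: scaleC_alt) (intro csub_add csub_scaleR csub_J)

lemma csub_has_sum:
  assumes "csub M" "(v has_sum s) A" "\<And>i. i \<in> A \<Longrightarrow> v i \<in> M" shows "s \<in> M"
  using assms(1) unfolding csub_def by (intro has_sum_in_closed_subspace[OF assms(2) _ _ assms(3)]) auto

lemma csub_UNIV [simp]: "csub UNIV"
  by (simp add: csub_def)

lemma ip_self: "ip f f = of_real ((norm f)\<^sup>2)"
  by (rule complex_eqI) (use inner_J[of f f] in \<open>simp_all add: ip_eq power2_norm_eq_inner inner_commute\<close>)

lemma ip_scaleR_left: "ip (r *\<^sub>R f) g = of_real r * ip f g" and ip_scaleR_right: "ip f (r *\<^sub>R g) = of_real r * ip f g"
  by (simp_all add: scaleR_eq ip_scale_left ip_scale_right)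

lemma ip_diff_right: "ip h (f - g) = ip h f - ip h g"
  by (simp add: ip_def kappa_diff_right C_diff)

lemma ip_sum_right: "ip f (sum g A) = (\<Sum>i\<in>A. ip f (g i))"
  by (induction A rule: infinite_finite_induct) (simp_all add: ip_add_right)

lemma bounded_linear_ip: "bounded_linear (ip f)"
proof (rule bounded_linear_intro[where K="2 * norm f"])
  fix x y :: 'k and r :: real
  show "ip f (x + y) = ip f x + ip f y" by (rule ip_add_right)
  show "ip f (r *\<^sub>R x) = r *\<^sub>R ip f x" by (simp add: ip_scaleR_right scaleR_conv_of_real)
  have "cmod (ip f x) \<le> \<bar>f \<bullet> x\<bar> + \<bar>J f \<bullet> x\<bar>"
    using cmod_le[of "ip f x"] by (simp add: ip_eq)
  also have "\<dots> \<le> norm f * norm x + norm (J f) * norm x"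
    by (intro add_mono Cauchy_Schwarz_ineq2)
  finally show "norm (ip f x) \<le> norm x * (2 * norm f)" by (simp add: algebra_simps)
qed

lemma orthonormalD: "orthonormal E \<Longrightarrow> e \<in> E \<Longrightarrow> e' \<in> E \<Longrightarrow> ip e e' = (if e = e' then 1 else 0)"
  by (simp add: orthonormal_def)

lemma orthonormal_norm: "orthonormal E \<Longrightarrow> e \<in> E \<Longrightarrow> norm e = 1"
  by (simp add: norm_eq_sqrt_inner inner_eq orthonormalD)

lemma norm_scaleC: "norm (scaleC c f) = cmod c * norm f"
proof -
  have "of_real ((norm (scaleC c f))\<^sup>2) = (c * cnj c) * of_real ((norm f)\<^sup>2)"
    unfolding ip_self[symmetric] by (simp add: ip_scale_left ip_scale_right mult.assoc)
  also have "\<dots> = complex_of_real ((cmod c * norm f)\<^sup>2)"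
    by (simp only: complex_norm_square[symmetric] power_mult_distrib of_real_mult of_real_power)
  finally have "(norm (scaleC c f))\<^sup>2 = (cmod c * norm f)\<^sup>2" by (simp only: of_real_eq_iff)
  then show ?thesis by (rule power2_eq_imp_eq) auto
qed

text \<open>An orthonormal subset of \<open>M\<close> that is maximal for inclusion is a basis, since a nonzero vector orthogonal to
  it could be normalized and added.\<close>

lemma onb_exists:
  assumes M: "csub M"
  shows "\<exists>E. onb M E"
proof -
  let ?A = "{E. orthonormal E \<and> E \<subseteq> M}"
  have "\<exists>E\<in>?A. \<forall>X\<in>?A. E \<subseteq> X \<longrightarrow> X = E"
  proof (rule subset_Zorn)
    fix \<C> assume ch: "subset.chain ?A \<C>"
    then have sub: "\<C> \<subseteq> ?A" and tot: "\<And>X Y. X \<in> \<C> \<Longrightarrow> Y \<in> \<C> \<Longrightarrow> X \<subseteq> Y \<or> Y \<subseteq> X"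
      by (auto simp: subset_chain_def)
    have "orthonormal (\<Union>\<C>)"
      unfolding orthonormal_def
    proof (intro ballI)
      fix e e' assume "e \<in> \<Union>\<C>" "e' \<in> \<Union>\<C>"
      then obtain X Y where "X \<in> \<C>" "e \<in> X" "Y \<in> \<C>" "e' \<in> Y" by blast
      then obtain Z where "Z \<in> \<C>" "e \<in> Z" "e' \<in> Z" using tot[of X Y] by blast
      then show "ip e e' = (if e = e' then 1 else 0)" using sub orthonormalD[of Z] by blast
    qed
    then show "\<exists>U\<in>?A. \<forall>X\<in>\<C>. X \<subseteq> U" using sub by (intro bexI[of _ "\<Union>\<C>"]) auto
  qed
  then obtain E where "E \<in> ?A" and max0: "\<forall>X\<in>?A. E \<subseteq> X \<longrightarrow> X = E"
    by (rule bexE)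
  then have E: "orthonormal E" "E \<subseteq> M" by auto
  have max: "X = E" if "orthonormal X" "X \<subseteq> M" "E \<subseteq> X" for X
    using max0 that by blast
  have "f = 0" if f: "f \<in> M" "\<forall>e\<in>E. ip e f = 0" for f
  proof (rule ccontr)
    assume nz: "f \<noteq> 0"
    define g where "g = (1 / norm f) *\<^sub>R f"
    have g: "ip g g = 1" "g \<in> M"
      using nz csub_scaleR[OF M f(1)] by (auto simp: g_def ip_scaleR_left ip_scaleR_right ip_self power2_eq_square)
    have eg: "ip e g = 0" "ip g e = 0" if "e \<in> E" for e
      using f(2) that ip_commute[of g e] by (auto simp: g_def ip_scaleR_right)
    have "orthonormal (insert g E)"
      using E(1) g(1) eg unfolding orthonormal_def by auto
    then have "g \<in> E" using max[of "insert g E"] g(2) E(2) by blast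
    then show False using eg(1)[of g] g(1) by simp
  qed
  then show ?thesis using E by (auto simp: onb_def)
qed

text \<open>Orthonormal vectors have mutual distance \<open>sqrt 2\<close>, so that points of a countable dense set at distance
  less than \<open>1/2\<close> from them are distinct.\<close>

lemma orthonormal_countable:
  assumes "orthonormal E" shows "countable E"
proof -
  obtain D :: "'k set" where D: "countable D" "\<And>X. open X \<Longrightarrow> X \<noteq> {} \<Longrightarrow> \<exists>d\<in>D. d \<in> X"
    using countable_dense_setE by blast
  have "\<exists>d\<in>D. d \<in> ball e (1/2)" for e by (rule D(2)) auto
  then obtain g where g: "\<And>e. g e \<in> D" "\<And>e. dist e (g e) < 1/2"
    by (metis mem_ball)
  have "inj_on g E"
  proof (rule inj_onI, rule ccontr)
    fix e e' assume e: "e \<in> E" "e' \<in> E" "g e = g e'" "e \<noteq> e'"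
    have "dist e e' < 1" using g(2)[of e] g(2)[of e'] e(3) dist_triangle_half_l[of e "g e" 1 e'] by simp
    moreover have "(dist e e')\<^sup>2 = 2"
    proof -
      have "e \<bullet> e' = 0" "e \<bullet> e = 1" "e' \<bullet> e' = 1"
        using orthonormalD[OF assms] e by (simp_all add: inner_eq)
      then show ?thesis unfolding dist_norm power2_norm_eq_inner
        by (simp add: inner_diff_left inner_diff_right inner_commute)
    qed
    ultimately show False by (smt (verit) one_le_power power_le_one zero_le_dist)
  qed
  then show ?thesis using D(1) g(1) by (meson countable_image_inj_on countable_subset image_subsetI)
qed

lemma orthonormal_sum_sq:
  assumes E: "orthonormal E" and F: "finite F" "F \<subseteq> E"
  shows "(norm (f - (\<Sum>e\<in>F. scaleC (ip e f) e)))\<^sup>2 = (norm f)\<^sup>2 - (\<Sum>e\<in>F. (cmod (ip e f))\<^sup>2)"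
proof -
  let ?s = "\<Sum>e\<in>F. scaleC (ip e f) e"
  have s: "ip e ?s = ip e f" if "e \<in> F" for e
  proof -
    have "ip e ?s = (\<Sum>e'\<in>F. ip e' f * (if e = e' then 1 else 0))"
      unfolding ip_sum_right ip_scale_right using orthonormalD[OF E] subsetD[OF F(2)] that
      by (intro sum.cong refl) auto
    then show ?thesis using F that by (simp add: sum.delta' if_distrib cong: if_cong)
  qed
  have "ip (f - ?s) ?s = (\<Sum>e\<in>F. ip e f * ip (f - ?s) e)"
    by (simp add: ip_sum_right ip_scale_right)
  also have "\<dots> = 0"
  proof (rule sum.neutral, rule ballI)
    fix e assume "e \<in> F"
    then have "ip e (f - ?s) = 0" using s by (simp add: ip_diff_right)
    then show "ip e f * ip (f - ?s) e = 0" using ip_commute[of "f - ?s" e] by simp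
  qed
  finally have o: "(f - ?s) \<bullet> ?s = 0" by (simp add: inner_eq)
  have "(norm f)\<^sup>2 = (norm (f - ?s))\<^sup>2 + (norm ?s)\<^sup>2"
    using o unfolding power2_norm_eq_inner by (simp add: inner_diff_left inner_diff_right inner_commute)
  moreover have "(norm ?s)\<^sup>2 = (\<Sum>e\<in>F. (norm (scaleC (ip e f) e))\<^sup>2)"
    using orthonormalD[OF E] F
    by (intro orthogonal_family_sum_norm) (auto simp: inner_eq ip_scale_left ip_scale_right subset_iff)
  moreover have "\<dots> = (\<Sum>e\<in>F. (cmod (ip e f))\<^sup>2)"
    using orthonormal_norm[OF E] F by (intro sum.cong refl) (auto simp: norm_scaleC)
  ultimately show ?thesis by simp
qed

lemma bessel:
  assumes E: "orthonormal E"
  shows "(\<lambda>e. (cmod (ip e f))\<^sup>2) summable_on E"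
proof (rule nonneg_bdd_above_summable_on)
  show "bdd_above (sum (\<lambda>e. (cmod (ip e f))\<^sup>2) ` {F. F \<subseteq> E \<and> finite F})"
  proof (rule bdd_aboveI2)
    fix F assume "F \<in> {F. F \<subseteq> E \<and> finite F}"
    then show "(\<Sum>e\<in>F. (cmod (ip e f))\<^sup>2) \<le> (norm f)\<^sup>2"
      using orthonormal_sum_sq[OF E, of F f] zero_le_power2[of "norm (f - (\<Sum>e\<in>F. scaleC (ip e f) e))"] by simp
  qed
qed simp

text \<open>A Fourier series may be transported along a bijection of orthonormal sets: its terms remain
  orthogonal, and their squared norms are summable by Bessel's inequality.\<close>

lemma fourier_transport_summable:
  assumes E: "orthonormal E" and \<phi>: "inj_on \<phi> E" "orthonormal (\<phi> ` E)"
  shows "(\<lambda>e. scaleC (ip e f) (\<phi> e)) summable_on E"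
proof (rule orthogonal_family_summable)
  fix i j assume "i \<in> E" "j \<in> E" "i \<noteq> j"
  then have "\<phi> i \<noteq> \<phi> j" "ip (\<phi> i) (\<phi> j) = 0"
    using \<phi>(1) orthonormalD[OF \<phi>(2), of "\<phi> i" "\<phi> j"] by (auto simp: inj_on_def)
  then show "scaleC (ip i f) (\<phi> i) \<bullet> scaleC (ip j f) (\<phi> j) = 0"
    by (simp add: inner_eq ip_scale_left ip_scale_right)
next
  have "(norm (scaleC (ip e f) (\<phi> e)))\<^sup>2 = (cmod (ip e f))\<^sup>2" if "e \<in> E" for e
    using that orthonormal_norm[OF \<phi>(2), of "\<phi> e"] by (simp add: norm_scaleC)
  then show "(\<lambda>e. (norm (scaleC (ip e f) (\<phi> e)))\<^sup>2) summable_on E"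
    using bessel[OF E, of f] by (metis (mono_tags, lifting) summable_on_cong)
qed

lemma fourier_coefficient:
  assumes E: "orthonormal E" and \<phi>: "inj_on \<phi> E" "orthonormal (\<phi> ` E)"
    and s: "((\<lambda>e. scaleC (ip e f) (\<phi> e)) has_sum s) E" and e: "e \<in> E"
  shows "ip (\<phi> e) s = ip e f"
proof -
  have "((\<lambda>e'. ip (\<phi> e) (scaleC (ip e' f) (\<phi> e'))) has_sum ip (\<phi> e) s) E"
    using has_sum_bounded_linear[OF bounded_linear_ip s, of "\<phi> e"] by (simp add: o_def)
  moreover have cg: "ip (\<phi> e) (scaleC (ip e' f) (\<phi> e')) = (if e' = e then ip e f else 0)" if "e' \<in> E" for e'
    using that e \<phi>(1) orthonormalD[OF \<phi>(2), of "\<phi> e" "\<phi> e'"]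
    by (auto simp: ip_scale_right inj_on_def)
  ultimately have 1: "((\<lambda>e'. if e' = e then ip e f else 0) has_sum ip (\<phi> e) s) E"
    by (subst (asm) has_sum_cong[OF cg])
  have "((\<lambda>e'. if e' = e then ip e f else 0) has_sum ip e f) {e}"
    using has_sum_finite[of "{e}" "\<lambda>e'. if e' = e then ip e f else 0"] by simp
  then have "((\<lambda>e'. if e' = e then ip e f else 0) has_sum ip e f) E"
    using e has_sum_cong_neutral[of "{e}" E "\<lambda>e'. if e' = e then ip e f else 0" "\<lambda>e'. if e' = e then ip e f else 0"]
    by auto
  then show ?thesis using 1 has_sum_unique by blast
qed

lemma onb_expansion:
  assumes M: "csub M" and E: "onb M E" and f: "f \<in> M"
  shows "((\<lambda>e. scaleC (ip e f) e) has_sum f) E"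
proof -
  have E': "orthonormal E" "E \<subseteq> M" using E by (auto simp: onb_def)
  obtain s where s: "((\<lambda>e. scaleC (ip e f) e) has_sum s) E"
    using fourier_transport_summable[OF E'(1), of "\<lambda>e. e" f] E' unfolding summable_on_def by auto
  have "s \<in> M"
    by (rule csub_has_sum[OF M s]) (use E' in \<open>auto intro!: csub_scaleC[OF M]\<close>)
  then have "f - s \<in> M" by (rule csub_diff[OF M f])
  moreover have "ip e (f - s) = 0" if "e \<in> E" for e
    using fourier_coefficient[of E "\<lambda>e. e", OF _ _ _ s that] E' by (simp add: ip_diff_right)
  ultimately have "f - s = 0" using E unfolding onb_def by blast
  then show ?thesis using s by simp
qed

lemma parseval:
  assumes "csub M" "onb M E" "f \<in> M"
  shows "((\<lambda>e. (cmod (ip e f))\<^sup>2) has_sum (norm f)\<^sup>2) E"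
proof -
  have "((\<lambda>e. f \<bullet> scaleC (ip e f) e) has_sum f \<bullet> f) E"
    using has_sum_bounded_linear[OF bounded_linear_inner_right onb_expansion[OF assms], of f] by (simp add: o_def)
  moreover have "f \<bullet> scaleC (ip e f) e = (cmod (ip e f))\<^sup>2" for e
    by (simp add: inner_eq ip_scale_right ip_commute[of f e] complex_norm_square[symmetric])
  ultimately show ?thesis by (simp add: power2_norm_eq_inner)
qed

text \<open>Any bijection between orthonormal bases of two closed complex subspaces extends to a
  partial isometry from the first subspace onto the second.\<close>

lemma partial_isometry_exists:
  assumes E: "onb M E" "onb M' E'" and M: "csub M" "csub M'" and \<phi>: "bij_betw \<phi> E E'"
    and p: "closed_projection M p" and p': "closed_projection M' p'"
  shows "\<exists>T :: 'k endo. clin T \<and> (\<forall>f. hadj T (T f) = p f) \<and> (\<forall>f. T (hadj T f) = p' f)"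
proof -
  have key: "\<exists>T :: 'k endo. clin T \<and> (\<forall>f. \<forall>e\<in>A. ip (\<psi> e) (T f) = ip e f) \<and> (\<forall>f. T f \<in> N')
      \<and> (\<forall>f. ((\<lambda>e. scaleC (ip e f) (\<psi> e)) has_sum T f) A)"
    if A: "onb N A" "onb N' A'" and N: "csub N" "csub N'" and \<psi>: "bij_betw \<psi> A A'" for N N' A A' \<psi>
  proof -
    have oA: "orthonormal A" and o\<psi>: "inj_on \<psi> A" "orthonormal (\<psi> ` A)" and A': "\<psi> ` A = A'" "A' \<subseteq> N'"
      using A \<psi> by (auto simp: onb_def bij_betw_def)
    define T where "T f = (\<Sum>\<^sub>\<infinity>e\<in>A. scaleC (ip e f) (\<psi> e))" for f
    have hs: "((\<lambda>e. scaleC (ip e f) (\<psi> e)) has_sum T f) A" for f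
      unfolding T_def by (rule has_sum_infsum, rule fourier_transport_summable[OF oA o\<psi>])
    have TN: "T f \<in> N'" for f
      by (rule csub_has_sum[OF N(2) hs]) (use A' in \<open>auto intro!: csub_scaleC[OF N(2)]\<close>)
    have co: "ip (\<psi> e) (T f) = ip e f" if "e \<in> A" for e f
      by (rule fourier_coefficient[OF oA o\<psi> hs that])
    have eqI: "T f = g" if "g \<in> N'" "\<And>e. e \<in> A \<Longrightarrow> ip (\<psi> e) g = ip e f" for f g
    proof -
      have "T f - g \<in> N'" by (rule csub_diff[OF N(2) TN that(1)])
      moreover have "\<forall>e\<in>A'. ip e (T f - g) = 0" using co that(2) by (auto simp: ip_diff_right A'(1)[symmetric])
      ultimately show ?thesis using A(2) unfolding onb_def by auto
    qed
    have "bounded_linear T"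
    proof (rule bounded_linear_intro[where K=1])
      fix x y :: 'k and r :: real
      show "T (x + y) = T x + T y"
        by (intro eqI csub_add[OF N(2)] TN) (simp add: co ip_add_right)
      show "T (r *\<^sub>R x) = r *\<^sub>R T x"
        by (intro eqI csub_scaleR[OF N(2)] TN) (simp add: co ip_scaleR_right)
      have "((\<lambda>e. (cmod (ip (\<psi> e) (T x)))\<^sup>2) has_sum (norm (T x))\<^sup>2) A"
        using parseval[OF N(2) A(2) TN] has_sum_reindex_bij_betw[OF \<psi>, of "\<lambda>e. (cmod (ip e (T x)))\<^sup>2"] by simp
      then have 1: "((\<lambda>e. (cmod (ip e x))\<^sup>2) has_sum (norm (T x))\<^sup>2) A"
        using has_sum_cong[of A "\<lambda>e. (cmod (ip (\<psi> e) (T x)))\<^sup>2" "\<lambda>e. (cmod (ip e x))\<^sup>2"] co by simp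
      have "(norm (T x))\<^sup>2 \<le> (norm x)\<^sup>2"
      proof (rule has_sum_le_finite_sums[OF 1])
        fix F assume "finite F" "F \<subseteq> A"
        then show "(\<Sum>e\<in>F. (cmod (ip e x))\<^sup>2) \<le> (norm x)\<^sup>2"
          using orthonormal_sum_sq[OF oA, of F x] zero_le_power2[of "norm (x - (\<Sum>e\<in>F. scaleC (ip e x) e))"] by simp
      qed
      from power2_le_imp_le[OF this norm_ge_zero] show "norm (T x) \<le> norm x * 1" by simp
    qed
    then have ap: "blinfun_apply (Blinfun T) = T" by (simp add: bounded_linear_Blinfun_apply)
    have "clin (Blinfun T)"
      unfolding clin_def J_def ap
      by (intro allI eqI csub_scaleC[OF N(2)] TN) (simp add: co ip_scale_right)
    then show ?thesis using co TN hs by (intro exI[of _ "Blinfun T"]) (simp add: ap)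
  qed
  obtain T where T': "clin T \<and> (\<forall>f. \<forall>e\<in>E. ip (\<phi> e) (blinfun_apply T f) = ip e f) \<and>
      (\<forall>f. blinfun_apply T f \<in> M') \<and> (\<forall>f. ((\<lambda>e. scaleC (ip e f) (\<phi> e)) has_sum blinfun_apply T f) E)"
    using key[OF E M \<phi>] ..
  then have T: "clin T" "\<And>f e. e \<in> E \<Longrightarrow> ip (\<phi> e) (blinfun_apply T f) = ip e f"
    "\<And>f. blinfun_apply T f \<in> M'" "\<And>f. ((\<lambda>e. scaleC (ip e f) (\<phi> e)) has_sum blinfun_apply T f) E"
    by simp_all
  let ?\<psi> = "inv_into E \<phi>"
  have \<psi>: "bij_betw ?\<psi> E' E" by (rule bij_betw_inv_into[OF \<phi>])
  obtain R where R': "clin R \<and> (\<forall>f. \<forall>e\<in>E'. ip (?\<psi> e) (blinfun_apply R f) = ip e f) \<and>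
      (\<forall>f. blinfun_apply R f \<in> M) \<and> (\<forall>f. ((\<lambda>e. scaleC (ip e f) (?\<psi> e)) has_sum blinfun_apply R f) E')"
    using key[OF E(2,1) M(2,1) \<psi>] ..
  then have R: "\<And>f e. e \<in> E' \<Longrightarrow> ip (?\<psi> e) (blinfun_apply R f) = ip e f" "\<And>f. blinfun_apply R f \<in> M"
    "\<And>f. ((\<lambda>e. scaleC (ip e f) (?\<psi> e)) has_sum blinfun_apply R f) E'"
    by simp_all
  have \<phi>\<psi>: "\<phi> (?\<psi> e) = e" "?\<psi> e \<in> E" if "e \<in> E'" for e
    using that \<phi> bij_betw_apply[OF \<psi> that] by (auto simp: bij_betw_def f_inv_into_f)
  have \<psi>\<phi>: "?\<psi> (\<phi> e) = e" "\<phi> e \<in> E'" if "e \<in> E" for e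
    using that \<phi> by (auto simp: bij_betw_def)
  have adj: "R f \<bullet> g = f \<bullet> T g" for f g
  proof -
    have a1: "((\<lambda>e. ip g (scaleC (ip (\<phi> e) f) e)) has_sum ip g (R f)) E"
      using has_sum_bounded_linear[OF bounded_linear_ip R(3), of g f]
        has_sum_reindex_bij_betw[OF \<phi>, of "\<lambda>e. ip g (scaleC (ip e f) (?\<psi> e))"] \<psi>\<phi>
      by (simp add: o_def cong: has_sum_cong)
    have a2: "((\<lambda>e. cnj (ip f (scaleC (ip e g) (\<phi> e)))) has_sum cnj (ip f (T g))) E"
      using has_sum_bounded_linear[OF bounded_linear_compose[OF bounded_linear_cnj bounded_linear_ip] T(4), of f g]
      by (simp add: o_def)
    have "ip g (scaleC (ip (\<phi> e) f) e) = cnj (ip f (scaleC (ip e g) (\<phi> e)))" for e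
      by (simp add: ip_scale_right ip_commute[of "\<phi> e" f] ip_commute[of e g])
    then have "ip g (R f) = cnj (ip f (T g))" using a1 a2 by (metis (no_types, lifting) ext has_sum_unique)
    then show ?thesis using inner_commute[of "R f" g] by (simp add: inner_eq)
  qed
  then have ad: "hadj T f = R f" for f by (metis hadj_unique)
  interpret p: closed_projection M p by fact
  interpret p': closed_projection M' p' by fact
  have uniq: "u = v" if "onb N A" "csub N" "u \<in> N" "v \<in> N" "\<And>e. e \<in> A \<Longrightarrow> ip e u = ip e v" for N A u v
  proof -
    have "u - v \<in> N" by (rule csub_diff[OF that(2-4)])
    then have "u - v = 0" using that(1,5) by (auto simp: onb_def ip_diff_right)
    then show ?thesis by simp
  qed
  have pip: "ip e (q f) = ip e f" if "closed_projection N q" "csub N" "e \<in> N" for N q e f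
    using that closed_projection.inner_eq[OF that(1)]
    by (simp add: ip_eq csub_def) (metis inner_commute)
  have "R (T f) = p f" for f
  proof (rule uniq[OF E(1) M(1) R(2) p.range])
    fix e assume e: "e \<in> E"
    then have "ip e (R (T f)) = ip e f" using R(1)[of "\<phi> e" "T f"] T(2)[OF e] \<psi>\<phi>[OF e] by simp
    then show "ip e (R (T f)) = ip e (p f)" using pip[OF p M(1), of e f] e E(1) by (auto simp: onb_def)
  qed
  moreover have "T (R f) = p' f" for f
  proof (rule uniq[OF E(2) M(2) T(3) p'.range])
    fix e assume e: "e \<in> E'"
    then have "ip e (T (R f)) = ip e f" using T(2)[of "?\<psi> e" "R f"] R(1)[OF e] \<phi>\<psi>[OF e] by simp
    then show "ip e (T (R f)) = ip e (p' f)" using pip[OF p' M(2), of e f] e E(2) by (auto simp: onb_def)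
  qed
  ultimately show ?thesis using T(1) ad by (intro exI[of _ T]) auto
qed

definition ecard :: "'k set \<Rightarrow> enat" where "ecard E = (if finite E then enat (card E) else \<infinity>)"

lemma orthonormal_independent:
  assumes "orthonormal E" shows "local.independent E"
  unfolding independent_explicit_module
proof (intro allI impI)
  fix t u v assume t: "finite t" "t \<subseteq> E" "(\<Sum>v\<in>t. scaleC (u v) v) = 0" "v \<in> t"
  have "0 = ip v (\<Sum>w\<in>t. scaleC (u w) w)" by (simp add: t(3))
  also have "\<dots> = (\<Sum>w\<in>t. u w * (if v = w then 1 else 0))"
    unfolding ip_sum_right ip_scale_right using orthonormalD[OF assms] subsetD[OF t(2)] t(4)
    by (intro sum.cong refl) auto
  also have "\<dots> = u v" using t by (simp add: sum.delta' if_distrib cong: if_cong)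
  finally show "u v = 0" by simp
qed

text \<open>For a finite basis the Fourier series are finite sums, so \<open>E\<close> is also an algebraic basis. An infinite
  orthonormal set is linearly independent and does not lie in a finitely generated subspace.\<close>

lemma edim_onb:
  assumes M: "csub M" and E: "onb M E"
  shows "edim M = ecard E"
proof (cases "finite E")
  case True
  have "M \<subseteq> local.span E"
  proof
    fix f assume "f \<in> M"
    then have "f = (\<Sum>e\<in>E. scaleC (ip e f) e)"
      using onb_expansion[OF M E] True by (metis (no_types, lifting) has_sum_finite has_sum_unique)
    also have "\<dots> \<in> local.span E" by (intro span_sum span_scale span_base)
    finally show "f \<in> local.span E" .
  qed
  moreover have "local.dim M = card E"
    using E calculation orthonormal_independent by (intro dim_unique) (auto simp: onb_def)
  ultimately show ?thesis using True by (auto simp: edim_def ecard_def)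
next
  case False
  have "\<not> (\<exists>B. finite B \<and> M \<subseteq> local.span B)"
  proof
    assume "\<exists>B. finite B \<and> M \<subseteq> local.span B"
    then obtain B where "finite B" "E \<subseteq> local.span B" using E by (auto simp: onb_def)
    then show False using independent_span_bound[OF _ orthonormal_independent] E False by (auto simp: onb_def)
  qed
  then show ?thesis using False by (simp add: edim_def ecard_def)
qed

lemma ecard_eq_bij:
  assumes "orthonormal E" "orthonormal E'" "ecard E = ecard E'"
  shows "\<exists>\<phi>. bij_betw \<phi> E E'"
proof (cases "finite E")
  case True
  then have "finite E'" "card E = card E'" using assms(3) by (auto simp: ecard_def split: if_splits)
  then show ?thesis using True finite_same_card_bij by blast
next
  case False
  then have "infinite E'" using assms(3) by (auto simp: ecard_def split: if_splits)
  then show ?thesis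
    using False assms(1,2) orthonormal_countable
    by (meson bij_betw_from_nat_into bij_betw_trans to_nat_on_infinite)
qed

section \<open>Hilbert-Schmidt operators\<close>

lemma orthonormal_basis_iff_onb: "orthonormal_basis E \<longleftrightarrow> onb UNIV E"
proof
  assume E: "orthonormal_basis E"
  have "f = 0" if f: "\<And>e. e \<in> E \<Longrightarrow> ip e f = 0" for f
  proof -
    have z: "ip f e = 0" if "e \<in> E" for e using f[OF that] ip_commute[of f e] by simp
    have "ip f g = 0" if "g \<in> local.span E" for g
      using that by (induction rule: span_induct_alt) (auto simp: ip_add_right ip_scale_right z)
    then have "local.span E \<subseteq> {g. ip f g = 0}" by blast
    moreover have "closed {g. ip f g = 0}"
      by (intro closed_Collect_eq continuous_on_const linear_continuous_on bounded_linear_ip)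
    ultimately have "closure (local.span E) \<subseteq> {g. ip f g = 0}" by (rule closure_minimal)
    then have "ip f f = 0" using E by (auto simp: orthonormal_basis_def)
    then show "f = 0" by (simp add: ip_self)
  qed
  then show "onb UNIV E" using E by (auto simp: onb_def orthonormal_basis_def orthonormal_def)
next
  assume E: "onb UNIV E"
  have "f \<in> closure (local.span E)" for f
  proof (rule Lim_in_closed_set[OF closed_closure _ finite_subsets_at_top_neq_bot])
    show "(sum (\<lambda>e. scaleC (ip e f) e) \<longlongrightarrow> f) (finite_subsets_at_top E)"
      using onb_expansion[OF csub_UNIV E UNIV_I] by (simp add: has_sum_def)
    have "sum (\<lambda>e. scaleC (ip e f) e) F \<in> closure (local.span E)" if "F \<subseteq> E" for F
      using that by (intro subsetD[OF closure_subset] span_sum span_scale span_base) auto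
    then show "\<forall>\<^sub>F F in finite_subsets_at_top E. sum (\<lambda>e. scaleC (ip e f) e) F \<in> closure (local.span E)"
      by (intro eventually_finite_subsets_at_top_weakI) auto
  qed
  then show "orthonormal_basis E" using E by (auto simp: onb_def orthonormal_basis_def orthonormal_def)
qed

text \<open>The basis that is implicit in the definition of the Hilbert-Schmidt norm.\<close>

definition E0 :: "'k set" where "E0 = (SOME E. orthonormal_basis E)"

lemma E0: "onb UNIV E0"
proof -
  have "\<exists>E. orthonormal_basis E" using onb_exists[OF csub_UNIV] by (simp add: orthonormal_basis_iff_onb)
  then have "orthonormal_basis E0" unfolding E0_def by (rule someI_ex)
  then show ?thesis by (simp add: orthonormal_basis_iff_onb)
qed

text \<open>Expanding \<open>A e\<close> in the basis \<open>F\<close> and \<open>A\<^sup>* f\<close> in the basis \<open>E\<close> gives the same double series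
  of nonnegative terms. Applied twice, this makes the sum independent of the basis.\<close>

lemma hs_sum_hadj:
  assumes E: "onb UNIV E" and F: "onb UNIV F" and A: "clin A"
    and s: "((\<lambda>e. (norm (A e))\<^sup>2) has_sum s) E"
  shows "((\<lambda>f. (norm (hadj A f))\<^sup>2) has_sum s) F"
proof -
  define c where "c = (\<lambda>(e, f). (cmod (ip f (A e)))\<^sup>2)"
  have adj: "ip e (hadj A f) = cnj (ip f (A e))" for e f
  proof -
    have "ip (hadj A f) e = ip f (A e)"
      using clin_hadj[OF A] unfolding clin_def ip_eq by (metis inner_hadj_left)
    then show ?thesis using ip_commute[of e "hadj A f"] by simp
  qed
  have row: "((\<lambda>f. c (e, f)) has_sum (norm (A e))\<^sup>2) F" for e
    using parseval[OF csub_UNIV F UNIV_I, of "A e"] by (simp add: c_def)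
  have col: "((\<lambda>e. c (e, f)) has_sum (norm (hadj A f))\<^sup>2) E" for f
    using parseval[OF csub_UNIV E UNIV_I, of "hadj A f"] by (simp add: c_def adj)
  have sm: "c summable_on (E \<times> F)"
    using row s by (intro summable_on_SigmaI[where g="\<lambda>e. (norm (A e))\<^sup>2"])
      (auto simp: c_def summable_on_def)
  then obtain t where t: "(c has_sum t) (E \<times> F)" by (auto simp: summable_on_def)
  have "t = s" using has_sum_SigmaD[OF t row] s has_sum_unique by blast
  moreover have "((\<lambda>(f, e). c (e, f)) has_sum t) (F \<times> E)"
    by (rule iffD1[OF has_sum_swap t])
  then have "((\<lambda>f. (norm (hadj A f))\<^sup>2) has_sum t) F"
    by (rule has_sum_SigmaD) (use col in simp)
  ultimately show ?thesis by simp
qed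

lemma hs_sum_basis:
  assumes "onb UNIV E" "onb UNIV F" "clin A" "((\<lambda>e. (norm (A e))\<^sup>2) has_sum s) E"
  shows "((\<lambda>f. (norm (A f))\<^sup>2) has_sum s) F"
  using hs_sum_hadj[OF assms(2,2) clin_hadj[OF assms(3)] hs_sum_hadj[OF assms]] by simp

definition HS :: "'k endo \<Rightarrow> bool" where "HS A \<longleftrightarrow> hilbert_schmidt (blinfun_apply A)"

abbreviation hsn :: "'k endo \<Rightarrow> real" where "hsn A \<equiv> hs_norm (blinfun_apply A)"

lemma HS_iff: "HS A \<longleftrightarrow> clin A \<and> (\<lambda>e. (norm (A e))\<^sup>2) summable_on E0"
  unfolding HS_def hilbert_schmidt_def linear_iff_clin orthonormal_basis_iff_onb
  using E0 hs_sum_basis[OF _ E0] by (auto simp: blinfun.bounded_linear_right summable_on_def)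

lemma HS_clin: "HS A \<Longrightarrow> clin A" by (simp add: HS_iff)

lemma hs_norm_eq: "hs_norm A = sqrt (\<Sum>\<^sub>\<infinity>e\<in>E0. (norm (A e))\<^sup>2)"
  by (simp add: hs_norm_def E0_def)

lemma hs_norm_nonneg: "0 \<le> hs_norm A"
  unfolding hs_norm_eq by (intro real_sqrt_ge_zero infsum_nonneg) simp

text \<open>Bounds on all finite parts of a basis reduce statements about the Hilbert-Schmidt norm to
  finite \<open>\<ell>\<^sup>2\<close> norms.\<close>

lemma HS_boundI:
  assumes A: "clin A" and c: "0 \<le> c"
    and b: "\<And>F. finite F \<Longrightarrow> F \<subseteq> E0 \<Longrightarrow> L2_set (\<lambda>e. norm (A e)) F \<le> c"
  shows "HS A" "hsn A \<le> c"
proof -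
  have le: "(\<Sum>e\<in>F. (norm (A e))\<^sup>2) \<le> c\<^sup>2" if "finite F" "F \<subseteq> E0" for F
    using b[OF that] c by (simp add: L2_set_def real_sqrt_le_iff' sum_nonneg)
  have sm: "(\<lambda>e. (norm (A e))\<^sup>2) summable_on E0"
    by (rule nonneg_bdd_above_summable_on) (auto intro!: bdd_aboveI2[where M="c\<^sup>2"] le)
  then show "HS A" using A by (simp add: HS_iff)
  have "(\<Sum>\<^sub>\<infinity>e\<in>E0. (norm (A e))\<^sup>2) \<le> c\<^sup>2"
    using le by (intro infsum_le_finite_sums[OF sm]) auto
  then show "hsn A \<le> c" unfolding hs_norm_eq using c real_sqrt_le_mono by fastforce
qed

lemma HS_boundD:
  assumes "HS A" "finite F" "F \<subseteq> E0"
  shows "L2_set (\<lambda>e. norm (A e)) F \<le> hsn A"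
  unfolding L2_set_def hs_norm_eq using assms
  by (intro real_sqrt_le_mono finite_sum_le_infsum) (auto simp: HS_iff)

lemma clin_blinfun [simp]:
  "clin A \<Longrightarrow> clin B \<Longrightarrow> clin (A + B)"
  "clin A \<Longrightarrow> clin B \<Longrightarrow> clin (A - B)"
  "clin A \<Longrightarrow> clin (r *\<^sub>R A)"
  "clin A \<Longrightarrow> clin B \<Longrightarrow> clin (A o\<^sub>L B)"
  "clin bP1" "clin bP2" "clin bC" "clin id_blinfun" "clin bJ" "clin 0"
  by (simp_all add: clin_def lin_simps P1_J C_J P2_def)

lemma HS_add:
  assumes A: "HS A" and B: "HS B"
  shows "HS (A + B)" "hsn (A + B) \<le> hsn A + hsn B"
proof -
  have "L2_set (\<lambda>e. norm ((A + B) e)) F \<le> hsn A + hsn B" if F: "finite F" "F \<subseteq> E0" for F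
  proof -
    have "L2_set (\<lambda>e. norm ((A + B) e)) F \<le> L2_set (\<lambda>e. norm (A e) + norm (B e)) F"
      by (rule L2_set_mono) (auto simp: blinfun.add_left norm_triangle_ineq)
    also have "\<dots> \<le> L2_set (\<lambda>e. norm (A e)) F + L2_set (\<lambda>e. norm (B e)) F"
      by (rule L2_set_triangle_ineq)
    finally show ?thesis using HS_boundD[OF A F] HS_boundD[OF B F] by linarith
  qed
  then show "HS (A + B)" "hsn (A + B) \<le> hsn A + hsn B"
    using HS_boundI[of "A + B" "hsn A + hsn B"] HS_clin[OF A] HS_clin[OF B] hs_norm_nonneg by auto
qed

lemma HS_compose_left:
  assumes A: "HS A" and B: "clin B"
  shows "HS (B o\<^sub>L A)" "hsn (B o\<^sub>L A) \<le> norm B * hsn A"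
proof -
  have "L2_set (\<lambda>e. norm ((B o\<^sub>L A) e)) F \<le> norm B * hsn A" if F: "finite F" "F \<subseteq> E0" for F
  proof -
    have "L2_set (\<lambda>e. norm ((B o\<^sub>L A) e)) F \<le> L2_set (\<lambda>e. norm B * norm (A e)) F"
      by (rule L2_set_mono) (auto simp: norm_blinfun)
    also have "\<dots> = norm B * L2_set (\<lambda>e. norm (A e)) F"
      by (simp add: L2_set_right_distrib)
    finally show ?thesis using mult_left_mono[OF HS_boundD[OF A F], of "norm B"] by simp
  qed
  then show "HS (B o\<^sub>L A)" "hsn (B o\<^sub>L A) \<le> norm B * hsn A"
    using HS_boundI[of "B o\<^sub>L A" "norm B * hsn A"] HS_clin[OF A] B hs_norm_nonneg by auto
qed

lemma HS_hadj:
  assumes A: "HS A"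
  shows "HS (hadj A)" "hsn (hadj A) = hsn A"
proof -
  have "((\<lambda>e. (norm (A e))\<^sup>2) has_sum (\<Sum>\<^sub>\<infinity>e\<in>E0. (norm (A e))\<^sup>2)) E0"
    using A by (simp add: HS_iff)
  from hs_sum_hadj[OF E0 E0 HS_clin[OF A] this]
  show "HS (hadj A)" "hsn (hadj A) = hsn A"
    using clin_hadj[OF HS_clin[OF A]] by (auto simp: HS_iff hs_norm_eq summable_on_def infsumI)
qed

lemma hadj_compose: "hadj (A o\<^sub>L B) = hadj B o\<^sub>L hadj A"
  by (rule blinfun_eqI, rule hadj_unique[symmetric]) (simp add: inner_hadj_left)

text \<open>The bound for \<open>A B\<close> follows from the one for \<open>(A B)\<^sup>* = B\<^sup>* A\<^sup>*\<close>.\<close>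

lemma HS_compose_right:
  assumes A: "HS A" and B: "clin B"
  shows "HS (A o\<^sub>L B)" "hsn (A o\<^sub>L B) \<le> norm B * hsn A"
proof -
  have eq: "A o\<^sub>L B = hadj (hadj B o\<^sub>L hadj A)" by (simp add: hadj_compose)
  have h: "HS (hadj B o\<^sub>L hadj A)" "hsn (hadj B o\<^sub>L hadj A) \<le> norm (hadj B) * hsn A"
    using HS_compose_left[OF HS_hadj(1)[OF A] clin_hadj[OF B]] HS_hadj(2)[OF A] by auto
  show "HS (A o\<^sub>L B)" unfolding eq by (rule HS_hadj(1)[OF h(1)])
  have "hsn (A o\<^sub>L B) \<le> norm (hadj B) * hsn A" unfolding eq using HS_hadj(2)[OF h(1)] h(2) by simp
  also have "\<dots> \<le> norm B * hsn A" by (intro mult_right_mono norm_hadj_le hs_norm_nonneg)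
  finally show "hsn (A o\<^sub>L B) \<le> norm B * hsn A" .
qed

lemma HS_of_eq: "HS A \<Longrightarrow> (\<And>f. blinfun_apply B f = blinfun_apply A f) \<Longrightarrow> HS B"
  by (metis blinfun_eqI)

lemma HS_scaleR: "HS A \<Longrightarrow> HS (r *\<^sub>R A)"
  by (rule HS_of_eq, rule HS_compose_left(1)[OF _ clin_blinfun(3)[OF clin_blinfun(8)], of A r])
     (simp_all add: blinfun.bilinear_simps)

lemma HS_diff: "HS A \<Longrightarrow> HS B \<Longrightarrow> HS (A - B)"
  using HS_add(1)[of A "(-1) *\<^sub>R B"] HS_scaleR[of B "-1"] by simp

lemma HS_zero [simp]: "HS 0"
  using HS_boundI(1)[of 0 0] by (simp add: L2_set_def)

lemma onb_star: assumes "onb UNIV E" shows "onb UNIV (star ` E)"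
  unfolding onb_def orthonormal_def
proof (intro conjI ballI impI)
  fix e e' assume "e \<in> star ` E" "e' \<in> star ` E"
  then show "ip e e' = (if e = e' then 1 else 0)"
    using assms by (auto simp: ip_star onb_def orthonormal_def star_inj)
next
  fix f assume f: "\<forall>e\<in>star ` E. ip e f = 0"
  have "ip e (star f) = 0" if "e \<in> E" for e
    using f ip_star[of "star e" f] ip_commute[of f "star e"] that by simp
  then have "star f = 0" using assms unfolding onb_def by blast
  then show "f = 0" by (metis star_star star_zero)
qed simp

lemma star_J: "star (J f) = - J (star f)"
  by (simp add: J_star)

lemma HS_bar: assumes A: "HS A" shows "HS (bstar o\<^sub>L (A o\<^sub>L bstar))"
proof -
  obtain s where "((\<lambda>e. (norm (A e))\<^sup>2) has_sum s) E0" using A by (auto simp: HS_iff summable_on_def)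
  then have s: "((\<lambda>e. (norm (A e))\<^sup>2) has_sum s) (star ` E0)"
    by (rule hs_sum_basis[OF E0 onb_star[OF E0] HS_clin[OF A]])
  have "inj_on star E0" by (simp add: inj_on_def star_inj)
  from has_sum_reindex[OF this, of "\<lambda>e. (norm (A e))\<^sup>2" s] s
  have "((\<lambda>e. (norm (A (star e)))\<^sup>2) has_sum s) E0" by (simp add: o_def)
  moreover have "clin (bstar o\<^sub>L (A o\<^sub>L bstar))"
    using HS_clin[OF A] by (simp add: clin_def star_J lin_simps)
  ultimately show ?thesis by (auto simp: HS_iff summable_on_def)
qed

section \<open>The index\<close>

lemma adm_clin: "adm T \<Longrightarrow> clin T" by (simp add: adm_def clin_def)

lemma adm_blinfun [simp]:
  "adm A \<Longrightarrow> adm B \<Longrightarrow> adm (A + B)" "adm A \<Longrightarrow> adm B \<Longrightarrow> adm (A - B)"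
  "adm A \<Longrightarrow> adm (r *\<^sub>R A)" "adm A \<Longrightarrow> adm B \<Longrightarrow> adm (A o\<^sub>L B)"
  "adm id_blinfun" "adm 0"
  by (simp_all add: adm_def lin_simps)

lemma S_compose: "U \<in> S \<Longrightarrow> V \<in> S \<Longrightarrow> U o\<^sub>L V \<in> S"
  by (simp add: S_iff)

text \<open>The block \<open>V\<^sub>1\<^sub>2\<close> as a bounded operator.\<close>

definition blk :: "'k endo \<Rightarrow> 'k endo" where "blk V = bP1 o\<^sub>L (V o\<^sub>L bP2)"

lemma block12_eq: "block12 (blinfun_apply V) = blinfun_apply (blk V)"
  by (simp add: fun_eq_iff block12_def blk_def)

lemma S_P1_iff: "V \<in> S_P1 \<longleftrightarrow> V \<in> S \<and> HS (blk V)"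
  by (simp add: S_P1_def block12_eq HS_def)

lemma P1_P2_add: "P1 f + P2 f = f" by (simp add: P2_def)
lemma P1_P2 [simp]: "P1 (P2 f) = 0" "P2 (P1 f) = 0" "P2 (P2 f) = P2 f" by (simp_all add: P2_def P1_diff)

lemma blk_compose: "blk (U o\<^sub>L V) = ((bP1 o\<^sub>L U) o\<^sub>L blk V) + (blk U o\<^sub>L (V o\<^sub>L bP2))"
  by (rule blinfun_eqI)
     (simp add: blk_def blinfun.bilinear_simps flip: P1_add blinfun.add_right, simp add: P1_P2_add)

lemma S_P1_compose: assumes "U \<in> S_P1" "V \<in> S_P1" shows "U o\<^sub>L V \<in> S_P1"
proof -
  have c: "clin U" "clin V" using assms by (auto simp: S_P1_iff S_clin)
  then have "HS ((bP1 o\<^sub>L U) o\<^sub>L blk V)" "HS (blk U o\<^sub>L (V o\<^sub>L bP2))"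
    using assms HS_compose_left(1)[OF _ clin_blinfun(4)[OF clin_blinfun(5) c(1)]]
      HS_compose_right(1)[OF _ clin_blinfun(4)[OF c(2) clin_blinfun(6)]]
    by (auto simp: S_P1_iff)
  then show ?thesis using assms by (simp add: S_P1_iff S_compose blk_compose HS_add)
qed

text \<open>The operator \<open>V\<^sup>\<dagger>\<close> as a bounded operator, which agrees with \<open>dagger V\<close> if \<open>V\<close> is complex linear. Its kernel
  \<open>kd V\<close> below is the orthogonal complement of the range of \<open>V\<close> with respect to \<open>\<kappa>\<close>.\<close>

definition dg :: "'k endo \<Rightarrow> 'k endo" where "dg V = bC o\<^sub>L (hadj V o\<^sub>L bC)"

lemma dg_apply: "dg V f = C (hadj V (C f))" by (simp add: dg_def)

lemma dg_inner: "dg V f \<bullet> C g = f \<bullet> C (V g)"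
  by (simp add: dg_apply inner_C inner_hadj_left flip: inner_C[of "hadj V _"])

lemma eq_C_iff: "(\<And>g. u \<bullet> C g = v \<bullet> C g) \<Longrightarrow> u = v"
  by (rule vector_eq_rdot[THEN iffD1]) (metis C_C)

lemma dg_left_inverse: "V \<in> S \<Longrightarrow> dg V (V f) = f"
  by (rule eq_C_iff) (simp add: dg_inner S_form)

lemma norm_dg: "norm (dg V) \<le> norm V"
proof (rule norm_blinfun_bound)
  fix f
  have "norm (dg V f) \<le> norm (hadj V) * norm (C f)" unfolding dg_apply norm_C
    using norm_blinfun[of "hadj V" "C f"] by simp
  also have "\<dots> \<le> norm V * norm f" by (simp add: mult_right_mono norm_hadj_le)
  finally show "norm (dg V f) \<le> norm V * norm f" .
qed simp

lemma adm_dg: "adm V \<Longrightarrow> adm (dg V)"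
  using adm_hadj[of V] by (simp add: adm_def dg_apply C_J C_star lin_simps)

definition kd :: "'k endo \<Rightarrow> 'k set" where "kd V = {f. dg V f = 0}"

lemma kd_iff: "f \<in> kd V \<longleftrightarrow> (\<forall>g. f \<bullet> C (V g) = 0)"
  unfolding kd_def mem_Collect_eq
  by (metis dg_inner eq_C_iff inner_zero_left)

lemma neg_ind_eq: "clin V \<Longrightarrow> neg_ind V = edim (kd V)"
  by (simp add: neg_ind_def kd_def dagger_eq dg_apply)

lemma kd_csub: assumes "clin V" shows "csub (kd V)"
proof -
  have "clin (dg V)"
    using clin_hadj[OF assms] by (simp add: clin_def dg_apply C_J)
  then show ?thesis
    unfolding csub_def kd_def
    by (auto simp: clin_def lin_simps real_vector.subspace_def intro!: closed_Collect_eq continuous_intros)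
qed

lemma csub_local_subspace: "csub M \<Longrightarrow> local.subspace M"
  by (auto simp: local.subspace_def csub_add csub_scaleC csub_def intro: real_vector.subspace_0)

lemma edim_le_of_inj:
  assumes M: "csub M" and T: "clin T" and sub: "T ` M \<subseteq> M'"
    and inj: "\<And>f. f \<in> M \<Longrightarrow> T f = 0 \<Longrightarrow> f = 0"
  shows "edim M \<le> edim M'"
proof (cases "\<exists>B. finite B \<and> M' \<subseteq> local.span B")
  case True
  then obtain B where B: "finite B" "M' \<subseteq> local.span B" by blast
  interpret l: Vector_Spaces.linear scaleC scaleC "blinfun_apply T"
    using T by (simp add: linear_iff_clin)
  obtain A where A: "A \<subseteq> M" "local.independent A" "M \<subseteq> local.span A" "card A = local.dim M"
    using basis_exists by blast
  have spanA: "local.span A = M"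
    using A csub_local_subspace[OF M] span_minimal by blast
  have injM: "inj_on T M"
  proof (rule inj_onI)
    fix f g assume "f \<in> M" "g \<in> M" "T f = T g"
    then show "f = g" using inj[of "f - g"] csub_diff[OF M] by (simp add: blinfun.diff_right)
  qed
  have TA: "local.independent (T ` A)"
    using l.independent_injective_image[OF A(2)] injM spanA by simp
  obtain A' where A': "A' \<subseteq> M'" "local.independent A'" "M' \<subseteq> local.span A'" "card A' = local.dim M'"
    using basis_exists by blast
  have fA': "finite A'" using independent_span_bound[OF B(1) A'(2)] A'(1) B(2) by blast
  have b: "finite (T ` A)" "card (T ` A) \<le> card A'"
    using independent_span_bound[OF fA' TA] A(1) sub A'(3) by blast+
  have iA: "inj_on T A" using injM A(1) inj_on_subset by blast
  have "finite A" using b(1) iA finite_image_iff by blast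
  moreover have "card (T ` A) = card A" using iA by (rule card_image)
  ultimately have "local.dim M \<le> local.dim M'" "\<exists>B. finite B \<and> M \<subseteq> local.span B"
    using b(2) A A' by auto
  then show ?thesis using True by (simp add: edim_def)
next
  case False
  then have "edim M' = \<infinity>" unfolding edim_def by (rule if_not_P)
  then show ?thesis by simp
qed

lemma edim_zero_iff:
  assumes M: "csub M" shows "edim M = 0 \<longleftrightarrow> M = {0}"
proof -
  obtain E where E: "onb M E" using onb_exists[OF M] by blast
  have "edim M = 0 \<longleftrightarrow> E = {}"
    unfolding edim_onb[OF M E] by (auto simp: ecard_def zero_enat_def)
  also have "\<dots> \<longleftrightarrow> M = {0}"
  proof
    assume "E = {}"
    then have "M \<subseteq> {0}" using E by (auto simp: onb_def)
    moreover have "0 \<in> M" using M by (auto simp: csub_def intro: real_vector.subspace_0)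
    ultimately show "M = {0}" by auto
  next
    assume "M = {0}"
    then show "E = {}" using E orthonormal_norm[of E] by (force simp: onb_def)
  qed
  finally show ?thesis .
qed

text \<open>An invertible \<open>U\<close> that preserves \<open>\<kappa>\<close> maps \<open>ker V\<^sup>\<dagger>\<close> bijectively onto \<open>ker (U V)\<^sup>\<dagger>\<close>.\<close>

lemma neg_ind_left_invertible:
  assumes U: "U \<in> S" and R: "clin R" "\<And>f. U (blinfun_apply R f) = f" and V: "V \<in> S"
  shows "neg_ind (U o\<^sub>L V) = neg_ind V"
proof -
  have UV: "U o\<^sub>L V \<in> S" by (rule S_compose[OF U V])
  have inv: "f \<in> kd V \<longleftrightarrow> U f \<in> kd (U o\<^sub>L V)" for f by (simp add: kd_iff S_form[OF U])
  have "edim (kd V) \<le> edim (kd (U o\<^sub>L V))"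
  proof (rule edim_le_of_inj[OF kd_csub[OF S_clin[OF V]] S_clin[OF U]])
    show "U ` kd V \<subseteq> kd (U o\<^sub>L V)" using inv by auto
    show "f = 0" if "U f = 0" for f using dg_left_inverse[OF U, of f] that by simp
  qed
  moreover have "edim (kd (U o\<^sub>L V)) \<le> edim (kd V)"
  proof (rule edim_le_of_inj[OF kd_csub[OF S_clin[OF UV]] R(1)])
    show "R ` kd (U o\<^sub>L V) \<subseteq> kd V" using inv R(2) by auto
    show "f = 0" if "R f = 0" for f using R(2)[of f] that by simp
  qed
  ultimately show ?thesis using neg_ind_eq[OF S_clin[OF V]] neg_ind_eq[OF S_clin[OF UV]] by simp
qed

lemma neg_ind_zero_iff:
  assumes U: "U \<in> S"
  shows "neg_ind U = 0 \<longleftrightarrow> (\<forall>f. U (dg U f) = f)"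
proof -
  have k: "neg_ind U = 0 \<longleftrightarrow> kd U = {0}"
    using edim_zero_iff[OF kd_csub[OF S_clin[OF U]]] neg_ind_eq[OF S_clin[OF U]] by simp
  show ?thesis unfolding k
  proof
    assume k0: "kd U = {0}"
    have "U (dg U f) - f \<in> kd U" for f
      by (simp add: kd_def blinfun.diff_right dg_left_inverse[OF U])
    then show "\<forall>f. U (dg U f) = f" using k0 by simp
  next
    assume "\<forall>f. U (dg U f) = f"
    then show "kd U = {0}" by (auto simp: kd_def) (metis blinfun.zero_right)
  qed
qed

lemma neg_ind_zeroI:
  assumes U: "U \<in> S" and surj: "\<And>f. \<exists>g. U g = f" shows "neg_ind U = 0"
  unfolding neg_ind_zero_iff[OF U]
proof
  fix f
  obtain g where "U g = f" using surj by blast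
  then show "U (dg U f) = f" using dg_left_inverse[OF U, of g] by auto
qed

text \<open>If \<open>V'\<close> is close to \<open>V\<close>, then \<open>V\<^sup>\<dagger> V'\<close> is close to the identity, so that no nonzero vector of
  \<open>ker V\<^sup>\<dagger>\<close> lies in the range of \<open>V'\<close>. The projection \<open>1 - V' V'\<^sup>\<dagger>\<close> therefore embeds \<open>ker V\<^sup>\<dagger>\<close>
  into \<open>ker V'\<^sup>\<dagger>\<close>.\<close>

lemma neg_ind_le_near:
  assumes V: "V \<in> S" and V': "V' \<in> S" and near: "norm V * norm (V - V') < 1"
  shows "neg_ind V \<le> neg_ind V'"
proof -
  let ?T = "id_blinfun - (V' o\<^sub>L dg V')"
  have "edim (kd V) \<le> edim (kd V')"
  proof (rule edim_le_of_inj[OF kd_csub[OF S_clin[OF V]]])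
    show "clin ?T"
      by (intro clin_blinfun S_clin[OF V'] adm_clin[OF adm_dg[OF S_adm[OF V']]])
    show "?T ` kd V \<subseteq> kd V'"
      by (auto simp: kd_def blinfun.bilinear_simps dg_left_inverse[OF V'])
    fix f assume f: "f \<in> kd V" and "?T f = 0"
    then have fg: "f = V' (dg V' f)" by (simp add: blinfun.bilinear_simps)
    define g where "g = dg V' f"
    have "dg V (V' g) = 0" using f fg by (simp add: kd_def g_def)
    then have "g = dg V ((V - V') g)"
      using dg_left_inverse[OF V, of g] by (simp add: blinfun.bilinear_simps)
    then have "norm g \<le> norm (dg V) * norm ((V - V') g)"
      using norm_blinfun[of "dg V" "(V - V') g"] by simp
    also have "\<dots> \<le> norm (dg V) * (norm (V - V') * norm g)"
      by (intro mult_left_mono norm_blinfun) simp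
    also have "\<dots> \<le> norm V * (norm (V - V') * norm g)" by (intro mult_right_mono norm_dg) auto
    finally have "norm g \<le> (norm V * norm (V - V')) * norm g" by (simp add: mult.assoc)
    then have "norm g = 0" using near mult_less_cancel_right[of "norm V * norm (V - V')" "norm g" 1]
      norm_ge_zero[of g] by linarith
    then show "f = 0" using fg by (simp add: g_def[symmetric])
  qed
  then show ?thesis using neg_ind_eq[OF S_clin[OF V]] neg_ind_eq[OF S_clin[OF V']] by simp
qed

lemma neg_ind_locally_constant:
  assumes V: "V \<in> S" and V': "V' \<in> S" and near: "norm (V - V') < 1 / (norm V + 2)"
  shows "neg_ind V = neg_ind V'"
proof (rule antisym)
  have pos: "0 < norm V + 2" using norm_ge_zero[of V] by linarith
  have 1: "(norm V + 2) * norm (V - V') < 1"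
    using near pos by (simp add: pos_less_divide_eq mult.commute)
  have "1 / (norm V + 2) \<le> 1" using pos norm_ge_zero[of V] by (simp add: pos_divide_le_eq[OF pos])
  then have n: "norm V' \<le> norm V + 2"
    using near norm_triangle_ineq2[of V' V] by (simp add: norm_minus_commute)
  have b: "a * norm (V - V') < 1" if "a \<le> norm V + 2" for a
    using mult_right_mono[OF that, of "norm (V - V')"] 1 by simp
  show "neg_ind V \<le> neg_ind V'" by (rule neg_ind_le_near[OF V V' b]) simp
  show "neg_ind V' \<le> neg_ind V"
    using b[OF n] by (intro neg_ind_le_near[OF V' V]) (simp add: norm_minus_commute)
qed

lemma \<delta>_eq: "\<delta> V V' = norm (V - V') + hsn (blk V - blk V')"
proof -
  have "(\<lambda>f. blk V f - blk V' f) = blinfun_apply (blk V - blk V')"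
    by (simp add: fun_eq_iff blinfun.diff_left)
  then show ?thesis by (simp add: \<delta>_def block12_eq)
qed

lemma metric_\<delta>: "Metric_space S_P1 \<delta>"
proof
  fix x y z
  show "0 \<le> \<delta> x y" by (simp add: \<delta>_eq hs_norm_nonneg)
  show "\<delta> x y = \<delta> y x"
  proof -
    have "norm (blinfun_apply (blk x - blk y) e) = norm (blinfun_apply (blk y - blk x) e)" for e
      by (simp add: blinfun.diff_left norm_minus_commute)
    then show ?thesis by (simp add: \<delta>_eq hs_norm_eq norm_minus_commute)
  qed
  assume x: "x \<in> S_P1" and y: "y \<in> S_P1"
  show "\<delta> x y = 0 \<longleftrightarrow> x = y"
  proof
    assume "\<delta> x y = 0"
    then have "norm (x - y) \<le> 0"
      unfolding \<delta>_eq using hs_norm_nonneg[of "blinfun_apply (blk x - blk y)"] by linarith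
    then show "x = y" by simp
  next
    assume "x = y"
    then show "\<delta> x y = 0" by (simp add: \<delta>_eq hs_norm_eq)
  qed
  assume z: "z \<in> S_P1"
  have "hsn ((blk x - blk y) + (blk y - blk z)) \<le> hsn (blk x - blk y) + hsn (blk y - blk z)"
    using x y z by (intro HS_add(2) HS_diff) (auto simp: S_P1_iff)
  moreover have "norm (x - z) \<le> norm (x - y) + norm (y - z)" using norm_triangle_ineq[of "x - y" "y - z"] by simp
  ultimately show "\<delta> x z \<le> \<delta> x y + \<delta> y z" by (simp add: \<delta>_eq)
qed

section \<open>Cayley transforms\<close>

text \<open>Bounded elements \<open>X\<close> of the Lie algebra, that is \<open>X\<^sup>\<dagger> = - X\<close>, for which the numerical range stays
  away from \<open>1\<close> and \<open>- 1\<close>. This makes \<open>1 - t X\<close> coercive for \<open>\<bar>t\<bar> \<le> 1\<close>. It covers both kinds of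
  generators that occur: selfadjoint odd operators of norm less than one, and skew-adjoint diagonal
  operators of arbitrary norm, whose diagonal matrix elements have real part zero. The last condition
  keeps the off-diagonal block of the Cayley transform Hilbert-Schmidt.\<close>

definition cay_gen :: "'k endo \<Rightarrow> bool"
  where "cay_gen X \<longleftrightarrow> adm X \<and> (\<forall>f g. X f \<bullet> C g = - (f \<bullet> C (X g))) \<and>
    (\<exists>q. 0 \<le> q \<and> q < 1 \<and> (\<forall>f. \<bar>f \<bullet> X f\<bar> \<le> q * (f \<bullet> f))) \<and> (HS X \<or> (\<forall>f. X (C f) = C (X f)))"

text \<open>The equation \<open>U = (1 + X) (1 - X)\<^sup>-\<^sup>1\<close> without mentioning the inverse.\<close>

definition cay :: "'k endo \<Rightarrow> 'k endo \<Rightarrow> bool"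
  where "cay X U \<longleftrightarrow> (\<forall>f. U (f - X f) = f + X f)"

definition cayley :: "'k endo set"
  where "cayley = {U. \<exists>X. cay_gen X \<and> cay X U}"

lemma cay_gen_scaleR:
  assumes X: "cay_gen X" and t: "\<bar>t\<bar> \<le> 1" shows "cay_gen (t *\<^sub>R X)"
proof -
  obtain q where q0: "0 \<le> q" and q: "q < 1" "\<And>f. \<bar>f \<bullet> X f\<bar> \<le> q * (f \<bullet> f)" using X by (auto simp: cay_gen_def)
  have "\<bar>f \<bullet> (t *\<^sub>R X) f\<bar> \<le> q * (f \<bullet> f)" for f
  proof -
    have "\<bar>f \<bullet> (t *\<^sub>R X) f\<bar> = \<bar>t\<bar> * \<bar>f \<bullet> X f\<bar>" by (simp add: blinfun.scaleR_left abs_mult)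
    also have "\<dots> \<le> 1 * \<bar>f \<bullet> X f\<bar>" by (rule mult_right_mono[OF t]) simp
    finally show ?thesis using q(2)[of f] by simp
  qed
  moreover have "HS X \<or> (\<forall>f. X (C f) = C (X f))" "adm X" "\<And>f g. X f \<bullet> C g = - (f \<bullet> C (X g))"
    using X by (auto simp: cay_gen_def)
  ultimately show ?thesis
    unfolding cay_gen_def using q0 q(1) HS_scaleR[of X t] by (auto simp: blinfun.scaleR_left C_scaleR)
qed

text \<open>The resolvent \<open>R = (1 - X)\<^sup>-\<^sup>1\<close> exists by coercivity, and the Cayley transform is \<open>2 R - 1\<close>.\<close>

lemma cay_resolvent:
  assumes X: "cay_gen X"
    and q: "q < 1" "\<And>f. \<bar>f \<bullet> X f\<bar> \<le> q * (f \<bullet> f)"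
  shows "\<exists>R. adm R \<and> (\<forall>f. blinfun_apply R (f - X f) = f) \<and> (\<forall>f. blinfun_apply R f - X (blinfun_apply R f) = f)
    \<and> norm R \<le> 1 / (1 - q)"
proof -
  let ?T = "id_blinfun - X"
  have T: "?T f = f - X f" for f by (simp add: blinfun.diff_left)
  have "(1 - q) * (f \<bullet> f) \<le> f \<bullet> ?T f" for f
    using q(2)[of f] by (simp add: T inner_diff_right algebra_simps)
  then obtain R where R': "(\<forall>f. ?T (blinfun_apply R f) = f) \<and> (\<forall>f. blinfun_apply R (?T f) = f) \<and> norm R \<le> 1 / (1 - q)"
    using coercive_inverse[of "1 - q" ?T] q(1) by auto
  then have R: "R f - X (R f) = f" "R (f - X f) = f" for f by (simp_all add: T[symmetric])
  have aX: "X (J f) = J (X f)" "X (star f) = star (X f)" for f using X by (auto simp: cay_gen_def adm_def)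
  have "R (J f) = J (R f)" for f
    using R(2)[of "J (R f)"] R(1)[of f] by (simp add: aX flip: J_diff)
  moreover have "R (star f) = star (R f)" for f
    using R(2)[of "star (R f)"] R(1)[of f] by (simp add: aX flip: star_diff)
  ultimately have "adm R" by (simp add: adm_def)
  then show ?thesis using R R' by blast
qed

lemma cay_exists: "cay_gen X \<Longrightarrow> \<exists>U. cay X U"
proof -
  assume X: "cay_gen X"
  then obtain q where q0: "0 \<le> q" and q: "q < 1" "\<And>f. \<bar>f \<bullet> X f\<bar> \<le> q * (f \<bullet> f)" by (auto simp: cay_gen_def)
  obtain R where R: "adm R \<and> (\<forall>f. blinfun_apply R (f - X f) = f) \<and> (\<forall>f. blinfun_apply R f - X (blinfun_apply R f) = f)
    \<and> norm R \<le> 1 / (1 - q)" using cay_resolvent[OF X q] ..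
  have "cay X (2 *\<^sub>R R - id_blinfun)"
    unfolding cay_def using R by (simp add: blinfun.diff_left blinfun.add_left blinfun.scaleR_left scaleR_2)
  then show ?thesis by blast
qed

lemma cay_alt:
  assumes "cay X U" "\<And>f. R f - X (R f) = f" shows "U f = 2 *\<^sub>R R f - f"
proof -
  have "U f = R f + X (R f)" using assms(1)[unfolded cay_def, rule_format, of "R f"] assms(2)[of f] by simp
  moreover have "X (R f) = R f - f" using assms(2)[of f] by (simp add: algebra_simps)
  ultimately show ?thesis by (simp add: scaleR_2)
qed

lemma
  assumes X: "cay_gen X" and U: "cay X U"
  shows cay_in_S: "U \<in> S" and cay_neg_ind: "neg_ind U = 0" and cay_inverse: "cay (- X) U' \<Longrightarrow> U' (U f) = f"
    and cay_HS: "HS X \<Longrightarrow> HS (U - id_blinfun)" and cay_S_P1: "U \<in> S_P1"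
proof -
  obtain q where q0: "0 \<le> q" and q: "q < 1" "\<And>f. \<bar>f \<bullet> X f\<bar> \<le> q * (f \<bullet> f)" using X by (auto simp: cay_gen_def)
  obtain R where R': "adm R \<and> (\<forall>f. blinfun_apply R (f - X f) = f) \<and> (\<forall>f. blinfun_apply R f - X (blinfun_apply R f) = f)
    \<and> norm R \<le> 1 / (1 - q)" using cay_resolvent[OF X q] ..
  have mX: "cay_gen (- X)" using cay_gen_scaleR[OF X, of "-1"] by simp
  have Ueq: "U f = 2 *\<^sub>R R f - f" for f using cay_alt[OF U, of R] R' by blast
  have Uf: "U (f - X f) = f + X f" for f using U by (simp add: cay_def)
  have surj1: "\<exists>g. f = g - X g" for f using R' by metis
  have form: "X f \<bullet> C g = - (f \<bullet> C (X g))" for f g using X by (auto simp: cay_gen_def)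
  have aU: "adm U" using R' by (simp add: adm_def Ueq lin_simps)
  have "U f \<bullet> C (U g) = f \<bullet> C g" for f g
  proof -
    obtain f' g' where fg: "f = f' - X f'" "g = g' - X g'" using surj1 by metis
    show ?thesis
      unfolding fg Uf by (simp add: inner_add_left inner_diff_left inner_add_right inner_diff_right C_add C_diff form)
  qed
  then show S: "U \<in> S" using aU by (simp add: S_iff)
  have inv: "U' (U f) = f" if "cay (- X) U'" for U' f
  proof -
    obtain g where g: "f = g - X g" using surj1 by blast
    have "U' (g + X g) = g - X g" using that by (simp add: cay_def blinfun.minus_left)
    then show ?thesis by (simp add: g Uf)
  qed
  then show "cay (- X) U' \<Longrightarrow> U' (U f) = f" .
  obtain q' where q': "q' < 1" "\<And>f. \<bar>f \<bullet> (- X) f\<bar> \<le> q' * (f \<bullet> f)" using mX by (auto simp: cay_gen_def)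
  have surj2: "\<exists>g. f = g + X g" for f
    using cay_resolvent[OF mX q'] by (metis blinfun.minus_left diff_minus_eq_add)
  show "neg_ind U = 0"
    by (rule neg_ind_zeroI[OF S]) (metis surj2 Uf)
  have HS1: "HS (U - id_blinfun)" if h: "HS X"
  proof (rule HS_of_eq)
    show "HS (2 *\<^sub>R (X o\<^sub>L R))" using h R' by (intro HS_scaleR HS_compose_right(1)) (auto simp: adm_clin)
    fix f
    have "X (R f) = R f - f" using R' by (metis diff_diff_eq2 add_diff_cancel_left')
    then show "(U - id_blinfun) f = (2 *\<^sub>R (X o\<^sub>L R)) f"
      by (simp add: blinfun.bilinear_simps Ueq scaleR_2)
  qed
  then show "HS X \<Longrightarrow> HS (U - id_blinfun)" .
  have "HS (blk U)"
  proof (cases "HS X")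
    case True
    have "HS (bP1 o\<^sub>L ((U - id_blinfun) o\<^sub>L bP2))"
      by (intro HS_compose_left(1) HS_compose_right(1) HS1 True clin_blinfun)
    then show ?thesis by (rule HS_of_eq) (simp add: blk_def blinfun.bilinear_simps P1_diff)
  next
    case False
    then have XC: "X (C f) = C (X f)" for f using X by (auto simp: cay_gen_def)
    have RC: "R (C f) = C (R f)" for f
    proof -
      have "R (C (R f) - X (C (R f))) = C (R f)" using R' by blast
      moreover have "C (R f) - X (C (R f)) = C f" using R' by (simp add: XC flip: C_diff)
      ultimately show ?thesis by simp
    qed
    have "P1 (U (P2 f)) = 0" for f
    proof -
      have e: "P1 h = (1/2) *\<^sub>R (C h + h)" "P2 h = (1/2) *\<^sub>R (h - C h)" for h
        by (simp_all add: C_alt P2_def scaleR_diff_right flip: scaleR_2)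
      show ?thesis unfolding Ueq by (simp add: e lin_simps RC scaleR_diff_right scaleR_add_right)
    qed
    then show ?thesis by (intro HS_of_eq[OF HS_zero]) (simp add: blk_def)
  qed
  then show "U \<in> S_P1" using S by (simp add: S_P1_iff)
qed

text \<open>The inverse of the Cayley transform of \<open>X\<close> is the Cayley transform of \<open>- X\<close>.\<close>

lemma cayley_inverse:
  assumes "U \<in> cayley"
  shows "\<exists>U'\<in>cayley. U' o\<^sub>L U = id_blinfun \<and> U o\<^sub>L U' = id_blinfun"
proof -
  obtain X where X: "cay_gen X" "cay X U" using assms by (auto simp: cayley_def)
  have mX: "cay_gen (- X)" using cay_gen_scaleR[OF X(1), of "-1"] by simp
  obtain U' where U': "cay (- X) U'" using cay_exists[OF mX] by blast
  have "U' o\<^sub>L U = id_blinfun" by (rule blinfun_eqI) (simp add: cay_inverse[OF X U'])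
  moreover have "U o\<^sub>L U' = id_blinfun"
    by (rule blinfun_eqI) (use cay_inverse[OF mX U', of U] X(2) in simp)
  ultimately show ?thesis using mX U' by (auto simp: cayley_def)
qed

lemma cayley_ind_zero: "U \<in> cayley \<Longrightarrow> U \<in> S_P1_ind 0"
  using cay_S_P1 cay_neg_ind by (auto simp: cayley_def S_P1_ind_def)

lemma S_P1_ind_S: "U \<in> S_P1_ind n \<Longrightarrow> U \<in> S" "U \<in> S_P1_ind n \<Longrightarrow> U \<in> S_P1"
  by (auto simp: S_P1_ind_def S_P1_iff)

lemma S_P1_ind_left_mult:
  assumes U: "U \<in> S_P1_ind 0" and V: "V \<in> S_P1_ind n"
  shows "U o\<^sub>L V \<in> S_P1_ind n"
proof -
  have u: "\<forall>f. U (dg U f) = f" using U neg_ind_zero_iff[OF S_P1_ind_S(1)[OF U]] by (auto simp: S_P1_ind_def)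
  have "neg_ind (U o\<^sub>L V) = neg_ind V"
    using u S_P1_ind_S(1)[OF V] S_P1_ind_S(1)[OF U]
    by (intro neg_ind_left_invertible[where R="dg U"]) (auto simp: adm_clin adm_dg S_adm)
  then show ?thesis using S_P1_compose[of U V] U V by (simp add: S_P1_ind_def)
qed

lemma hs_norm_scaleR_le:
  assumes "HS A" shows "hsn (a *\<^sub>R A) \<le> \<bar>a\<bar> * hsn A"
proof -
  have "a *\<^sub>R A = (a *\<^sub>R id_blinfun) o\<^sub>L A" by (rule blinfun_eqI) (simp add: blinfun.bilinear_simps)
  then have "hsn (a *\<^sub>R A) \<le> norm (a *\<^sub>R (id_blinfun :: 'k endo)) * hsn A"
    using HS_compose_left(2)[OF assms clin_blinfun(3)[OF clin_blinfun(8)], of a] by simp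
  also have "norm (a *\<^sub>R (id_blinfun :: 'k endo)) \<le> \<bar>a\<bar>"
    by (rule norm_blinfun_bound) (simp_all add: blinfun.scaleR_left)
  finally show ?thesis using mult_right_mono[OF _ hs_norm_nonneg] by fastforce
qed

text \<open>The resolvent identity makes the segment from \<open>0\<close> to \<open>X\<close> a path of Cayley transforms that is
  Lipschitz for the metric.\<close>

lemma cayley_path:
  assumes X: "cay_gen X" and U: "cay X U" and V: "V \<in> S_P1"
  shows "\<exists>c. (\<forall>t\<in>{0..1}. c t \<in> cayley) \<and> c 0 = id_blinfun \<and> c 1 = U \<and>
    (\<exists>K. \<forall>s\<in>{0..1}. \<forall>t\<in>{0..1}. \<delta> (c t o\<^sub>L V) (c s o\<^sub>L V) \<le> K * \<bar>t - s\<bar>)"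
proof -
  have VS: "V \<in> S" and Vb: "HS (blk V)" using V by (auto simp: S_P1_iff)
  obtain q where q0: "0 \<le> q" and q: "q < 1" "\<And>f. \<bar>f \<bullet> X f\<bar> \<le> q * (f \<bullet> f)" using X by (auto simp: cay_gen_def)
  have g: "cay_gen (t *\<^sub>R X)" if "t \<in> {0..1}" for t
    using that by (intro cay_gen_scaleR[OF X]) auto
  have gq: "\<bar>f \<bullet> (t *\<^sub>R X) f\<bar> \<le> q * (f \<bullet> f)" if "t \<in> {0..1}" for t f
  proof -
    have "\<bar>f \<bullet> (t *\<^sub>R X) f\<bar> \<le> 1 * \<bar>f \<bullet> X f\<bar>"
      using that by (simp add: blinfun.scaleR_left abs_mult mult_left_le_one_le)
    then show ?thesis using q(2)[of f] by simp
  qed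
  have "\<forall>t\<in>{0..1}. \<exists>R. adm R \<and> (\<forall>f. blinfun_apply R (f - (t *\<^sub>R X) f) = f) \<and>
      (\<forall>f. blinfun_apply R f - (t *\<^sub>R X) (blinfun_apply R f) = f) \<and> norm R \<le> 1 / (1 - q)"
    using cay_resolvent[OF g q(1) gq] by blast
  then obtain R where R': "\<forall>t\<in>{0..1::real}. adm (R t) \<and> (\<forall>f. blinfun_apply (R t) (f - (t *\<^sub>R X) f) = f) \<and>
      (\<forall>f. blinfun_apply (R t) f - (t *\<^sub>R X) (blinfun_apply (R t) f) = f) \<and> norm (R t) \<le> 1 / (1 - q)"
    unfolding bchoice_iff ..
  define r where "r = 1 / (1 - q)"
  have r0: "0 \<le> r" using q(1) by (simp add: r_def)
  have R: "adm (R t)" "blinfun_apply (R t) (f - t *\<^sub>R X f) = f"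
    "blinfun_apply (R t) f - t *\<^sub>R X (blinfun_apply (R t) f) = f" "norm (R t) \<le> r"
    if "t \<in> {0..1}" for t f
    using bspec[OF R' that] by (auto simp: blinfun.scaleR_left r_def)
  define c where "c t = 2 *\<^sub>R R t - id_blinfun" for t
  have cay_c: "cay (t *\<^sub>R X) (c t)" if "t \<in> {0..1}" for t
    unfolding cay_def c_def
    using R(2)[OF that] by (simp add: blinfun.diff_left blinfun.add_left blinfun.scaleR_left scaleR_2)
  have c0: "c 0 = id_blinfun"
    by (rule blinfun_eqI) (use cay_c[of 0] in \<open>simp add: cay_def\<close>)
  have c1: "c 1 = U"
  proof (rule blinfun_eqI)
    fix f show "c 1 f = U f"
      using cay_alt[OF U, of "blinfun_apply (R 1)" f] R(3)[of 1] by (simp add: c_def blinfun.diff_left blinfun.scaleR_left)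
  qed
  define D where "D s t = R t o\<^sub>L (X o\<^sub>L R s)" for s t
  have res: "R t f - R s f = (t - s) *\<^sub>R D s t f" if "s \<in> {0..1}" "t \<in> {0..1}" for s t f
  proof -
    let ?h = "R s f"
    have "R t f - R s f = R t (?h - s *\<^sub>R X ?h) - R t (?h - t *\<^sub>R X ?h)"
      using R(3)[OF that(1), of f] R(2)[OF that(2), of ?h] by simp
    also have "\<dots> = (t - s) *\<^sub>R R t (X ?h)"
      by (simp add: blinfun.bilinear_simps scaleR_diff_left)
    finally show ?thesis by (simp add: D_def)
  qed
  have nD: "norm (D s t) \<le> r * (norm X * r)" if "s \<in> {0..1}" "t \<in> {0..1}" for s t
    unfolding D_def
    by (intro order_trans[OF norm_blinfun_compose] mult_mono R(4) that order_refl norm_ge_zero r0 mult_nonneg_nonneg)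
  have aX: "adm X" using X by (simp add: cay_gen_def)
  have cD: "clin (D s t)" if "s \<in> {0..1}" "t \<in> {0..1}" for s t
    unfolding D_def using that by (intro adm_clin adm_blinfun R(1) aX)
  have diff: "(c t o\<^sub>L V) - (c s o\<^sub>L V) = (2 * (t - s)) *\<^sub>R (D s t o\<^sub>L V)" if "s \<in> {0..1}" "t \<in> {0..1}" for s t
  proof (rule blinfun_eqI)
    fix f
    have "((c t o\<^sub>L V) - (c s o\<^sub>L V)) f = 2 *\<^sub>R (R t (V f) - R s (V f))"
      by (simp add: c_def blinfun.bilinear_simps scaleR_diff_right)
    also have "\<dots> = ((2 * (t - s)) *\<^sub>R (D s t o\<^sub>L V)) f"
      unfolding res[OF that] scaleR_scaleR blinfun.scaleR_left blinfun_apply_blinfun_compose ..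
    finally show "((c t o\<^sub>L V) - (c s o\<^sub>L V)) f = ((2 * (t - s)) *\<^sub>R (D s t o\<^sub>L V)) f" .
  qed
  have bdiff: "blk (c t o\<^sub>L V) - blk (c s o\<^sub>L V) = (2 * (t - s)) *\<^sub>R (bP1 o\<^sub>L (D s t o\<^sub>L (V o\<^sub>L bP2)))"
    if "s \<in> {0..1}" "t \<in> {0..1}" for s t
  proof (rule blinfun_eqI)
    fix f
    have "(blk (c t o\<^sub>L V) - blk (c s o\<^sub>L V)) f = P1 (((c t o\<^sub>L V) - (c s o\<^sub>L V)) (P2 f))"
      by (simp add: blk_def blinfun.bilinear_simps P1_diff)
    also have "\<dots> = ((2 * (t - s)) *\<^sub>R (bP1 o\<^sub>L (D s t o\<^sub>L (V o\<^sub>L bP2)))) f"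
      unfolding diff[OF that] by (simp add: blinfun.bilinear_simps P1_scaleR)
    finally show "(blk (c t o\<^sub>L V) - blk (c s o\<^sub>L V)) f = ((2 * (t - s)) *\<^sub>R (bP1 o\<^sub>L (D s t o\<^sub>L (V o\<^sub>L bP2)))) f" .
  qed
  have "\<exists>L. \<forall>s\<in>{0..1}. \<forall>t\<in>{0..1}. HS (bP1 o\<^sub>L (D s t o\<^sub>L (V o\<^sub>L bP2))) \<and> hsn (bP1 o\<^sub>L (D s t o\<^sub>L (V o\<^sub>L bP2))) \<le> L"
  proof (cases "HS X")
    case True
    have "HS (bP1 o\<^sub>L (D s t o\<^sub>L (V o\<^sub>L bP2))) \<and>
        hsn (bP1 o\<^sub>L (D s t o\<^sub>L (V o\<^sub>L bP2))) \<le> norm bP1 * (norm (V o\<^sub>L bP2) * (r * (r * hsn X)))"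
      if st: "s \<in> {0..1}" "t \<in> {0..1}" for s t
    proof -
      have 1: "HS (X o\<^sub>L R s)" "hsn (X o\<^sub>L R s) \<le> norm (R s) * hsn X"
        using HS_compose_right[OF True adm_clin[OF R(1)[OF st(1)]]] by auto
      have 2: "HS (D s t)" "hsn (D s t) \<le> norm (R t) * hsn (X o\<^sub>L R s)"
        unfolding D_def using HS_compose_left[OF 1(1) adm_clin[OF R(1)[OF st(2)]]] by auto
      have cV: "clin (V o\<^sub>L bP2)" by (intro clin_blinfun S_clin[OF VS])
      have 3: "HS (D s t o\<^sub>L (V o\<^sub>L bP2))" "hsn (D s t o\<^sub>L (V o\<^sub>L bP2)) \<le> norm (V o\<^sub>L bP2) * hsn (D s t)"
        using HS_compose_right[OF 2(1) cV] by auto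
      have 4: "HS (bP1 o\<^sub>L (D s t o\<^sub>L (V o\<^sub>L bP2)))"
        "hsn (bP1 o\<^sub>L (D s t o\<^sub>L (V o\<^sub>L bP2))) \<le> norm bP1 * hsn (D s t o\<^sub>L (V o\<^sub>L bP2))"
        using HS_compose_left[OF 3(1) clin_blinfun(5)] by auto
      have "hsn (X o\<^sub>L R s) \<le> r * hsn X"
        by (rule order_trans[OF 1(2)]) (intro mult_right_mono R(4) st hs_norm_nonneg)
      then have "hsn (D s t) \<le> r * (r * hsn X)"
        by (intro order_trans[OF 2(2)] mult_mono R(4) st hs_norm_nonneg r0)
      then have "hsn (D s t o\<^sub>L (V o\<^sub>L bP2)) \<le> norm (V o\<^sub>L bP2) * (r * (r * hsn X))"
        by (intro order_trans[OF 3(2)] mult_left_mono) auto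
      then show ?thesis using 4 by (intro conjI order_trans[OF 4(2)] mult_left_mono) auto
    qed
    then show ?thesis by blast
  next
    case False
    then have XC: "X (C f) = C (X f)" for f using X by (auto simp: cay_gen_def)
    have P1C: "P1 h = (1/2) *\<^sub>R (C h + h)" for h by (simp add: C_alt)
    have RC: "R t (C f) = C (R t f)" if "t \<in> {0..1}" for t f
    proof -
      have "R t (C (R t f) - t *\<^sub>R X (C (R t f))) = C (R t f)" by (rule R(2)[OF that])
      moreover have "C (R t f) - t *\<^sub>R X (C (R t f)) = C f"
        using R(3)[OF that, of f] by (simp add: XC flip: C_diff C_scaleR)
      ultimately show ?thesis by simp
    qed
    have "HS (bP1 o\<^sub>L (D s t o\<^sub>L (V o\<^sub>L bP2))) \<and>
        hsn (bP1 o\<^sub>L (D s t o\<^sub>L (V o\<^sub>L bP2))) \<le> (r * (norm X * r)) * hsn (blk V)"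
      if st: "s \<in> {0..1}" "t \<in> {0..1}" for s t
    proof -
      have eq: "bP1 o\<^sub>L (D s t o\<^sub>L (V o\<^sub>L bP2)) = D s t o\<^sub>L blk V"
        by (rule blinfun_eqI) (simp add: blk_def D_def P1C RC[OF st(1)] RC[OF st(2)] XC lin_simps)
      show ?thesis unfolding eq
        using HS_compose_left[OF Vb cD[OF st]] mult_right_mono[OF nD[OF st] hs_norm_nonneg] order_trans by blast
    qed
    then show ?thesis by blast
  qed
  then obtain L where L: "\<And>s t. s \<in> {0..1} \<Longrightarrow> t \<in> {0..1} \<Longrightarrow> HS (bP1 o\<^sub>L (D s t o\<^sub>L (V o\<^sub>L bP2)))"
    "\<And>s t. s \<in> {0..1} \<Longrightarrow> t \<in> {0..1} \<Longrightarrow> hsn (bP1 o\<^sub>L (D s t o\<^sub>L (V o\<^sub>L bP2))) \<le> L" by metis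
  have "\<delta> (c t o\<^sub>L V) (c s o\<^sub>L V) \<le> (2 * (r * (norm X * r) * norm V) + 2 * L) * \<bar>t - s\<bar>"
    if st: "s \<in> {0..1}" "t \<in> {0..1}" for s t
  proof -
    have "norm ((c t o\<^sub>L V) - (c s o\<^sub>L V)) \<le> \<bar>2 * (t - s)\<bar> * (norm (D s t) * norm V)"
      unfolding diff[OF st] norm_scaleR by (intro mult_left_mono norm_blinfun_compose) simp
    also have "\<dots> \<le> \<bar>2 * (t - s)\<bar> * (r * (norm X * r) * norm V)"
      by (intro mult_left_mono mult_right_mono nD st) auto
    finally have 1: "norm ((c t o\<^sub>L V) - (c s o\<^sub>L V)) \<le> \<bar>2 * (t - s)\<bar> * (r * (norm X * r) * norm V)" .
    have "hsn (blk (c t o\<^sub>L V) - blk (c s o\<^sub>L V)) \<le> \<bar>2 * (t - s)\<bar> * hsn (bP1 o\<^sub>L (D s t o\<^sub>L (V o\<^sub>L bP2)))"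
      unfolding bdiff[OF st] by (rule hs_norm_scaleR_le[OF L(1)[OF st]])
    also have "\<dots> \<le> \<bar>2 * (t - s)\<bar> * L" by (intro mult_left_mono L(2) st) simp
    finally show ?thesis using 1 unfolding \<delta>_eq abs_mult by (simp add: algebra_simps)
  qed
  then have "\<exists>K. \<forall>s\<in>{0..1}. \<forall>t\<in>{0..1}. \<delta> (c t o\<^sub>L V) (c s o\<^sub>L V) \<le> K * \<bar>t - s\<bar>" by blast
  moreover have "c t \<in> cayley" if "t \<in> {0..1}" for t
    unfolding cayley_def using cay_c[OF that] g[OF that] by blast
  ultimately show ?thesis using c0 c1 by blast
qed

lemma id_compose [simp]: "id_blinfun o\<^sub>L V = V" "V o\<^sub>L id_blinfun = V"
  by (rule blinfun_eqI, simp)+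

definition top_S :: "'k endo topology" where "top_S = Metric_space.mtopology S_P1 \<delta>"

lemma cayley_connected:
  assumes U: "U \<in> cayley" and V: "V \<in> S_P1"
  shows "connected_component_of top_S V (U o\<^sub>L V)"
proof -
  interpret M: Metric_space S_P1 \<delta> by (rule metric_\<delta>)
  obtain X where X: "cay_gen X" "cay X U" using U by (auto simp: cayley_def)
  obtain c where c: "(\<forall>t\<in>{0..1}. c t \<in> cayley) \<and> c 0 = id_blinfun \<and> c 1 = U \<and>
    (\<exists>K. \<forall>s\<in>{0..1}. \<forall>t\<in>{0..1}. \<delta> (c t o\<^sub>L V) (c s o\<^sub>L V) \<le> K * \<bar>t - s\<bar>)"
    using cayley_path[OF X V] ..
  then obtain K where K: "\<And>s t. s \<in> {0..1} \<Longrightarrow> t \<in> {0..1} \<Longrightarrow> \<delta> (c t o\<^sub>L V) (c s o\<^sub>L V) \<le> K * \<bar>t - s\<bar>"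
    by blast
  have in_S: "c t o\<^sub>L V \<in> S_P1" if "t \<in> {0..1}" for t
    using c that S_P1_compose[OF S_P1_ind_S(2)[OF cayley_ind_zero] V] by blast
  have cont: "continuous_map (top_of_set {0..1::real}) top_S (\<lambda>t. c t o\<^sub>L V)"
    unfolding top_S_def M.continuous_map_to_metric
  proof (intro ballI allI impI)
    fix s e assume s: "s \<in> topspace (top_of_set {0..1::real})" and e: "(0::real) < e"
    let ?W = "{0..1} \<inter> ball s (e / (\<bar>K\<bar> + 1))"
    have Kp: "0 < \<bar>K\<bar> + 1" by linarith
    have "c t o\<^sub>L V \<in> M.mball (c s o\<^sub>L V) e" if t: "t \<in> ?W" for t
    proof -
      have "\<delta> (c s o\<^sub>L V) (c t o\<^sub>L V) \<le> K * \<bar>s - t\<bar>" using K[of t s] s t by simp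
      also have "\<dots> \<le> (\<bar>K\<bar> + 1) * \<bar>s - t\<bar>" by (rule mult_right_mono) auto
      also have "\<dots> < e"
        using t by (simp add: dist_real_def pos_less_divide_eq[OF Kp] mult.commute)
      finally show ?thesis using in_S s t by simp
    qed
    moreover have "openin (top_of_set {0..1}) ?W" by (rule openin_open_Int) simp
    moreover have "s \<in> ?W" using s e Kp by simp
    ultimately show "\<exists>W. openin (top_of_set {0..1}) W \<and> s \<in> W \<and> (\<forall>t\<in>W. c t o\<^sub>L V \<in> M.mball (c s o\<^sub>L V) e)"
      by blast
  qed
  have "connectedin (top_of_set {0..1::real}) {0..1}"
    by (simp add: connectedin_subtopology)
  from connectedin_continuous_map_image[OF cont this]
  have "connectedin top_S ((\<lambda>t. c t o\<^sub>L V) ` {0..1})" .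
  moreover have "V \<in> (\<lambda>t. c t o\<^sub>L V) ` {0..1}"
    using c by (intro image_eqI[of _ _ 0]) (auto simp: id_compose)
  moreover have "U o\<^sub>L V \<in> (\<lambda>t. c t o\<^sub>L V) ` {0..1}"
    using c by (intro image_eqI[of _ _ 1]) auto
  ultimately show ?thesis unfolding connected_component_of_def by blast
qed

lemma S_P1_ind_openin: "openin top_S (S_P1_ind n)"
proof -
  interpret M: Metric_space S_P1 \<delta> by (rule metric_\<delta>)
  show ?thesis
    unfolding top_S_def M.openin_mtopology
  proof (intro conjI allI impI)
    show "S_P1_ind n \<subseteq> S_P1" by (auto simp: S_P1_ind_def)
    fix V assume V: "V \<in> S_P1_ind n"
    have "M.mball V (1 / (norm V + 2)) \<subseteq> S_P1_ind n"
    proof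
      fix W assume W: "W \<in> M.mball V (1 / (norm V + 2))"
      then have "norm (V - W) < 1 / (norm V + 2)"
        using hs_norm_nonneg[of "blinfun_apply (blk V - blk W)"] by (simp add: \<delta>_eq)
      then have "neg_ind V = neg_ind W"
        using V W by (intro neg_ind_locally_constant) (auto simp: S_P1_ind_def S_P1_iff)
      then show "W \<in> S_P1_ind n" using V W by (simp add: S_P1_ind_def)
    qed
    then show "\<exists>r>0. M.mball V r \<subseteq> S_P1_ind n"
      by (intro exI[of _ "1 / (norm V + 2)"]) (simp add: add_nonneg_pos)
  qed
qed

section \<open>Reduction to diagonal operators\<close>

text \<open>If \<open>z = tanh (2 \<theta>)\<close> formally, then \<open>X = tanh \<theta>\<close> is the fixed point of
  \<open>X = z (1 + X\<^sup>2) / 2\<close>.\<close>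

lemma half_angle:
  assumes z: "adm z" "\<And>f g. z f \<bullet> g = f \<bullet> z g" "\<And>f. z (C f) = - C (z f)" "HS z" "norm z < 1"
  obtains X :: "'k endo" where "cay_gen X" "HS X" "norm X < 1"
    "\<And>f g. X f \<bullet> g = f \<bullet> X g"
    "\<And>f. X (C f) = - C (X f)"
    "\<And>f. 2 *\<^sub>R X f = z f + z (X (X f))"
    "\<And>f. z f = 0 \<Longrightarrow> X f = 0"
    "\<forall>B. (\<forall>f. blinfun_apply B (z f) = z (blinfun_apply B f)) \<longrightarrow>
      (\<forall>f. blinfun_apply B (X f) = X (blinfun_apply B f))"
proof -
  let ?Y = "quad_iter z z"
  obtain X where lim: "\<And>f. (\<lambda>n. ?Y n f) \<longlonglongrightarrow> blinfun_apply X f" and X1: "norm X \<le> 1"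
    and fix0: "\<And>f. blinfun_apply X f = (1/2) *\<^sub>R (z f + z (blinfun_apply X (blinfun_apply X f)))"
    using quad_iter_limit[of z z] z(5) by (metis less_imp_le)
  note YS = quad_iter_Suc[of z z]
  have zz: "z (J f) = J (z f)" "z (star f) = star (z f)" for f using z(1) by (auto simp: adm_def)
  have odd: "?Y n (C f) = - C (?Y n f)" for n f
  proof (induction n arbitrary: f)
    case (Suc n)
    show ?case unfolding YS by (simp add: Suc z(3) lin_simps scaleR_add_right scaleR_diff_right)
  qed simp
  have ker: "?Y n f = 0" if "z f = 0" for n f
  proof (induction n)
    case (Suc n)
    show ?case unfolding YS by (simp add: Suc that)
  qed simp
  have Xcomm: "B (X f) = X (B f)" if "\<And>f. blinfun_apply B (z f) = z (B f)" for B f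
    by (rule quad_iter_limit_commute[OF lim that that])
  have Xsym: "X f \<bullet> g = f \<bullet> X g" for f g
    by (rule quad_iter_limit_symmetric[OF lim z(2) z(2) refl])
  have Xodd: "X (C f) = - C (X f)" for f
  proof (rule LIMSEQ_unique)
    show "(\<lambda>n. ?Y n (C f)) \<longlonglongrightarrow> X (C f)" by (rule lim)
    have "(\<lambda>n. - bC (?Y n f)) \<longlonglongrightarrow> - bC (X f)" by (intro tendsto_intros lim)
    then show "(\<lambda>n. ?Y n (C f)) \<longlonglongrightarrow> - C (X f)" by (simp add: odd)
  qed
  have Xker: "X f = 0" if "z f = 0" for f
    by (rule LIMSEQ_unique[OF lim]) (simp add: ker[OF that])
  have Xadm: "adm X"
    unfolding adm_def using Xcomm[of bJ] Xcomm[of bstar] zz by auto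
  have Xeq: "X = (1/2) *\<^sub>R (z + (z o\<^sub>L (X o\<^sub>L X)))"
    by (rule blinfun_eqI) (simp add: blinfun.bilinear_simps fix0[symmetric] flip: scaleR_add_right)
  have HSX: "HS X"
    by (subst Xeq) (intro HS_scaleR HS_add(1) z(4) HS_compose_right(1) clin_blinfun adm_clin Xadm)
  have "norm X \<le> norm z"
  proof (rule norm_blinfun_bound)
    fix f
    have "norm (X f) = (1/2) * norm (z f + z (X (X f)))" using arg_cong[OF fix0[of f], of norm] by simp
    also have "\<dots> \<le> (1/2) * (norm z * norm f + norm z * (1 * (1 * norm f)))"
    proof (intro mult_left_mono norm_triangle_le add_mono norm_blinfun)
      have "norm (X h) \<le> 1 * norm h" for h
        using norm_blinfun[of X h] mult_right_mono[OF X1, of "norm h"] by simp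
      then have "norm (X (X f)) \<le> 1 * (1 * norm f)" by (metis order_trans mult_1)
      then show "norm (z (X (X f))) \<le> norm z * (1 * (1 * norm f))"
        by (intro order_trans[OF norm_blinfun[of z]] mult_left_mono) auto
    qed simp
    finally show "norm (X f) \<le> norm z * norm f" by (simp add: mult.commute)
  qed simp
  then have Xn: "norm X < 1" using z(5) by simp
  have "\<bar>f \<bullet> X f\<bar> \<le> norm X * (f \<bullet> f)" for f
  proof -
    have "\<bar>f \<bullet> X f\<bar> \<le> norm f * (norm X * norm f)"
      by (intro order_trans[OF Cauchy_Schwarz_ineq2] mult_left_mono norm_blinfun) simp
    then show ?thesis by (simp add: power2_norm_eq_inner[symmetric] power2_eq_square mult.left_commute)
  qed
  then have gen: "cay_gen X"
    unfolding cay_gen_def using Xadm HSX Xn Xodd Xsym by (auto intro!: exI[of _ "norm X"])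
  have eq: "2 *\<^sub>R X f = z f + z (X (X f))" for f
    using arg_cong[OF fix0[of f], of "\<lambda>x. 2 *\<^sub>R x"] by simp
  show thesis by (rule that[OF gen HSX Xn Xsym Xodd eq Xker]) (assumption, intro allI impI, rule Xcomm, erule spec)
qed

text \<open>The inverse of the resulting Cayley transform is \<open>(1 - z\<^sup>2)\<^sup>-\<^sup>1\<^sup>/\<^sup>2 (1 - z)\<close>, where the first
  factor is even and trivial on the kernel of \<open>z\<close>.\<close>

lemma reducing_cayley:
  assumes z: "adm z" "\<And>f g. z f \<bullet> g = f \<bullet> z g" "\<And>f. z (C f) = - C (z f)" "HS z" "norm z < 1"
  obtains U U' N :: "'k endo" where "U \<in> cayley" "U \<in> S_HS" "U' \<in> cayley" "U o\<^sub>L U' = id_blinfun"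
    "\<And>f. U' f = N (f - z f)"
    "\<And>f. N (C f) = C (N f)" "\<And>f. z f = 0 \<Longrightarrow> N f = f"
    "\<forall>B. (\<forall>f. blinfun_apply B (z f) = z (blinfun_apply B f)) \<longrightarrow>
      (\<forall>f. blinfun_apply B (N f) = N (blinfun_apply B f))"
proof -
  obtain X where gX: "cay_gen X" and hX: "HS X" and nX: "norm X < 1"
    and sX: "\<And>f g. blinfun_apply X f \<bullet> g = f \<bullet> blinfun_apply X g"
    and oX: "\<And>f. blinfun_apply X (C f) = - C (blinfun_apply X f)"
    and fX: "\<And>f. 2 *\<^sub>R blinfun_apply X f = z f + z (blinfun_apply X (blinfun_apply X f))"
    and kX: "\<And>f. z f = 0 \<Longrightarrow> blinfun_apply X f = 0"
    and cX0: "\<forall>B. (\<forall>f. blinfun_apply B (z f) = z (blinfun_apply B f)) \<longrightarrow>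
      (\<forall>f. blinfun_apply B (blinfun_apply X f) = blinfun_apply X (blinfun_apply B f))"
    by (rule half_angle[OF z]) (rule that; blast)
  have cX: "B (X f) = X (B f)" if "\<And>f. blinfun_apply B (z f) = z (B f)" for B f using cX0 that by blast
  have mX: "cay_gen (- X)" using cay_gen_scaleR[OF gX, of "-1"] by simp
  obtain U where U: "cay X U" using cay_exists[OF gX] by blast
  obtain U' where U': "cay (- X) U'" using cay_exists[OF mX] by blast
  have UU': "U o\<^sub>L U' = id_blinfun"
    by (rule blinfun_eqI) (use cay_inverse[OF mX U', of U] U in simp)
  let ?T = "id_blinfun - (X o\<^sub>L X)"
  have T: "?T f = f - X (X f)" for f by (simp add: blinfun.bilinear_simps)
  have "(1 - norm X) * (f \<bullet> f) \<le> f \<bullet> ?T f" for f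
  proof -
    have "f \<bullet> X (X f) = (norm (X f))\<^sup>2" by (simp add: sX[symmetric] power2_norm_eq_inner)
    also have "\<dots> \<le> (norm X * norm f)\<^sup>2" by (intro power_mono norm_blinfun) simp
    also have "\<dots> = (norm X)\<^sup>2 * (f \<bullet> f)" by (simp add: power_mult_distrib power2_norm_eq_inner)
    also have "\<dots> \<le> norm X * (f \<bullet> f)"
      using nX by (intro mult_right_mono) (auto simp: power2_eq_square mult_left_le_one_le)
    finally show ?thesis by (simp add: T inner_diff_right algebra_simps)
  qed
  then obtain Q where Q': "(\<forall>f. ?T (blinfun_apply Q f) = f) \<and> (\<forall>f. blinfun_apply Q (?T f) = f) \<and> norm Q \<le> 1 / (1 - norm X)"
    using coercive_inverse[of "1 - norm X" ?T] nX by auto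
  then have Q: "Q f - X (X (Q f)) = f" "Q (f - X (X f)) = f" for f by (simp_all add: T[symmetric])
  have Qcomm: "B (Q f) = Q (B f)" if "\<And>f. blinfun_apply B (X (X f)) = X (X (B f))" for B f
  proof -
    have "Q (B (Q f) - X (X (B (Q f)))) = B (Q f)" by (rule Q(2))
    moreover have "B (Q f) - X (X (B (Q f))) = B f"
      using Q(1)[of f] by (simp add: that[symmetric] flip: blinfun.diff_right)
    ultimately show ?thesis by simp
  qed
  define N where "N = Q + (X o\<^sub>L (X o\<^sub>L Q))"
  have N: "N f = Q f + X (X (Q f))" for f by (simp add: N_def blinfun.bilinear_simps)
  have Ncomm: "B (N f) = N (B f)" if "\<And>f. blinfun_apply B (z f) = z (B f)" for B f
    using cX[OF that] Qcomm[of B] by (simp add: N blinfun.add_right)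
  have UN0: "U' h = N h - z (N h)" for h
  proof -
    let ?k = "Q h"
    have h: "h = (?k - X ?k) - (- X) (?k - X ?k)"
      using Q(1)[of h] by (simp add: blinfun.bilinear_simps)
    have "U' h = (?k - X ?k) + (- X) (?k - X ?k)"
      by (subst h) (rule U'[unfolded cay_def, rule_format])
    also have "\<dots> = N h - 2 *\<^sub>R X ?k" by (simp add: N blinfun.bilinear_simps scaleR_2)
    also have "\<dots> = N h - z (N h)" by (simp add: fX N blinfun.add_right)
    finally show ?thesis .
  qed
  have UN: "U' f = N (f - z f)" for f
    unfolding UN0 using Ncomm[of z, OF refl] by (simp add: blinfun.diff_right)
  have NC: "N (C f) = C (N f)" for f
  proof -
    have "Q (C f) = C (Q f)" using Qcomm[of bC f] by (simp add: oX lin_simps)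
    then show ?thesis by (simp add: N oX lin_simps)
  qed
  have Nker: "N f = f" if "z f = 0" for f
  proof -
    have x: "X f = 0" by (rule kX[OF that])
    have "Q f = f" using Q(2)[of f] x by simp
    then show ?thesis by (simp add: N x)
  qed
  have "hilbert_schmidt (blinfun_apply (U - id_blinfun))"
    using cay_HS[OF gX U hX] by (simp only: HS_def)
  moreover have "blinfun_apply (U - id_blinfun) = (\<lambda>f. U f - f)"
    by (simp add: fun_eq_iff blinfun.diff_left)
  ultimately have UHS: "U \<in> S_HS" using cay_in_S[OF gX U] by (simp add: S_HS_def)
  have Uc: "U \<in> cayley" "U' \<in> cayley" using gX mX U U' by (auto simp: cayley_def)
  show thesis
    by (rule that[OF Uc(1) UHS Uc(2) UU' UN NC Nker]) (assumption, intro allI impI, rule Ncomm, erule spec)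
qed

text \<open>The even and odd parts with respect to the grading \<open>C\<close>.\<close>

definition ev :: "'k endo \<Rightarrow> 'k endo" where "ev V = (1/2) *\<^sub>R (V + (bC o\<^sub>L (V o\<^sub>L bC)))"
definition od :: "'k endo \<Rightarrow> 'k endo" where "od V = (1/2) *\<^sub>R (V - (bC o\<^sub>L (V o\<^sub>L bC)))"

lemma ev_apply: "ev V f = (1/2) *\<^sub>R (V f + C (V (C f)))" and od_apply: "od V f = (1/2) *\<^sub>R (V f - C (V (C f)))"
  by (simp_all add: ev_def od_def blinfun.bilinear_simps)

lemma ev_C: "ev V (C f) = C (ev V f)" and od_C: "od V (C f) = - C (od V f)"
  by (simp_all add: ev_apply od_apply C_scaleR C_add C_diff add.commute flip: scaleR_minus_right)

lemma ev_od_add: "blinfun_apply V f = ev V f + od V f"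
  by (simp add: ev_apply od_apply flip: scaleR_add_right)

lemma adm_ev_od: assumes "adm V" shows "adm (ev V)" "adm (od V)"
  using assms by (auto simp: adm_def ev_apply od_apply C_J C_star lin_simps)

lemma ev_od_unique:
  assumes "\<And>f. blinfun_apply V f = a f + b f" "\<And>f. a (C f) = C (a f)" "\<And>f. b (C f) = - C (b f)"
  shows "ev V f = a f" "od V f = b f"
  by (simp_all add: ev_apply od_apply assms C_add C_diff C_minus flip: scaleR_2)

text \<open>The odd part is the sum of the block \<open>V\<^sub>1\<^sub>2\<close> and its conjugate \<open>V\<^sub>2\<^sub>1\<close> under the involution.\<close>

lemma HS_od_iff: assumes V: "adm V" shows "HS (od V) \<longleftrightarrow> HS (blk V)"
proof
  assume h: "HS (od V)"
  have "HS (bP1 o\<^sub>L (od V o\<^sub>L bP2))" by (intro HS_compose_left(1) HS_compose_right(1) h clin_blinfun)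
  moreover have "blk V f = (bP1 o\<^sub>L (od V o\<^sub>L bP2)) f" for f
    by (simp add: blk_def od_apply C_def lin_simps flip: scaleR_2)
  ultimately show "HS (blk V)" by (rule HS_of_eq)
next
  assume h: "HS (blk V)"
  have "HS (blk V + (bstar o\<^sub>L (blk V o\<^sub>L bstar)))" by (intro HS_add(1) HS_bar h)
  moreover have "od V f = (blk V + (bstar o\<^sub>L (blk V o\<^sub>L bstar))) f" for f
  proof -
    have Vs: "V (star g) = star (V g)" for g using V by (simp add: adm_def)
    have "(bstar o\<^sub>L (blk V o\<^sub>L bstar)) f = P2 (V (P1 f))"
      by (simp add: blk_def P2_star P1_star Vs)
    moreover have "od V f = P1 (V (P2 f)) + P2 (V (P1 f))"
    proof -
      have "V f = V (P1 f) + V (P2 f)" by (simp add: P1_P2_add flip: blinfun.add_right)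
      moreover have "V (C f) = V (P1 f) - V (P2 f)" by (simp add: C_def blinfun.diff_right)
      ultimately show ?thesis
        by (simp add: od_apply C_def P2_def lin_simps scaleR_diff_right scaleR_add_right)
           (simp add: algebra_simps flip: scaleR_2)
    qed
    ultimately show ?thesis by (simp add: blk_def blinfun.add_left)
  qed
  ultimately show "HS (od V)" by (rule HS_of_eq)
qed

text \<open>These are the even and the odd part of the equation \<open>(a\<^sup>* - b\<^sup>*) (a + b) = 1\<close>, to which \<open>V\<^sup>\<dagger> V = 1\<close>
  amounts because \<open>V\<^sup>\<dagger> = a\<^sup>* - b\<^sup>*\<close>.\<close>

lemma ev_od_relations:
  assumes V: "V \<in> S"
  shows "ev V f \<bullet> ev V g - od V f \<bullet> od V g = f \<bullet> g" "od V f \<bullet> ev V g = ev V f \<bullet> od V g"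
proof -
  have 1: "(ev V f + od V f) \<bullet> (ev V g - od V g) = f \<bullet> g" for f g
    using S_form[OF V, of f "C g"] by (simp add: ev_od_add[of V] ev_C od_C C_diff)
  have 2: "(ev V f - od V f) \<bullet> (ev V g + od V g) = f \<bullet> g"
    using 1[of g f] by (simp add: inner_commute)
  show "ev V f \<bullet> ev V g - od V f \<bullet> od V g = f \<bullet> g" "od V f \<bullet> ev V g = ev V f \<bullet> od V g"
    using 1[of f g] 2 by (simp_all add: inner_add_left inner_add_right inner_diff_left inner_diff_right)
qed

text \<open>The equation \<open>a\<^sup>* a = 1 + b\<^sup>* b\<close> makes \<open>a\<^sup>* a\<close> coercive, so \<open>p = a (a\<^sup>* a)\<^sup>-\<^sup>1 a\<^sup>*\<close> is the orthogonal
  projection onto the range of \<open>a\<close>, and \<open>Z = b (a\<^sup>* a)\<^sup>-\<^sup>1 a\<^sup>*\<close> satisfies \<open>Z a = b\<close> and vanishes on the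
  orthogonal complement of that range. The norm of \<open>Z\<close> is less than one because
  \<open>\<parallel>b h\<parallel>\<^sup>2 = \<parallel>a h\<parallel>\<^sup>2 - \<parallel>h\<parallel>\<^sup>2\<close>, where \<open>\<parallel>h\<parallel>\<close> is bounded below by a multiple of \<open>\<parallel>a h\<parallel>\<close>.\<close>

lemma graph_operator:
  assumes V: "V \<in> S_P1"
  obtains p Z :: "'k endo" where "adm Z" "HS Z" "norm Z < 1" "\<And>f. Z (C f) = - C (Z f)"
    "\<And>f. Z (ev V f) = od V f" "\<And>f. Z (p f) = Z f"
    "\<And>f. p (ev V f) = ev V f" "\<And>f. \<exists>h. p f = ev V h"
    "\<And>f g. p f \<bullet> g = f \<bullet> p g" "adm p"
    "\<And>f. p (C f) = C (p f)"
proof -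
  have VS: "V \<in> S" and aV: "adm V" and Vb: "HS (blk V)" using V by (auto simp: S_P1_iff S_adm)
  let ?a = "ev V" and ?b = "od V"
  note rel = ev_od_relations[OF VS]
  have sq: "(norm (?a f))\<^sup>2 = (norm f)\<^sup>2 + (norm (?b f))\<^sup>2" for f
    using rel(1)[of f f] by (simp add: power2_norm_eq_inner)
  let ?L = "hadj ?a o\<^sub>L ?a"
  have "1 * (f \<bullet> f) \<le> f \<bullet> ?L f" for f
    using sq[of f] by (simp add: inner_hadj_right power2_norm_eq_inner)
  from coercive_inverse[OF zero_less_one this]
  obtain G where "(\<forall>f. ?L (blinfun_apply G f) = f) \<and> (\<forall>f. blinfun_apply G (?L f) = f) \<and> norm G \<le> 1 / 1" ..
  then have G: "hadj ?a (?a (G f)) = f" "G (hadj ?a (?a f)) = f" for f by simp_all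
  have Gcomm: "T (G f) = G (T f)" if "\<And>f. hadj ?a (?a (T f)) = T (hadj ?a (?a f))" for T f
    using G(2)[of "T (G f)"] by (simp add: that G(1))
  have aa: "adm ?a" "adm ?b" using adm_ev_od[OF aV] by auto
  have ah: "adm (hadj ?a)" by (rule adm_hadj[OF aa(1)])
  have hC: "hadj ?a (C f) = C (hadj ?a f)" for f
    by (rule vector_eq_rdot[THEN iffD1]) (simp add: inner_hadj_left inner_C ev_C)
  have aG: "adm G"
  proof -
    have "J (G f) = G (J f)" for f by (rule Gcomm) (use aa(1) ah in \<open>simp add: adm_def\<close>)
    moreover have "star (G f) = G (star f)" for f by (rule Gcomm) (use aa(1) ah in \<open>simp add: adm_def\<close>)
    ultimately show ?thesis by (simp add: adm_def)
  qed
  have GC: "G (C f) = C (G f)" for f by (rule Gcomm[symmetric]) (simp add: hC ev_C)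
  define p where "p = ?a o\<^sub>L (G o\<^sub>L hadj ?a)"
  define Z where "Z = ?b o\<^sub>L (G o\<^sub>L hadj ?a)"
  have p: "p f = ?a (G (hadj ?a f))" and Z: "Z f = ?b (G (hadj ?a f))" for f by (simp_all add: p_def Z_def)
  have adm: "adm p" "adm Z" unfolding p_def Z_def by (intro adm_blinfun aa ah aG)+
  have Gsym: "G f \<bullet> g = f \<bullet> G g" for f g
  proof -
    have "G f \<bullet> hadj ?a (?a (G g)) = hadj ?a (?a (G f)) \<bullet> G g"
      by (simp add: inner_hadj_left inner_hadj_right)
    then show ?thesis by (simp add: G)
  qed
  have psym: "p f \<bullet> g = f \<bullet> p g" for f g
  proof -
    have "p f \<bullet> g = G (hadj ?a f) \<bullet> hadj ?a g" unfolding p by (rule inner_hadj_right[symmetric])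
    also have "\<dots> = hadj ?a f \<bullet> G (hadj ?a g)" by (rule Gsym)
    also have "\<dots> = f \<bullet> p g" unfolding p by (rule inner_hadj_left)
    finally show ?thesis .
  qed
  have pp: "p (p f) = p f" for f by (simp add: p G)
  have np: "(norm (p f))\<^sup>2 \<le> (norm f)\<^sup>2" for f
  proof -
    have "(norm (p f))\<^sup>2 = p f \<bullet> f" by (simp add: power2_norm_eq_inner psym[of f "p f"] pp inner_commute[of f])
    also have "\<dots> \<le> norm (p f) * norm f" by (rule norm_cauchy_schwarz)
    finally have "norm (p f) \<le> norm f"
      by (cases "norm (p f) = 0") (auto simp: power2_eq_square)
    then show ?thesis by (intro power_mono) auto
  qed
  define m where "m = (norm ?a)\<^sup>2 + 1"
  have m: "1 \<le> m" by (simp add: m_def)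
  have d: "(1 - 1 / m) * x = x - x / m" for x by (simp add: left_diff_distrib)
  have nZ: "(norm (Z f))\<^sup>2 \<le> (1 - 1 / m) * (norm f)\<^sup>2" for f
  proof -
    let ?h = "G (hadj ?a f)"
    have "(norm (?a ?h))\<^sup>2 \<le> (norm ?a * norm ?h)\<^sup>2" by (intro power_mono norm_blinfun) simp
    also have "\<dots> \<le> m * (norm ?h)\<^sup>2" by (simp add: m_def power_mult_distrib distrib_right)
    finally have "(norm (?a ?h))\<^sup>2 / m \<le> (norm ?h)\<^sup>2" using m by (simp add: divide_le_eq mult.commute)
    then have "(norm (?b ?h))\<^sup>2 \<le> (1 - 1 / m) * (norm (?a ?h))\<^sup>2" using sq[of ?h] d[of "(norm (?a ?h))\<^sup>2"] by linarith
    also have "\<dots> \<le> (1 - 1 / m) * (norm f)\<^sup>2" using np[of f] m by (intro mult_left_mono) (auto simp: p)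
    finally show ?thesis by (simp add: Z)
  qed
  have "norm Z \<le> sqrt (1 - 1 / m)"
  proof (rule norm_blinfun_bound)
    fix f
    have "norm (Z f) = sqrt ((norm (Z f))\<^sup>2)" by simp
    also have "\<dots> \<le> sqrt ((1 - 1 / m) * (norm f)\<^sup>2)" by (rule real_sqrt_le_mono[OF nZ])
    finally show "norm (Z f) \<le> sqrt (1 - 1 / m) * norm f" by (simp add: real_sqrt_mult)
  qed (use m in simp)
  also have "\<dots> < 1" using m by (simp add: real_sqrt_lt_1_iff)
  finally have Z1: "norm Z < 1" .
  have HSZ: "HS Z"
    unfolding Z_def using Vb HS_od_iff[OF aV]
    by (intro HS_compose_right(1)) (auto intro!: clin_blinfun adm_clin[OF aG] adm_clin[OF ah])
  have pa: "\<exists>h. p f = ev V h" for f using p by blast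
  show thesis
    by (rule that[OF adm(2) HSZ Z1 _ _ _ _ pa psym adm(1)]) (simp_all add: Z p G hC GC od_C ev_C)
qed

lemma even_S_diag: assumes "V \<in> S" "\<And>f. od V f = 0" shows "V \<in> S_diag"
proof -
  have "V (C f) = C (V f)" for f using ev_C[of V f] by (simp add: ev_od_add[of V] assms(2))
  moreover have "P1 h = (1/2) *\<^sub>R (C h + h)" for h by (simp add: C_alt)
  ultimately have "P1 (V f) = V (P1 f)" for f by (simp add: blinfun.bilinear_simps)
  then show ?thesis using assms(1) by (auto simp: S_diag_def fun_eq_iff)
qed

text \<open>The parts of \<open>U\<^sup>-\<^sup>1 V = N (1 - z) (a + b)\<close> are read off from the parity of the factors: \<open>N\<close> is even and
  \<open>z\<close> is odd.\<close>

lemma reduction_step: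
  assumes V: "V \<in> S_P1"
    and z: "adm z" "\<And>f g. z f \<bullet> g = f \<bullet> z g" "\<And>f. z (C f) = - C (z f)" "HS z" "norm z < 1"
  obtains U W N :: "'k endo" where "U \<in> cayley" "U \<in> S_HS" "W \<in> S_P1" "V = U o\<^sub>L W"
    "\<And>f. od W f = N (od V f - z (ev V f))" "\<And>f. ev W f = N (ev V f - z (od V f))"
    "\<And>f. z f = 0 \<Longrightarrow> N f = f"
    "\<forall>B. (\<forall>f. blinfun_apply B (z f) = z (blinfun_apply B f)) \<longrightarrow>
      (\<forall>f. blinfun_apply B (N f) = N (blinfun_apply B f))"
proof -
  obtain U U' N where U: "U \<in> cayley" "U \<in> S_HS" "U' \<in> cayley" "U o\<^sub>L U' = id_blinfun"
    and N: "\<And>f. blinfun_apply U' f = blinfun_apply N (f - z f)" "\<And>f. blinfun_apply N (C f) = C (blinfun_apply N f)"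
      "\<And>f. z f = 0 \<Longrightarrow> blinfun_apply N f = f"
      "\<forall>B. (\<forall>f. blinfun_apply B (z f) = z (blinfun_apply B f)) \<longrightarrow>
      (\<forall>f. blinfun_apply B (blinfun_apply N f) = blinfun_apply N (blinfun_apply B f))"
    by (rule reducing_cayley[OF z]) (rule that; blast)
  let ?W = "U' o\<^sub>L V"
  have W: "?W \<in> S_P1" by (rule S_P1_compose[OF S_P1_ind_S(2)[OF cayley_ind_zero[OF U(3)]] V])
  have VUW: "V = U o\<^sub>L ?W"
    by (rule blinfun_eqI)
       (use arg_cong[OF U(4), of "\<lambda>A. blinfun_apply A (V _)"] in simp)
  have eq: "?W f = N (ev V f - z (od V f)) + N (od V f - z (ev V f))" for f
    by (simp add: N(1) ev_od_add[of V f] blinfun.bilinear_simps)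
  have c: "N (ev V (C f) - z (od V (C f))) = C (N (ev V f - z (od V f)))"
    "N (od V (C f) - z (ev V (C f))) = - C (N (od V f - z (ev V f)))" for f
  proof -
    have "ev V (C f) - z (od V (C f)) = C (ev V f - z (od V f))"
      "od V (C f) - z (ev V (C f)) = - C (od V f - z (ev V f))"
      by (simp_all add: ev_C od_C z(3) C_diff blinfun.minus_right)
    then show "N (ev V (C f) - z (od V (C f))) = C (N (ev V f - z (od V f)))"
      "N (od V (C f) - z (ev V (C f))) = - C (N (od V f - z (ev V f)))"
      by (simp_all only: N(2) blinfun.minus_right)
  qed
  note eo = ev_od_unique[OF eq c]
  show thesis by (rule that[OF U(1,2) W VUW eo(2,1) N(3,4)])
qed

text \<open>With \<open>z = p Z\<close> the new odd part is \<open>(1 - p) b\<close>, while the new even part still has its range in the range of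
  \<open>p\<close>. The operator \<open>p Z\<close> is selfadjoint because \<open>a\<^sup>* b = b\<^sup>* a\<close>.\<close>

lemma reduce_to_orthogonal:
  assumes V: "V \<in> S_P1"
  shows "\<exists>U W. U \<in> cayley \<and> U \<in> S_HS \<and> W \<in> S_P1 \<and> V = U o\<^sub>L W \<and> (\<forall>f g. ev W f \<bullet> od W g = 0)"
proof -
  have VS: "V \<in> S" using V by (simp add: S_P1_iff)
  obtain p Z where Z: "adm Z" "HS Z" "norm Z < 1" "\<And>f. blinfun_apply Z (C f) = - C (blinfun_apply Z f)"
      "\<And>f. blinfun_apply Z (ev V f) = od V f" "\<And>f. blinfun_apply Z (blinfun_apply p f) = blinfun_apply Z f"
    and p: "\<And>f. blinfun_apply p (ev V f) = ev V f" "\<And>f. \<exists>h. blinfun_apply p f = ev V h"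
      "\<And>f g. blinfun_apply p f \<bullet> g = f \<bullet> blinfun_apply p g" "adm p" "\<And>f. blinfun_apply p (C f) = C (blinfun_apply p f)"
    by (rule graph_operator[OF V]) (rule that; blast)
  define z where "z = p o\<^sub>L Z"
  have z_apply: "z f = p (Z f)" for f by (simp add: z_def)
  have zsym: "z f \<bullet> g = f \<bullet> z g" for f g
  proof -
    obtain h where h: "p f = ev V h" using p(2) by blast
    obtain k where k: "p g = ev V k" using p(2) by blast
    have "z f \<bullet> g = Z (p f) \<bullet> p g" by (simp add: z_apply p(3) Z(6))
    also have "\<dots> = od V h \<bullet> ev V k" by (simp add: h k Z(5))
    also have "\<dots> = ev V h \<bullet> od V k" by (rule ev_od_relations(2)[OF VS])
    also have "\<dots> = p f \<bullet> Z (p g)" by (simp add: h k Z(5))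
    finally show ?thesis by (simp add: z_apply p(3) Z(6))
  qed
  have pp: "p (p f) = p f" for f using p(1) p(2)[of f] by auto
  have np: "norm (p f) \<le> norm f" for f
  proof -
    have "(norm (p f))\<^sup>2 = p f \<bullet> f" by (simp add: power2_norm_eq_inner p(3)[of f "p f"] pp inner_commute[of f])
    also have "\<dots> \<le> norm (p f) * norm f" by (rule norm_cauchy_schwarz)
    finally show ?thesis by (cases "norm (p f) = 0") (auto simp: power2_eq_square)
  qed
  have "norm z \<le> norm Z"
    by (rule norm_blinfun_bound) (auto simp: z_apply intro: order_trans[OF np norm_blinfun])
  then have zn: "norm z < 1" using Z(3) by simp
  have zH: "HS z" unfolding z_def by (rule HS_compose_left(1)[OF Z(2) adm_clin[OF p(4)]])
  have za: "adm z" unfolding z_def by (intro adm_blinfun p(4) Z(1))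
  have zo: "z (C f) = - C (z f)" for f by (simp add: z_apply Z(4) p(5) blinfun.minus_right)
  obtain U W N where U: "U \<in> cayley" "U \<in> S_HS" "W \<in> S_P1" "V = U o\<^sub>L W"
    and W: "\<And>f. od W f = blinfun_apply N (od V f - z (ev V f))" "\<And>f. ev W f = blinfun_apply N (ev V f - z (od V f))"
    and N: "\<And>f. z f = 0 \<Longrightarrow> blinfun_apply N f = f"
      "\<forall>B. (\<forall>f. blinfun_apply B (z f) = z (blinfun_apply B f)) \<longrightarrow>
      (\<forall>f. blinfun_apply B (blinfun_apply N f) = blinfun_apply N (blinfun_apply B f))"
    by (rule reduction_step[OF V za zsym zo zH zn]) (rule that; blast)
  have odW: "od W f = od V f - p (od V f)" for f
  proof -
    have "z (od V f - p (od V f)) = 0" by (simp add: z_apply blinfun.diff_right Z(6))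
    then show ?thesis unfolding W(1) using N(1) by (simp add: z_apply Z(5))
  qed
  have pN: "p (N f) = N (p f)" for f using N(2) by (simp add: z_apply pp Z(6))
  have evW: "p (ev W f) = ev W f" for f
    unfolding W(2) pN by (simp add: blinfun.diff_right p(1) z_apply pp)
  have "ev W f \<bullet> od W g = 0" for f g
  proof -
    have "ev W f \<bullet> od W g = p (ev W f) \<bullet> od W g" by (simp only: evW)
    also have "\<dots> = ev W f \<bullet> p (od W g)" by (rule p(3))
    finally show ?thesis by (simp add: odW blinfun.diff_right pp)
  qed
  then show ?thesis using U by blast
qed

text \<open>If the ranges of \<open>a\<close> and \<open>b\<close> are orthogonal, then \<open>p Z = 0\<close>. The selfadjoint operator \<open>z = Z + Z\<^sup>*\<close>
  interchanges the range of \<open>p\<close> and its orthogonal complement, so that its norm is that of \<open>Z\<close>, and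
  it still satisfies \<open>z a = b\<close>. The odd part of the reduced operator is a multiple of \<open>b - z a = 0\<close>.\<close>

lemma reduce_orthogonal_to_diagonal:
  assumes V: "V \<in> S_P1" and orth: "\<And>f g. ev V f \<bullet> od V g = 0"
  shows "\<exists>U W. U \<in> cayley \<and> U \<in> S_HS \<and> W \<in> S_diag \<and> V = U o\<^sub>L W"
proof -
  obtain p Z where Z: "adm Z" "HS Z" "norm Z < 1" "\<And>f. blinfun_apply Z (C f) = - C (blinfun_apply Z f)"
      "\<And>f. blinfun_apply Z (ev V f) = od V f" "\<And>f. blinfun_apply Z (blinfun_apply p f) = blinfun_apply Z f"
    and p: "\<And>f. blinfun_apply p (ev V f) = ev V f" "\<And>f. \<exists>h. blinfun_apply p f = ev V h"
      "\<And>f g. blinfun_apply p f \<bullet> g = f \<bullet> blinfun_apply p g" "adm p" "\<And>f. blinfun_apply p (C f) = C (blinfun_apply p f)"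
    by (rule graph_operator[OF V]) (rule that; blast)
  have pp: "p (p f) = p f" for f using p(1) p(2)[of f] by auto
  have pZ0: "p f \<bullet> Z g = 0" for f g
  proof -
    obtain h where h: "p f = ev V h" using p(2) by blast
    obtain k where k: "p g = ev V k" using p(2) by blast
    have "Z g = od V k" using Z(5)[of k] Z(6)[of g] k by simp
    then show ?thesis by (simp add: h orth)
  qed
  have pZ: "p (Z g) = 0" for g using pZ0[of "Z g" g] p(3)[of "Z g" "p (Z g)"] p(3)[of "p (Z g)" "Z g"] pp by simp
  have ZZ: "Z (Z f) = 0" for f using Z(6)[of "Z f"] pZ by simp
  have hp: "hadj Z (p f) = 0" for f
    by (rule vector_eq_rdot[THEN iffD1]) (simp add: inner_hadj_left pZ0)
  define z where "z = Z + hadj Z"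
  have z_apply: "z f = Z f + hadj Z f" for f by (simp add: z_def blinfun.add_left)
  have zsym: "z f \<bullet> g = f \<bullet> z g" for f g
    by (simp add: z_apply inner_add_left inner_add_right inner_hadj_left inner_hadj_right)
  have "norm z \<le> norm Z"
  proof (rule norm_blinfun_bound)
    fix f
    have a: "(norm f)\<^sup>2 = (norm (p f))\<^sup>2 + (norm (f - p f))\<^sup>2"
      unfolding power2_norm_eq_inner using p(3)[of f "p f"] pp
      by (simp add: inner_diff_left inner_diff_right inner_commute)
    have "Z f \<bullet> hadj Z f = 0" by (simp add: inner_hadj_right ZZ)
    then have "(norm (z f))\<^sup>2 = (norm (Z f))\<^sup>2 + (norm (hadj Z f))\<^sup>2"
      unfolding power2_norm_eq_inner z_apply by (simp add: inner_add_left inner_add_right inner_commute)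
    also have "Z f = Z (p f)" by (simp add: Z(6))
    also have "hadj Z f = hadj Z (f - p f)" by (simp add: blinfun.diff_right hp)
    also have "(norm (Z (p f)))\<^sup>2 + (norm (hadj Z (f - p f)))\<^sup>2
        \<le> (norm Z * norm (p f))\<^sup>2 + (norm Z * norm (f - p f))\<^sup>2"
      using norm_hadj_le[of Z]
      by (intro add_mono power_mono norm_blinfun order_trans[OF norm_blinfun[of "hadj Z"]] mult_right_mono) auto
    also have "\<dots> = (norm Z * norm f)\<^sup>2" by (simp add: power_mult_distrib a distrib_left)
    finally show "norm (z f) \<le> norm Z * norm f" by (rule power2_le_imp_le) simp
  qed simp
  then have zn: "norm z < 1" using Z(3) by simp
  have zH: "HS z" unfolding z_def by (intro HS_add(1) Z(2) HS_hadj(1))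
  have za: "adm z" unfolding z_def by (intro adm_blinfun Z(1) adm_hadj)
  have zo: "z (C f) = - C (z f)" for f
  proof -
    have "hadj Z (C f) = - C (hadj Z f)"
      by (rule vector_eq_rdot[THEN iffD1]) (simp add: inner_hadj_left inner_C Z(4))
    then show ?thesis by (simp add: z_apply Z(4) C_add)
  qed
  obtain U W N where U: "U \<in> cayley" "U \<in> S_HS" "W \<in> S_P1" "V = U o\<^sub>L W"
    and W: "\<And>f. od W f = blinfun_apply N (od V f - z (ev V f))"
    by (rule reduction_step[OF V za zsym zo zH zn]) (rule that; blast)
  have "hadj Z (ev V f) = 0" for f using hp[of "ev V f"] p(1) by simp
  then have "od W f = 0" for f by (simp add: W z_apply Z(5))
  then have "W \<in> S_diag" using U(3) by (intro even_S_diag) (auto simp: S_P1_iff)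
  then show ?thesis using U by blast
qed

lemma factorization:
  assumes "V \<in> S_P1"
  shows "\<exists>U1 U2 W. U1 \<in> cayley \<and> U1 \<in> S_HS \<and> U2 \<in> cayley \<and> U2 \<in> S_HS \<and> W \<in> S_diag \<and> V = U1 o\<^sub>L (U2 o\<^sub>L W)"
proof -
  obtain U1 V' where 1: "U1 \<in> cayley \<and> U1 \<in> S_HS \<and> V' \<in> S_P1 \<and> V = U1 o\<^sub>L V' \<and> (\<forall>f g. ev V' f \<bullet> od V' g = 0)"
    using reduce_to_orthogonal[OF assms] by blast
  then obtain U2 W where "U2 \<in> cayley \<and> U2 \<in> S_HS \<and> W \<in> S_diag \<and> V' = U2 o\<^sub>L W"
    using reduce_orthogonal_to_diagonal[of V'] by blast
  then show ?thesis using 1 by blast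
qed

section \<open>Diagonal operators\<close>

lemma
  assumes "W \<in> S_diag"
  shows S_diag_S: "W \<in> S" and S_diag_C: "W (C f) = C (W f)" and S_diag_inner: "W f \<bullet> W g = f \<bullet> g"
    and S_diag_P1: "W (P1 f) = P1 (W f)" and S_diag_S_P1: "W \<in> S_P1"
proof -
  have P: "W (P1 f) = P1 (W f)" for f using assms by (auto simp: S_diag_def fun_eq_iff)
  show S: "W \<in> S" using assms by (simp add: S_diag_def)
  have WC: "W (C f) = C (W f)" for f by (simp add: C_alt blinfun.bilinear_simps P)
  show "W (C f) = C (W f)" "W (P1 f) = P1 (W f)" by (rule WC, rule P)
  show "W f \<bullet> W g = f \<bullet> g" using S_form[OF S, of f "C g"] by (simp add: WC)
  have "W (P2 f) = P2 (W f)" for f by (simp add: P2_def blinfun.diff_right P)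
  then have "blk W f = blinfun_apply 0 f" for f by (simp add: blk_def)
  then have "HS (blk W)" by (rule HS_of_eq[OF HS_zero])
  then show "W \<in> S_P1" using S by (simp add: S_P1_iff)
qed

lemma S_diagI:
  assumes "adm W" "\<And>f. W (C f) = C (W f)" "\<And>f g. W f \<bullet> W g = f \<bullet> g"
  shows "W \<in> S_diag"
proof -
  have "W \<in> S" using assms by (simp add: S_iff flip: assms(2))
  moreover have "P1 h = (1/2) *\<^sub>R (C h + h)" for h by (simp add: C_alt)
  then have "P1 (W f) = W (P1 f)" for f by (simp add: blinfun.bilinear_simps assms(2))
  ultimately show ?thesis by (auto simp: S_diag_def fun_eq_iff)
qed

lemma dg_diag_inner: assumes "W \<in> S_diag" shows "dg W f \<bullet> g = f \<bullet> W g"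
  using dg_inner[of W f "C g"] by (simp add: S_diag_C[OF assms])

lemma dg_diag_C: assumes "W \<in> S_diag" shows "dg W (C f) = C (dg W f)"
  by (rule vector_eq_rdot[THEN iffD1]) (simp add: dg_diag_inner[OF assms] inner_C S_diag_C[OF assms])

text \<open>A unitary that is diagonal has a real and an imaginary part with respect to the complex
  structure \<open>j = \<i> C\<close>, which commutes with the involution. The reflection \<open>s\<close> below is the sign of
  the imaginary part \<open>b\<close>. The product \<open>- j U s\<close> then has nonnegative real part \<open>\<bar>b\<bar>\<close>, so that it is
  a Cayley transform, and so is \<open>j s\<close>, a square root of \<open>- 1\<close>.\<close>

lemma diagonal_unitary_cayley:
  assumes U: "U \<in> S_diag" and ind: "neg_ind U = 0"
  shows "\<exists>V1 V2. V1 \<in> cayley \<and> V2 \<in> cayley \<and> U = V1 o\<^sub>L V2"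
proof -
  have US: "U \<in> S" by (rule S_diag_S[OF U])
  define u' where "u' = dg U"
  have uu: "U (u' f) = f" "u' (U f) = f" for f
    using ind neg_ind_zero_iff[OF US] dg_left_inverse[OF US] by (auto simp: u'_def)
  have ua: "u' f \<bullet> g = f \<bullet> U g" for f g unfolding u'_def by (rule dg_diag_inner[OF U])
  have ua2: "U f \<bullet> g = f \<bullet> u' g" for f g using ua[of g f] by (simp add: inner_commute)
  have aU: "adm U" and au': "adm u'" using S_adm[OF US] adm_dg by (auto simp: u'_def)
  note admD = aU[unfolded adm_def] au'[unfolded adm_def]
  have UC: "U (C f) = C (U f)" "u' (C f) = C (u' f)" for f
    using S_diag_C[OF U] dg_diag_C[OF U] by (auto simp: u'_def)
  define j where "j f = J (C f)" for f
  have jj: "j (j f) = - f" for f by (simp add: j_def C_J)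
  have j_inner: "j f \<bullet> g = - (f \<bullet> j g)" for f g by (simp add: j_def inner_J inner_C C_J)
  have j_comm: "j (C f) = C (j f)" "j (star f) = star (j f)" "j (J f) = J (j f)"
    "U (j f) = j (U f)" "u' (j f) = j (u' f)" for f
    using admD by (simp_all add: j_def C_J C_star J_star UC lin_simps)
  have j_lin: "j (f + g) = j f + j g" "j (f - g) = j f - j g" "j (- f) = - j f" "j (r *\<^sub>R f) = r *\<^sub>R j f" for f g r
    by (simp_all add: j_def lin_simps)
  define bj where "bj = bJ o\<^sub>L bC"
  have bj: "bj f = j f" for f by (simp add: bj_def j_def)
  define b where "b = (-1/2) *\<^sub>R (bj o\<^sub>L (U - u'))"
  have b: "b f = (-1/2) *\<^sub>R j (U f - u' f)" for f by (simp add: b_def bj j_lin blinfun.bilinear_simps)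
  have bsym: "b f \<bullet> g = f \<bullet> b g" for f g
    by (simp add: b j_inner j_lin inner_diff_left inner_diff_right ua ua2 j_comm)
  have nU: "norm (U f) = norm f" "norm (u' f) = norm f" for f
    by (simp_all add: norm_eq_sqrt_inner ua ua2 uu)
  have nj: "norm (j f) = norm f" for f by (simp add: j_def)
  have nb: "norm (b f) \<le> norm f" for f
    using norm_triangle_ineq4[of "U f" "u' f"] by (simp add: b nj nU)
  let ?x = "id_blinfun - (b o\<^sub>L b)"
  have x: "?x f = f - b (b f)" for f by (simp add: blinfun.diff_left)
  have "norm ?x \<le> 1"
  proof (rule norm_blinfun_bound)
    fix f
    have "(norm (?x f))\<^sup>2 = (norm f)\<^sup>2 - 2 * (norm (b f))\<^sup>2 + (norm (b (b f)))\<^sup>2"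
      unfolding power2_norm_eq_inner x
      by (simp add: inner_diff_left inner_diff_right bsym[of "b f" f] bsym[of f "b f", symmetric])
    also have "\<dots> \<le> (norm f)\<^sup>2"
      using power_mono[OF nb[of "b f"] norm_ge_zero, of 2] zero_le_power2[of "norm (b f)"] by linarith
    finally show "norm (?x f) \<le> 1 * norm f" using power2_le_imp_le[OF _ norm_ge_zero] by simp
  qed simp
  then obtain y where lim: "\<And>f. (\<lambda>n. quad_iter ?x id_blinfun n f) \<longlonglongrightarrow> blinfun_apply y f"
    and ny: "norm y \<le> 1" and fy: "\<And>f. blinfun_apply y f = (1/2) *\<^sub>R (?x f + id_blinfun (y (y f)))"
    using quad_iter_limit[of ?x id_blinfun] norm_blinfun_id_le by blast
  \<comment> \<open>The operator \<open>y\<close> is \<open>1 - sqrt (b\<^sup>2)\<close>, so that \<open>a\<close> below is the absolute value of \<open>b\<close>.\<close>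
  have y_comm: "T (y f) = y (T f)" if "\<And>f. blinfun_apply T (b f) = b (T f)" for T f
    by (rule quad_iter_limit_commute[OF lim]) (simp_all add: x blinfun.diff_right that)
  have y_sym: "y f \<bullet> g = f \<bullet> y g" for f g
    by (rule quad_iter_limit_symmetric[OF lim]) (simp_all add: x inner_diff_left inner_diff_right bsym)
  define a where "a = id_blinfun - y"
  have a: "a f = f - y f" for f by (simp add: a_def blinfun.diff_left)
  have a_comm: "T (a f) = a (T f)" if "\<And>f. blinfun_apply T (b f) = b (T f)" for T f
    by (simp add: a blinfun.diff_right y_comm[OF that])
  have a_sym: "a f \<bullet> g = f \<bullet> a g" for f g by (simp add: a inner_diff_left inner_diff_right y_sym)
  have ab: "b (a f) = a (b f)" for f by (rule a_comm) simp
  have aa: "a (a f) = b (b f)" for f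
  proof -
    have "2 *\<^sub>R y f = (f - b (b f)) + y (y f)"
      using arg_cong[OF fy[of f], of "\<lambda>h. 2 *\<^sub>R h"] by (simp add: x)
    then show ?thesis by (simp add: a blinfun.diff_right scaleR_2 algebra_simps)
  qed
  have a_pos: "0 \<le> f \<bullet> a f" for f
  proof -
    have "f \<bullet> y f \<le> norm f * (norm y * norm f)"
      by (intro order_trans[OF norm_cauchy_schwarz] mult_left_mono norm_blinfun) simp
    also have "\<dots> \<le> norm f * (1 * norm f)" by (intro mult_left_mono mult_right_mono ny) auto
    finally show ?thesis by (simp add: a inner_diff_right power2_norm_eq_inner[symmetric] power2_eq_square)
  qed
  \<comment> \<open>The vectors on which \<open>b\<close> is nonnegative. On the orthogonal complement \<open>b = - a\<close>, since
    \<open>a + b\<close> maps into \<open>M\<close> and is selfadjoint.\<close>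
  define M where "M = {f. a f = b f}"
  have M: "Real_Vector_Spaces.subspace M"
    unfolding M_def real_vector.subspace_def by (simp add: blinfun.bilinear_simps)
  have "closed M" unfolding M_def by (intro closed_Collect_eq continuous_intros)
  from orthogonal_projection[OF M this]
  obtain p where p0: "(\<forall>f. blinfun_apply p f \<in> M) \<and> (\<forall>f. \<forall>k\<in>M. (f - blinfun_apply p f) \<bullet> k = 0)" ..
  interpret p: closed_projection M p by unfold_locales (use M p0 in auto)
  have ab_M: "a f + b f \<in> M" for f by (simp add: M_def blinfun.add_right aa ab)
  have neg: "a (f - p f) = - b (f - p f)" for f
  proof -
    let ?h = "f - p f"
    have "(a ?h + b ?h) \<bullet> (a ?h + b ?h) = ?h \<bullet> (a (a ?h + b ?h) + b (a ?h + b ?h))"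
      by (simp add: inner_add_left inner_add_right a_sym bsym blinfun.add_right)
    also have "\<dots> = 0" by (rule p.orth[OF ab_M])
    finally show ?thesis by (simp add: eq_neg_iff_add_eq_0)
  qed
  define s where "s = 2 *\<^sub>R p - id_blinfun"
  have s: "s f = 2 *\<^sub>R p f - f" for f by (simp add: s_def blinfun.bilinear_simps)
  have ss: "s (s f) = f" for f by (simp add: s blinfun.bilinear_simps p.idem scaleR_2)
  have s_sym: "s f \<bullet> g = f \<bullet> s g" for f g by (simp add: s inner_diff_left inner_diff_right p.symmetric)
  have bs: "b (s f) = a f" for f
  proof -
    have "a f = a (p f) + a (f - p f)" by (simp flip: blinfun.add_right)
    also have "a (p f) = b (p f)" using p.range[of f] by (simp add: M_def)
    finally have "a f = b (p f) + - b (f - p f)" by (simp only: neg)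
    then show ?thesis by (simp add: s blinfun.bilinear_simps scaleR_2)
  qed
  have s_comm: "s (T f) = T (s f)"
    if "\<And>f. blinfun_apply T (b f) = b (T f)" "\<And>f. blinfun_apply T' (b f) = b (T' f)"
      "\<And>f g. blinfun_apply T f \<bullet> g = f \<bullet> T' g" for T T' f
  proof -
    have "p (T f) = T (p f)"
      by (rule p.commute[OF that(3)]) (simp_all add: M_def that(1,2) flip: a_comm[OF that(1)] a_comm[OF that(2)])
    then show ?thesis by (simp add: s blinfun.bilinear_simps)
  qed
  have uJ: "U (J f) = J (U f)" "u' (J f) = J (u' f)" "U (star f) = star (U f)" "u' (star f) = star (u' f)" for f
    using admD by auto
  have bC: "bC (b f) = b (bC f)" for f
    by (simp add: b j_comm UC lin_simps j_lin)
  have bJ: "bJ (b f) = b (bJ f)" "(- bJ) (b f) = b ((- bJ) f)" for f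
    by (simp_all add: b j_comm uJ lin_simps j_lin scaleR_diff_right)
  have bS: "bstar (b f) = b (bstar f)" for f
    by (simp add: b j_comm uJ lin_simps j_lin)
  have bU: "U (b f) = b (U f)" "u' (b f) = b (u' f)" for f
    by (simp_all add: b j_comm uu lin_simps j_lin)
  have sC: "s (C f) = C (s f)" for f using s_comm[OF bC bC, of f] by (simp add: inner_C)
  have sJ: "s (J f) = J (s f)" for f using s_comm[OF bJ, of f] by (simp add: inner_J blinfun.minus_left)
  have sstar: "s (star f) = star (s f)" for f using s_comm[OF bS bS, of f] by (simp add: inner_star)
  have sU: "s (U f) = U (s f)" for f by (rule s_comm[OF bU ua2])
  have su': "s (u' f) = u' (s f)" for f by (rule s_comm[OF bU(2,1) ua])
  have sj: "s (j f) = j (s f)" for f by (simp add: j_def sJ sC)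
  \<comment> \<open>For skew-adjoint \<open>X\<close> the numerical bound holds with the constant zero.\<close>
  have diag_cayley: "T \<in> cayley" if T: "cay X T" "adm X" "\<And>f. X (C f) = C (X f)"
    "\<And>f g. X f \<bullet> g = - (f \<bullet> X g)" for X T
  proof -
    have "f \<bullet> X f = 0" for f using T(4)[of f f] by (simp add: inner_commute)
    then have "cay_gen X" using T by (auto simp: cay_gen_def intro!: exI[of _ 0])
    then show ?thesis using T(1) by (auto simp: cayley_def)
  qed
  define V2 where "V2 = bj o\<^sub>L s"
  have V2: "V2 f = j (s f)" for f by (simp add: V2_def bj)
  have V2c: "V2 \<in> cayley"
  proof (rule diag_cayley[of V2 V2])
    show "cay V2 V2" by (simp add: cay_def V2 j_lin blinfun.diff_right sj jj ss)
    show "adm V2" by (simp add: adm_def V2 sJ sstar j_comm)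
    show "V2 (C f) = C (V2 f)" for f by (simp add: V2 sC j_comm)
    show "V2 f \<bullet> g = - (f \<bullet> V2 g)" for f g by (simp add: V2 j_inner s_sym sj)
  qed
  define V1 where "V1 = (-1) *\<^sub>R (bj o\<^sub>L (U o\<^sub>L s))"
  have V1: "V1 f = - j (U (s f))" for f by (simp add: V1_def bj blinfun.scaleR_left blinfun.minus_left)
  have UV: "U = V1 o\<^sub>L V2"
    by (rule blinfun_eqI) (simp add: V1 V2 sj j_comm jj ss j_lin)
  have V1_adm: "adm V1" using admD by (simp add: adm_def V1 sJ sstar j_comm lin_simps)
  have V1C: "V1 (C f) = C (V1 f)" for f by (simp add: V1 sC UC j_comm C_minus)
  have V1_iso: "V1 f \<bullet> V1 g = f \<bullet> g" for f g
    by (simp add: V1 j_inner jj s_sym ss ua2 uu)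
  \<comment> \<open>Since \<open>- j U s\<close> is the sum of \<open>a\<close> and a skew-adjoint operator.\<close>
  have V1_pos: "0 \<le> f \<bullet> V1 f" for f
  proof -
    let ?r = "\<lambda>h. U (s h) + u' (s h)"
    have r: "f \<bullet> j (?r f) = 0"
    proof -
      have "f \<bullet> j (?r f) = - (j f \<bullet> ?r f)" by (simp add: j_inner)
      also have "\<dots> = - (?r (j f) \<bullet> f)"
        by (simp add: inner_add_left inner_add_right ua ua2 s_sym flip: sU su')
      also have "?r (j f) = j (?r f)" by (simp add: sj j_comm j_lin)
      finally show ?thesis by (simp add: inner_commute)
    qed
    have "V1 f = a f - (1/2) *\<^sub>R j (?r f)"
    proof -
      have "a f = (-1/2) *\<^sub>R j (U (s f) - u' (s f))" by (simp add: b flip: bs)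
      moreover have "- x = (-1/2) *\<^sub>R (x - y) - (1/2) *\<^sub>R (x + y)" for x y :: 'k
      proof -
        have "(-1/2) *\<^sub>R (x - y) - (1/2) *\<^sub>R (x + y) = - ((1/2) *\<^sub>R (x + x))"
          by (simp add: scaleR_diff_right scaleR_add_right del: scaleR_half_double)
        then show ?thesis by simp
      qed
      ultimately show ?thesis by (simp only: V1 j_lin)
    qed
    then show ?thesis using r a_pos[of f] by (simp add: inner_diff_right)
  qed
  let ?T = "id_blinfun + V1"
  have T: "?T f = f + V1 f" for f by (simp add: blinfun.add_left)
  have "1 * (f \<bullet> f) \<le> f \<bullet> ?T f" for f using V1_pos[of f] by (simp add: T inner_add_right)
  from coercive_inverse[OF zero_less_one this]
  obtain G where "(\<forall>f. ?T (blinfun_apply G f) = f) \<and> (\<forall>f. blinfun_apply G (?T f) = f) \<and> norm G \<le> 1 / 1" ..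
  then have G: "G f + V1 (G f) = f" "G (f + V1 f) = f" for f by (simp_all add: T[symmetric])
  have G_comm: "G (h f) = h (G f)" if "\<And>f g. h (f + g) = h f + h g" "\<And>f. V1 (h f) = h (V1 f)" for h f
    using G(2)[of "h (G f)"] G(1)[of f] by (simp add: that flip: that(1))
  \<comment> \<open>The inverse Cayley transform \<open>(V1 - 1) (V1 + 1)\<^sup>-\<^sup>1\<close>.\<close>
  define k where "k = (V1 - id_blinfun) o\<^sub>L G"
  have k: "k f = V1 (G f) - G f" for f by (simp add: k_def blinfun.diff_left)
  have "V1 \<in> cayley"
  proof (rule diag_cayley[of k V1])
    show "cay k V1"
      unfolding cay_def
    proof
      fix f
      let ?g = "G f"
      have "f - k f = 2 *\<^sub>R ?g" "f + k f = 2 *\<^sub>R V1 ?g"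
        using G(1)[of f] by (simp_all add: k scaleR_2 algebra_simps)
      then show "V1 (f - k f) = f + k f" by (simp add: blinfun.scaleR_right)
    qed
    have GJ: "G (J f) = J (G f)" "G (star f) = star (G f)" "G (C f) = C (G f)" for f
      using V1_adm V1C by (intro G_comm; simp add: lin_simps adm_def)+
    then show "adm k" using V1_adm by (simp add: adm_def k lin_simps)
    show "k (C f) = C (k f)" for f by (simp add: k GJ V1C C_diff)
    show "k f \<bullet> g = - (f \<bullet> k g)" for f g
    proof -
      have "k f \<bullet> (G g + V1 (G g)) = - ((G f + V1 (G f)) \<bullet> k g)"
        by (simp add: k inner_add_left inner_add_right inner_diff_left inner_diff_right V1_iso)
      then show ?thesis by (simp only: G(1))
    qed
  qed
  then show ?thesis using V2c UV by blast
qed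

section \<open>The index of diagonal operators\<close>

definition H1 :: "'k set" where "H1 = {f. P1 f = f}"

definition defect :: "'k endo \<Rightarrow> 'k set" where "defect W = kd W \<inter> H1"

lemma csub_H1: "csub H1"
  unfolding csub_def H1_def
  by (auto simp: real_vector.subspace_def lin_simps P1_J
      intro!: closed_Collect_eq linear_continuous_on bounded_linear_P1 continuous_on_id)

lemma csub_Int: "csub M \<Longrightarrow> csub N \<Longrightarrow> csub (M \<inter> N)"
  by (auto simp: csub_def intro: real_vector.subspace_inter)

lemma csub_defect: "W \<in> S \<Longrightarrow> csub (defect W)"
  unfolding defect_def by (intro csub_Int csub_H1 kd_csub S_clin)

lemma H1_star_orthogonal: assumes "e \<in> H1" "e' \<in> H1" shows "ip e (star e') = 0" "e \<bullet> star e' = 0"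
proof -
  have "P1 (star e') = 0" using assms by (simp add: P1_star H1_def P2_def)
  moreover have "f \<bullet> star e' = P1 f \<bullet> star e'" if "f \<in> H1" for f using that by (simp add: H1_def)
  ultimately have "f \<bullet> star e' = 0" if "f \<in> H1" for f using that by (simp add: inner_P1)
  then show "ip e (star e') = 0" "e \<bullet> star e' = 0"
    using assms csub_J[OF csub_H1] by (simp_all add: ip_eq zero_complex.code)
qed

lemma ip_P1: "ip (P1 f) g = ip f (P1 g)"
  by (simp add: ip_eq inner_P1 flip: P1_J)

text \<open>The involution maps \<open>H1\<close> onto its orthogonal complement.\<close>

lemma onb_star_union:
  assumes M: "\<And>f. f \<in> M \<Longrightarrow> star f \<in> M" "\<And>f. f \<in> M \<Longrightarrow> P1 f \<in> M" and E: "onb (M \<inter> H1) E"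
  shows "onb M (E \<union> star ` E)" "ecard (E \<union> star ` E) = 2 * ecard E"
proof -
  have EH: "e \<in> H1" "e \<in> M" if "e \<in> E" for e using E that by (auto simp: onb_def)
  have oE: "orthonormal E" using E by (simp add: onb_def)
  have z: "ip e (star e') = 0" "ip (star e') e = 0" if "e \<in> E" "e' \<in> E" for e e'
    using H1_star_orthogonal(1)[OF EH(1) EH(1), OF that] ip_commute[of "star e'" e] by auto
  have disj: "E \<inter> star ` E = {}"
    using z(1) orthonormalD[OF oE] by force
  show "onb M (E \<union> star ` E)"
    unfolding onb_def
  proof (intro conjI ballI impI)
    show "orthonormal (E \<union> star ` E)"
      unfolding orthonormal_def using orthonormalD[OF oE] z disj
      by (auto simp: ip_star star_inj)
    show "E \<union> star ` E \<subseteq> M" using EH M by auto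
    fix f assume f: "f \<in> M" "\<forall>e\<in>E \<union> star ` E. ip e f = 0"
    have total: "P1 g = 0" if "g \<in> M" "\<And>e. e \<in> E \<Longrightarrow> ip e g = 0" for g
    proof -
      have "P1 g \<in> M \<inter> H1" using M that by (simp add: H1_def)
      moreover have "ip e (P1 g) = 0" if "e \<in> E" for e
        using \<open>\<And>e. e \<in> E \<Longrightarrow> ip e g = 0\<close>[OF that] EH(1)[OF that] by (simp add: H1_def flip: ip_P1)
      ultimately show ?thesis using E unfolding onb_def by blast
    qed
    have "P1 f = 0" using f by (intro total) auto
    moreover have "P1 (star f) = 0"
    proof (rule total)
      fix e assume "e \<in> E"
      then have "ip (star e) f = 0" using f by auto
      then show "ip e (star f) = 0" using ip_star[of "star e" f] ip_commute[of f "star e"] by simp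
    qed (use f M in auto)
    then have "P2 f = 0" by (metis P1_star star_star star_zero)
    ultimately show "f = 0" using P1_P2_add[of f] by simp
  qed
  have inj: "inj_on star E" by (simp add: inj_on_def star_inj)
  show "ecard (E \<union> star ` E) = 2 * ecard E"
  proof (cases "finite E")
    case True
    then have "card (E \<union> star ` E) = 2 * card E"
      using disj by (simp add: card_Un_disjoint card_image[OF inj])
    then show ?thesis using True by (simp add: ecard_def numeral_eq_enat)
  qed (simp add: ecard_def numeral_eq_enat)
qed

lemma
  assumes W: "W \<in> S_diag" and f: "f \<in> kd W"
  shows kd_star: "star f \<in> kd W" and kd_P1: "P1 f \<in> kd W" and kd_inner: "f \<bullet> W g = 0"
proof -
  have WS: "W \<in> S" by (rule S_diag_S[OF W])
  have fg: "f \<bullet> W g = 0" for g using f S_diag_C[OF W, of "C g"] by (simp add: kd_iff)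
  show "f \<bullet> W g = 0" by (rule fg)
  show "star f \<in> kd W"
    using fg by (simp add: kd_iff inner_star flip: S_star[OF WS] S_diag_C[OF W])
  show "P1 f \<in> kd W"
    using fg by (simp add: kd_iff inner_P1 flip: S_diag_P1[OF W] S_diag_C[OF W])
qed

text \<open>The kernel of \<open>W\<^sup>\<dagger>\<close> is invariant under the involution and under \<open>P1\<close>, hence it is the sum of its part
  in \<open>H1\<close> and the conjugate of that part, of equal dimension.\<close>

lemma neg_ind_diag:
  assumes W: "W \<in> S_diag"
  shows "neg_ind W = 2 * edim (defect W)"
proof -
  have WS: "W \<in> S" by (rule S_diag_S[OF W])
  obtain E where E: "onb (defect W) E" using onb_exists[OF csub_defect[OF WS]] by blast
  note u = onb_star_union[OF kd_star[OF W] kd_P1[OF W] E[unfolded defect_def]]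
  show ?thesis
    using edim_onb[OF kd_csub[OF S_clin[OF WS]] u(1)] u(2) edim_onb[OF csub_defect[OF WS] E]
      neg_ind_eq[OF S_clin[OF WS]] by simp
qed

text \<open>Diagonal operators are assembled from an operator on \<open>H1\<close>, extended by zero, and its conjugate on the
  orthogonal complement of \<open>H1\<close>.\<close>

definition doubled :: "'k endo \<Rightarrow> 'k endo" where "doubled T = T + (bstar o\<^sub>L (T o\<^sub>L bstar))"

lemma doubled_apply: "doubled T f = T f + star (T (star f))"
  by (simp add: doubled_def blinfun.add_left)

lemma doubled:
  assumes T: "clin T" "\<And>f. T f \<in> H1" "\<And>f. T (P1 f) = T f"
  shows doubled_adm: "adm (doubled T)" and doubled_C: "doubled T (C f) = C (doubled T f)"
    and doubled_inner: "doubled T f \<bullet> doubled T g = T f \<bullet> T g + T (star f) \<bullet> T (star g)"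
    and doubled_H1: "h \<in> H1 \<Longrightarrow> h \<bullet> doubled T g = h \<bullet> T g"
proof -
  have CH: "C h = h" if "h \<in> H1" for h using that by (simp add: C_alt H1_def scaleR_2)
  have TC: "T (C f) = T f" for f
  proof -
    have "T (C f) = T (P1 (C f))" by (simp add: T(3))
    also have "P1 (C f) = P1 f" by (simp add: C_def P1_diff)
    finally show ?thesis by (simp add: T(3))
  qed
  show "adm (doubled T)"
    using T(1) by (simp add: adm_def clin_def doubled_apply star_J lin_simps add.commute)
  show "doubled T (C f) = C (doubled T f)"
  proof -
    have "star (C f) = - C (star f)" by (simp add: C_star)
    then have "star (T (star (C f))) = - star (T (star f))" by (simp add: TC lin_simps)
    moreover have "C (star (T (star f))) = - star (T (star f))"
      by (simp add: C_star CH[OF T(2)])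
    ultimately show ?thesis by (simp add: doubled_apply TC C_add CH[OF T(2)])
  qed
  have o: "T f \<bullet> star (T g) = 0" "star (T g) \<bullet> T f = 0" for f g
    using H1_star_orthogonal(2)[OF T(2) T(2)] by (auto simp: inner_commute)
  show "doubled T f \<bullet> doubled T g = T f \<bullet> T g + T (star f) \<bullet> T (star g)"
    by (simp add: doubled_apply inner_add_left inner_add_right o inner_star_star)
  show "h \<bullet> doubled T g = h \<bullet> T g" if "h \<in> H1"
    using H1_star_orthogonal(2)[OF that T(2)] by (simp add: doubled_apply inner_add_right)
qed

text \<open>For diagonal \<open>W\<close> the operator \<open>1 - W W\<^sup>\<dagger>\<close> is the orthogonal projection onto \<open>ker W\<^sup>\<dagger>\<close> and commutes with
  \<open>P1\<close>.\<close>

definition defect_proj :: "'k endo \<Rightarrow> 'k endo" where "defect_proj W = bP1 o\<^sub>L (id_blinfun - (W o\<^sub>L dg W))"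

lemma defect_proj_apply: "defect_proj W f = P1 (f - W (dg W f))"
  by (simp add: defect_proj_def blinfun.diff_left)

lemma defect_proj:
  assumes W: "W \<in> S_diag"
  shows "closed_projection (defect W) (defect_proj W)"
    and defect_proj_sum: "defect_proj W f + star (defect_proj W (star f)) = f - W (dg W f)"
proof -
  have WS: "W \<in> S" by (rule S_diag_S[OF W])
  have kd: "f - W (dg W f) \<in> kd W" for f
    by (simp add: kd_def blinfun.diff_right dg_left_inverse[OF WS])
  show "closed_projection (defect W) (defect_proj W)"
  proof
    show "Real_Vector_Spaces.subspace (defect W)" using csub_defect[OF WS] by (simp add: csub_def)
    show "defect_proj W f \<in> defect W" for f
      using kd_P1[OF W kd] by (simp add: defect_def defect_proj_apply H1_def)
    fix f k assume k: "k \<in> defect W"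
    then have "P1 k = k" "k \<in> kd W" by (auto simp: defect_def H1_def)
    moreover have "W (dg W f) \<bullet> k = 0" using kd_inner[OF W \<open>k \<in> kd W\<close>] by (simp add: inner_commute)
    ultimately show "(f - defect_proj W f) \<bullet> k = 0"
      by (simp add: defect_proj_apply inner_diff_left inner_P1)
  qed
  have d: "dg W (star f) = star (dg W f)" for f using adm_dg[OF S_adm[OF WS]] by (simp add: adm_def)
  have "star (defect_proj W (star f)) = P2 (f - W (dg W f))"
    by (simp add: defect_proj_apply d S_star[OF WS] P1_star flip: star_diff)
  then show "defect_proj W f + star (defect_proj W (star f)) = f - W (dg W f)"
    by (simp add: defect_proj_apply P1_P2_add)
qed

lemma partial_isometry_absorb:
  assumes "\<And>f. hadj T (T f) = blinfun_apply p f" "\<And>f. T (hadj T f) = blinfun_apply p' f"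
    and p: "closed_projection M p" and p': "closed_projection M' p'"
  shows "T (p f) = T f" "T f \<in> M'"
proof -
  interpret p: closed_projection M p by fact
  interpret p': closed_projection M' p' by fact
  have "T (f - p f) \<bullet> T (f - p f) = (f - p f) \<bullet> p (f - p f)"
    by (simp add: assms(1) flip: inner_hadj_right)
  also have "\<dots> = 0" by (simp add: blinfun.diff_right p.idem)
  finally show 1: "T (p f) = T f" by (simp add: blinfun.diff_right)
  have "p' (T f) = T (hadj T (T f))" by (rule assms(2)[symmetric])
  also have "\<dots> = T (p f)" by (simp only: assms(1))
  finally have "p' (T f) = T (p f)" .
  then show "T f \<in> M'" using 1 p'.range[of "T f"] by simp
qed

text \<open>Diagonal isometries of equal index differ by a diagonal unitary: it is prescribed on the
  range, and a partial isometry between the orthogonal complements extends it.\<close>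

lemma diagonal_transitive:
  assumes W: "W \<in> S_diag" and W': "W' \<in> S_diag" and eq: "edim (defect W) = edim (defect W')"
  shows "\<exists>D\<in>S_diag. neg_ind (blinfun_apply D) = 0 \<and> W' = D o\<^sub>L W"
proof -
  have WS: "W \<in> S" and WS': "W' \<in> S" using W W' by (auto simp: S_diag_S)
  have M: "csub (defect W)" "csub (defect W')" using csub_defect WS WS' by auto
  obtain E E' where E: "onb (defect W) E" "onb (defect W') E'" using onb_exists M by blast
  then have "ecard E = ecard E'" using eq edim_onb M by metis
  then obtain \<phi> where \<phi>: "bij_betw \<phi> E E'" using ecard_eq_bij E by (meson onb_def)
  let ?p = "defect_proj W" and ?p' = "defect_proj W'"
  note p = defect_proj(1)[OF W] and p' = defect_proj(1)[OF W']
  obtain T where T: "clin T" "\<And>f. hadj T (T f) = ?p f" "\<And>f. T (hadj T f) = ?p' f"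
    using partial_isometry_exists[OF E M \<phi> p p'] by blast
  have T': "clin (hadj T)" "\<And>f. hadj (hadj T) (hadj T f) = ?p' f" "\<And>f. hadj T (hadj (hadj T) f) = ?p f"
    using clin_hadj[OF T(1)] T by simp_all
  note Tp = partial_isometry_absorb[OF T(2,3) p p'] and Tp' = partial_isometry_absorb[OF T'(2,3) p' p]
  have TP: "T (P1 f) = T f" for f
  proof -
    have "?p (P1 f) = ?p f"
      using dg_diag_C[OF W]
      by (simp add: defect_proj_apply P1_diff C_alt blinfun.bilinear_simps flip: S_diag_P1[OF W])
    then show ?thesis using Tp(1)[of f] Tp(1)[of "P1 f"] by simp
  qed
  have TH: "T f \<in> H1" for f using Tp(2)[of f] by (simp add: defect_def)
  note dT = doubled[OF T(1) TH TP]
  define D where "D = (W' o\<^sub>L dg W) + doubled T"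
  have D: "D f = W' (dg W f) + doubled T f" for f by (simp add: D_def blinfun.add_left)
  have TW: "T (W f) = 0" for f
    using Tp(1)[of "W f"] by (simp add: defect_proj_apply dg_left_inverse[OF WS])
  have dTW: "doubled T (W f) = 0" for f
    by (simp add: doubled_apply TW flip: S_star[OF WS])
  have DW: "D (W f) = W' f" for f by (simp add: D dg_left_inverse[OF WS] dTW)
  have T_kd: "doubled T f \<in> kd W'" for f
    using Tp(2)[of f] kd_star[OF W', of "T (star f)"] Tp(2)[of "star f"] kd_csub[OF S_clin[OF WS']]
    by (simp add: doubled_apply defect_def csub_add)
  have DD: "D f \<bullet> D g = f \<bullet> g" for f g
  proof -
    have o: "doubled T h \<bullet> W' k = 0" "W' k \<bullet> doubled T h = 0" for h k
      using kd_inner[OF W' T_kd] by (auto simp: inner_commute)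
    have "D f \<bullet> D g = W' (dg W f) \<bullet> W' (dg W g) + doubled T f \<bullet> doubled T g"
      by (simp add: D inner_add_left inner_add_right o)
    also have "W' (dg W f) \<bullet> W' (dg W g) = f \<bullet> W (dg W g)"
      by (simp add: S_diag_inner[OF W'] dg_diag_inner[OF W])
    also have "doubled T f \<bullet> doubled T g = f \<bullet> ?p g + star f \<bullet> ?p (star g)"
      unfolding dT(3) T(2)[symmetric] inner_hadj_right ..
    also have "\<dots> = f \<bullet> (g - W (dg W g))"
      unfolding defect_proj_sum[OF W, symmetric] by (simp add: inner_add_right inner_star)
    finally show ?thesis by (simp add: inner_diff_right)
  qed
  have aD: "adm D" unfolding D_def by (intro adm_blinfun dT(1) S_adm adm_dg WS WS')
  have DC: "D (C f) = C (D f)" for f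
    by (simp add: D dT(2) dg_diag_C[OF W] S_diag_C[OF W'] C_add)
  have Dd: "D \<in> S_diag" by (rule S_diagI[OF aD DC DD])
  have "\<exists>g. D g = h" for h
  proof (intro exI)
    let ?m = "hadj T h" and ?n = "hadj T (star h)"
    have mn: "?m \<in> defect W" "?n \<in> defect W" by (rule Tp'(2))+
    have Tstar: "T (star m) = 0" if "m \<in> defect W" for m
    proof -
      have "P1 (star m) = 0" using that by (simp add: P1_star defect_def H1_def P2_def)
      then show ?thesis using TP[of "star m"] by simp
    qed
    have k: "dg W ?m = 0" "dg W (star ?n) = 0"
      using mn kd_star[OF W, of ?n] by (auto simp: defect_def kd_def)
    have "D (W (dg W' h) + ?m + star ?n) = W' (dg W' h) + (D ?m + D (star ?n))"
      by (simp add: blinfun.add_right DW)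
    also have "D ?m = ?p' h" by (simp add: D k doubled_apply Tstar[OF mn(1)] T(3))
    also have "D (star ?n) = star (?p' (star h))" by (simp add: D k doubled_apply Tstar[OF mn(2)] T(3))
    also have "W' (dg W' h) + (?p' h + star (?p' (star h))) = h"
      by (simp add: defect_proj_sum[OF W'])
    finally show "D (W (dg W' h) + ?m + star ?n) = h" .
  qed
  then have "neg_ind D = 0" by (rule neg_ind_zeroI[OF S_diag_S[OF Dd]])
  moreover have "W' = D o\<^sub>L W" by (rule blinfun_eqI) (simp add: DW)
  ultimately show ?thesis using Dd by blast
qed

lemma onb_H1_infinite: assumes E: "onb H1 E" shows "infinite E"
proof
  assume fin: "finite E"
  have "onb UNIV (E \<union> star ` E)" using onb_star_union(1)[of UNIV E] E by simp
  then have "edim UNIV = ecard (E \<union> star ` E)" by (rule edim_onb[OF csub_UNIV])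
  then have "edim UNIV \<noteq> \<infinity>" using fin by (simp add: ecard_def)
  then show False using infinite_dimensional by (auto simp: edim_def split: if_splits)
qed

lemma infinite_split:
  assumes E: "countable E" "infinite E"
  shows "\<exists>F\<subseteq>E. ecard F = n \<and> infinite (E - F)"
proof (cases n)
  case (enat k)
  obtain F where F: "F \<subseteq> E" "finite F" "card F = k"
    using infinite_arbitrarily_large[OF E(2)] by blast
  then show ?thesis using enat E(2) by (intro exI[of _ F]) (auto simp: ecard_def)
next
  case infinity
  have b: "bij_betw (from_nat_into E) UNIV E" using E by (rule bij_betw_from_nat_into)
  let ?F = "from_nat_into E ` {i. even i}"
  have inf: "infinite {i::nat. even i}" "infinite {i::nat. odd i}"
    using infinite_nat_iff_unbounded by (metis even_Suc lessI mem_Collect_eq less_SucI)+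
  have inj: "inj (from_nat_into E)" and E_eq: "E = from_nat_into E ` UNIV" using b by (auto simp: bij_betw_def)
  have "infinite ?F" using inf(1) inj by (simp add: finite_image_iff inj_on_subset)
  moreover have "from_nat_into E ` {i. odd i} \<subseteq> E - ?F"
    using E_eq inj by (auto simp: inj_on_def)
  then have "infinite (E - ?F)"
    using inf(2) inj by (meson finite_image_iff finite_subset inj_on_subset subset_UNIV)
  moreover have "?F \<subseteq> E" using E_eq by auto
  ultimately show ?thesis using infinity by (intro exI[of _ ?F]) (simp add: ecard_def)
qed

text \<open>A basis \<open>E\<close> of \<open>H1\<close> is mapped bijectively onto \<open>E - F\<close>, where \<open>F\<close> has cardinality \<open>n\<close>. The part of
  \<open>ker W\<^sup>\<dagger>\<close> in \<open>H1\<close> then has the basis \<open>F\<close>.\<close>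

lemma diagonal_exists: "\<exists>W\<in>S_diag. edim (defect W) = n"
proof -
  obtain E where E: "onb H1 E" using onb_exists[OF csub_H1] by blast
  have oE: "orthonormal E" and EH: "E \<subseteq> H1" using E by (auto simp: onb_def)
  obtain F where F: "F \<subseteq> E" "ecard F = n" "infinite (E - F)"
    using infinite_split[OF orthonormal_countable[OF oE] onb_H1_infinite[OF E]] by blast
  define M where "M = H1 \<inter> {f. \<forall>e\<in>F. ip e f = 0}"
  have "{f. \<forall>e\<in>F. ip e f = 0} = (\<Inter>e\<in>F. {f. ip e f = 0})" by auto
  moreover have "closed {f. ip e f = 0}" for e
    by (intro closed_Collect_eq linear_continuous_on bounded_linear_ip continuous_on_const)
  ultimately have "closed {f. \<forall>e\<in>F. ip e f = 0}" by (simp add: closed_INT)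
  then have "csub {f. \<forall>e\<in>F. ip e f = 0}"
    by (simp add: csub_def real_vector.subspace_def ip_add_right ip_scaleR_right J_def ip_scale_right)
  then have M: "csub M" unfolding M_def by (rule csub_Int[OF csub_H1])
  have EF: "onb M (E - F)"
    unfolding onb_def
  proof (intro conjI ballI impI)
    show "orthonormal (E - F)" using oE by (auto simp: orthonormal_def)
    show "E - F \<subseteq> M" using EH F(1) orthonormalD[OF oE] by (auto simp: M_def)
    fix f assume "f \<in> M" "\<forall>e\<in>E - F. ip e f = 0"
    then have "f \<in> H1" "\<forall>e\<in>E. ip e f = 0" by (auto simp: M_def)
    then show "f = 0" using E unfolding onb_def by blast
  qed
  have "ecard E = ecard (E - F)" using onb_H1_infinite[OF E] F(3) by (simp add: ecard_def)
  then obtain \<phi> where \<phi>: "bij_betw \<phi> E (E - F)" using ecard_eq_bij oE EF by (meson onb_def)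
  have p: "closed_projection H1 bP1"
    using csub_H1 by unfold_locales (auto simp: csub_def H1_def inner_diff_left inner_P1)
  obtain p' where p0: "(\<forall>f. blinfun_apply p' f \<in> M) \<and> (\<forall>f. \<forall>k\<in>M. (f - blinfun_apply p' f) \<bullet> k = 0)"
    using orthogonal_projection[of M] M unfolding csub_def by blast
  interpret p': closed_projection M p' by unfold_locales (use M p0 in \<open>auto simp: csub_def\<close>)
  have p': "closed_projection M p'" by (rule p'.closed_projection_axioms)
  obtain T where T: "clin T" "\<And>f. hadj T (T f) = bP1 f" "\<And>f. T (hadj T f) = p' f"
    using partial_isometry_exists[OF E EF csub_H1 M \<phi> p p'] by blast
  note Tp = partial_isometry_absorb[OF T(2,3) p p']
  have TH: "T f \<in> H1" for f using Tp(2)[of f] by (simp add: M_def)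
  have TP: "T (P1 f) = T f" for f using Tp(1)[of f] by simp
  define W where "W = doubled T"
  note d = doubled[OF T(1) TH TP, folded W_def]
  have iso: "W f \<bullet> W g = f \<bullet> g" for f g
  proof -
    have "T h \<bullet> T k = h \<bullet> P1 k" for h k using T(2)[of k] by (simp flip: inner_hadj_right)
    then have "W f \<bullet> W g = f \<bullet> (P1 g + P2 g)"
      by (simp add: d(3) inner_star P1_star inner_add_right)
    then show ?thesis by (simp add: P1_P2_add)
  qed
  have W: "W \<in> S_diag" by (rule S_diagI[OF d(1,2) iso])
  have kd: "f \<in> kd W \<longleftrightarrow> (\<forall>g. f \<bullet> T g = 0)" if f: "f \<in> H1" for f
  proof -
    have "f \<in> kd W \<longleftrightarrow> (\<forall>g. f \<bullet> W g = 0)"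
      unfolding kd_iff by (metis S_diag_C[OF W] C_C)
    then show ?thesis using d(4)[OF f] by simp
  qed
  have "onb (defect W) F"
    unfolding onb_def
  proof (intro conjI ballI impI)
    show "orthonormal F" using oE F(1) unfolding orthonormal_def by blast
    show "F \<subseteq> defect W"
    proof
      fix e assume e: "e \<in> F"
      then have eH: "e \<in> H1" using F(1) EH by auto
      have "ip e (T g) = 0" for g using Tp(2)[of g] e by (simp add: M_def)
      then have "e \<bullet> T g = 0" for g by (simp add: inner_eq)
      then show "e \<in> defect W" using kd[OF eH] eH by (simp add: defect_def)
    qed
    fix f assume f: "f \<in> defect W" "\<forall>e\<in>F. ip e f = 0"
    then have fM: "f \<in> M" and fH: "f \<in> H1" by (auto simp: M_def defect_def)
    have "f = T (hadj T f)" using p'.fixed[OF fM] T(3) by simp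
    then have "f \<bullet> f = 0" using kd[OF fH] f(1) by (metis defect_def IntD1)
    then show "f = 0" by simp
  qed
  then have "edim (defect W) = n" using edim_onb[OF csub_defect[OF S_diag_S[OF W]]] F(2) by simp
  then show ?thesis using W by blast
qed

section \<open>Orbits and components\<close>

text \<open>Being in the same orbit and in the same component. The two are treated together, because both are
  produced by the same chains of Cayley transforms.\<close>

definition linked :: "'k endo \<Rightarrow> 'k endo \<Rightarrow> bool"
  where "linked V V' \<longleftrightarrow> V \<in> S_P1 \<and> connected_component_of top_S V V' \<and> (\<exists>U\<in>S_P1_ind 0. V' = U o\<^sub>L V)"

lemma compose_assoc: "(A o\<^sub>L B) o\<^sub>L D = A o\<^sub>L (B o\<^sub>L D)"
  by (rule blinfun_eqI) simp

lemma linked_cayley: "U \<in> cayley \<Longrightarrow> V \<in> S_P1 \<Longrightarrow> linked V (U o\<^sub>L V)"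
  unfolding linked_def using cayley_connected cayley_ind_zero by blast

lemma linked_S_P1: "linked V V' \<Longrightarrow> V' \<in> S_P1"
  unfolding linked_def using S_P1_compose S_P1_ind_S(2) by blast

lemma linked_trans: assumes "linked V V'" "linked V' V''" shows "linked V V''"
proof -
  obtain U U' where U: "U \<in> S_P1_ind 0" "V' = U o\<^sub>L V" "U' \<in> S_P1_ind 0" "V'' = U' o\<^sub>L V'"
    using assms by (auto simp: linked_def)
  then have "V'' = (U' o\<^sub>L U) o\<^sub>L V" by (simp add: compose_assoc)
  moreover have "connected_component_of top_S V V''"
    by (rule connected_component_of_trans[of top_S V V']) (use assms in \<open>auto simp: linked_def\<close>)
  ultimately show ?thesis using assms(1) S_P1_ind_left_mult[OF U(3,1)] unfolding linked_def by blast
qed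

lemma linked_cayley_sym: assumes "U \<in> cayley" "V \<in> S_P1" shows "linked (U o\<^sub>L V) V"
proof -
  obtain U' where U': "U' \<in> cayley" "U' o\<^sub>L U = id_blinfun" using cayley_inverse[OF assms(1)] by blast
  have "U o\<^sub>L V \<in> S_P1" using linked_S_P1[OF linked_cayley[OF assms]] .
  from linked_cayley[OF U'(1) this] show ?thesis by (simp add: U'(2) flip: compose_assoc)
qed

lemma linked_diagonal:
  assumes V: "V \<in> S_P1"
  shows "\<exists>W\<in>S_diag. linked V W \<and> linked W V"
proof -
  obtain U1 U2 W where f: "U1 \<in> cayley" "U2 \<in> cayley" "W \<in> S_diag" "V = U1 o\<^sub>L (U2 o\<^sub>L W)"
    using factorization[OF V] by blast
  have W: "W \<in> S_P1" by (rule S_diag_S_P1[OF f(3)])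
  have U2W: "U2 o\<^sub>L W \<in> S_P1" by (rule linked_S_P1[OF linked_cayley[OF f(2) W]])
  show ?thesis
    using linked_trans[OF linked_cayley[OF f(2) W] linked_cayley[OF f(1) U2W]]
      linked_trans[OF linked_cayley_sym[OF f(1) U2W] linked_cayley_sym[OF f(2) W]] f(3,4) by blast
qed

lemma linked_neg_ind: "linked V V' \<Longrightarrow> V \<in> S_P1_ind n \<Longrightarrow> V' \<in> S_P1_ind n"
  unfolding linked_def using S_P1_ind_left_mult by blast

lemma neg_ind_inj: "2 * m = 2 * n \<Longrightarrow> m = (n::enat)"
  by (cases m; cases n) (auto simp: numeral_eq_enat)

lemma S_P1_ind_unique: "V \<in> S_P1_ind m \<Longrightarrow> V \<in> S_P1_ind n \<Longrightarrow> m = n"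
  by (simp add: S_P1_ind_def neg_ind_inj)

lemma S_P1_ind_exists: assumes V: "V \<in> S_P1" shows "\<exists>n. V \<in> S_P1_ind n"
proof -
  obtain W where W: "W \<in> S_diag" "linked W V" using linked_diagonal[OF V] by blast
  then have "W \<in> S_P1_ind (edim (defect W))"
    by (simp add: S_P1_ind_def S_diag_S_P1 neg_ind_diag)
  then show ?thesis using linked_neg_ind[OF W(2)] by blast
qed

lemma S_P1_ind_nonempty: "S_P1_ind n \<noteq> {}"
proof -
  obtain W where "W \<in> S_diag" "edim (defect W) = n" using diagonal_exists by blast
  then have "W \<in> S_P1_ind n" by (simp add: S_P1_ind_def S_diag_S_P1 neg_ind_diag)
  then show ?thesis by blast
qed

text \<open>Both operators are linked to diagonal ones, which have the same index and so differ by a diagonal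
  unitary, a product of two Cayley transforms.\<close>

lemma S_P1_ind_linked:
  assumes V: "V \<in> S_P1_ind n" and V': "V' \<in> S_P1_ind n"
  shows "linked V V'"
proof -
  obtain W where W: "W \<in> S_diag" "linked V W"
    using linked_diagonal[OF S_P1_ind_S(2)[OF V]] by blast
  obtain W' where W': "W' \<in> S_diag" "linked W' V'" "linked V' W'"
    using linked_diagonal[OF S_P1_ind_S(2)[OF V']] by blast
  have "W \<in> S_P1_ind n" "W' \<in> S_P1_ind n"
    using linked_neg_ind[OF W(2) V] linked_neg_ind[OF W'(3) V'] by auto
  then have "2 * edim (defect W) = 2 * edim (defect W')"
    unfolding neg_ind_diag[OF W(1), symmetric] neg_ind_diag[OF W'(1), symmetric] by (simp add: S_P1_ind_def)
  then have "edim (defect W) = edim (defect W')" by (rule neg_ind_inj)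
  then obtain D where D: "D \<in> S_diag" "neg_ind D = 0" "W' = D o\<^sub>L W"
    using diagonal_transitive[OF W(1) W'(1)] by blast
  obtain D1 D2 where DD: "D1 \<in> cayley" "D2 \<in> cayley" "D = D1 o\<^sub>L D2"
    using diagonal_unitary_cayley[OF D(1,2)] by blast
  have WP: "W \<in> S_P1" by (rule S_diag_S_P1[OF W(1)])
  have "linked W (D1 o\<^sub>L (D2 o\<^sub>L W))"
    by (rule linked_trans[OF linked_cayley[OF DD(2) WP] linked_cayley[OF DD(1) linked_S_P1[OF linked_cayley[OF DD(2) WP]]]])
  then have "linked W W'" by (simp add: D(3) DD(3) compose_assoc)
  then show ?thesis using linked_trans W(2) W'(2) by blast
qed

lemma orbit_eq: assumes V: "V \<in> S_P1_ind n" shows "{U o\<^sub>L V |U. U \<in> S_P1_ind 0} = S_P1_ind n"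
  using S_P1_ind_left_mult[OF _ V] S_P1_ind_linked[OF V] unfolding linked_def by blast

lemma component_eq: assumes V: "V \<in> S_P1_ind n" shows "connected_component_of_set top_S V = S_P1_ind n"
proof
  show "S_P1_ind n \<subseteq> connected_component_of_set top_S V"
    using S_P1_ind_linked[OF V] by (auto simp: linked_def)
  have top: "topspace top_S = S_P1"
    unfolding top_S_def by (rule Metric_space.topspace_mtopology[OF metric_\<delta>])
  have "topspace top_S - S_P1_ind n = (\<Union>m\<in>UNIV - {n}. S_P1_ind m)"
    unfolding top
  proof
    show "S_P1 - S_P1_ind n \<subseteq> (\<Union>m\<in>UNIV - {n}. S_P1_ind m)" using S_P1_ind_exists by fastforce
    show "(\<Union>m\<in>UNIV - {n}. S_P1_ind m) \<subseteq> S_P1 - S_P1_ind n"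
    proof
      fix W assume "W \<in> (\<Union>m\<in>UNIV - {n}. S_P1_ind m)"
      then obtain m where m: "m \<noteq> n" "W \<in> S_P1_ind m" by blast
      then show "W \<in> S_P1 - S_P1_ind n" using S_P1_ind_unique[OF m(2)] S_P1_ind_S(2)[OF m(2)] by blast
    qed
  qed
  then have cl: "closedin top_S (S_P1_ind n)"
    unfolding closedin_def using openin_subset[OF S_P1_ind_openin] S_P1_ind_openin by auto
  have "connected_component_of_set top_S V \<subseteq> S_P1_ind n \<or> disjnt (connected_component_of_set top_S V) (S_P1_ind n)"
    by (rule connectedin_clopen_cases[OF connectedin_connected_component_of cl S_P1_ind_openin])
  moreover have "V \<in> connected_component_of_set top_S V"
    using S_P1_ind_S(2)[OF V] by (simp add: connected_component_of_refl top)
  ultimately show "connected_component_of_set top_S V \<subseteq> S_P1_ind n"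
    using V by (auto simp: disjnt_iff)
qed

lemma S_HS_compose: assumes "U \<in> S_HS" "V \<in> S_HS" shows "U o\<^sub>L V \<in> S_HS"
proof -
  have HSm: "HS (A - id_blinfun) \<longleftrightarrow> hilbert_schmidt (\<lambda>f. A f - f)" for A
  proof -
    have "blinfun_apply (A - id_blinfun) = (\<lambda>f. A f - f)" by (simp add: fun_eq_iff blinfun.diff_left)
    then show ?thesis by (simp only: HS_def)
  qed
  have S: "U \<in> S" "V \<in> S" and h: "HS (U - id_blinfun)" "HS (V - id_blinfun)"
    using assms by (auto simp: S_HS_def HSm)
  have "HS ((U o\<^sub>L (V - id_blinfun)) + (U - id_blinfun))"
    by (intro HS_add(1) HS_compose_left(1) h S_clin S)
  then have "HS ((U o\<^sub>L V) - id_blinfun)" by (rule HS_of_eq) (simp add: blinfun.bilinear_simps)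
  then show ?thesis using S_compose[OF S] unfolding HSm S_HS_def by simp
qed

lemma S_HS_S_P1: assumes "U \<in> S_HS" shows "U \<in> S_P1"
proof -
  have "blinfun_apply (U - id_blinfun) = (\<lambda>f. U f - f)" by (simp add: fun_eq_iff blinfun.diff_left)
  then have S: "U \<in> S" and h: "HS (U - id_blinfun)" using assms by (auto simp: S_HS_def HS_def)
  have "HS (bP1 o\<^sub>L ((U - id_blinfun) o\<^sub>L bP2))"
    by (intro HS_compose_left(1) HS_compose_right(1) h clin_blinfun)
  then have "HS (blk U)" by (rule HS_of_eq) (simp add: blk_def blinfun.bilinear_simps P1_diff)
  then show ?thesis using S by (simp add: S_P1_iff)
qed

lemma S_P1_eq_product: "S_P1 = {V o\<^sub>L W |V W. V \<in> S_HS \<and> W \<in> S_diag}"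
proof
  show "S_P1 \<subseteq> {V o\<^sub>L W |V W. V \<in> S_HS \<and> W \<in> S_diag}"
  proof
    fix V assume "V \<in> S_P1"
    then obtain U1 U2 W where f: "U1 \<in> S_HS" "U2 \<in> S_HS" "W \<in> S_diag" "V = U1 o\<^sub>L (U2 o\<^sub>L W)"
      using factorization by blast
    then have "V = (U1 o\<^sub>L U2) o\<^sub>L W" by (simp add: compose_assoc)
    then show "V \<in> {V o\<^sub>L W |V W. V \<in> S_HS \<and> W \<in> S_diag}" using S_HS_compose[OF f(1,2)] f(3) by blast
  qed
  show "{V o\<^sub>L W |V W. V \<in> S_HS \<and> W \<in> S_diag} \<subseteq> S_P1"
    using S_P1_compose S_HS_S_P1 S_diag_S_P1 by blast
qed

lemma orbits_eq: "{{U o\<^sub>L V |U. U \<in> S_P1_ind 0} |V. V \<in> S_P1} = range S_P1_ind"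
proof
  show "{{U o\<^sub>L V |U. U \<in> S_P1_ind 0} |V. V \<in> S_P1} \<subseteq> range S_P1_ind"
    using S_P1_ind_exists orbit_eq by blast
  show "range S_P1_ind \<subseteq> {{U o\<^sub>L V |U. U \<in> S_P1_ind 0} |V. V \<in> S_P1}"
  proof
    fix X assume "X \<in> range S_P1_ind"
    then obtain n where X: "X = S_P1_ind n" by blast
    obtain V where V: "V \<in> S_P1_ind n" using S_P1_ind_nonempty by blast
    show "X \<in> {{U o\<^sub>L V |U. U \<in> S_P1_ind 0} |V. V \<in> S_P1}"
      using orbit_eq[OF V] S_P1_ind_S(2)[OF V] X by blast
  qed
qed

lemma components_eq: "connected_components_of (Metric_space.mtopology S_P1 \<delta>) = range S_P1_ind"
proof -
  have top: "topspace top_S = S_P1"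
    unfolding top_S_def by (rule Metric_space.topspace_mtopology[OF metric_\<delta>])
  have "connected_components_of top_S = range S_P1_ind"
  proof
    show "connected_components_of top_S \<subseteq> range S_P1_ind"
      unfolding connected_components_of_def top using S_P1_ind_exists component_eq by blast
    show "range S_P1_ind \<subseteq> connected_components_of top_S"
    proof
      fix X assume "X \<in> range S_P1_ind"
      then obtain n where X: "X = S_P1_ind n" by blast
      obtain V where V: "V \<in> S_P1_ind n" using S_P1_ind_nonempty by blast
      show "X \<in> connected_components_of top_S"
        unfolding connected_components_of_def top X component_eq[OF V, symmetric]
        using S_P1_ind_S(2)[OF V] by blast
    qed
  qed
  then show ?thesis by (simp add: top_S_def)
qed

end

theorem corollary3p8:
  fixes scaleC :: "complex \<Rightarrow> 'k::{real_inner, complete_space, second_countable_topology} \<Rightarrow> 'k"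
    and \<kappa> :: "'k \<Rightarrow> 'k \<Rightarrow> complex"
    and star :: "'k \<Rightarrow> 'k"
    and P1 :: "'k \<Rightarrow> 'k"
  assumes "selfdual_hilbert_space scaleC \<kappa> star P1"
  shows "selfdual_hilbert_space.S_P1 scaleC \<kappa> star P1 =
      {V o\<^sub>L W |V W. V \<in> selfdual_hilbert_space.S_HS scaleC \<kappa> star P1 \<and>
                     W \<in> selfdual_hilbert_space.S_diag scaleC \<kappa> star P1} \<and>
    {{U o\<^sub>L V |U. U \<in> selfdual_hilbert_space.S_P1_ind scaleC \<kappa> star P1 0} |V.
        V \<in> selfdual_hilbert_space.S_P1 scaleC \<kappa> star P1} =
      range (selfdual_hilbert_space.S_P1_ind scaleC \<kappa> star P1) \<and>
    connected_components_of
        (Metric_space.mtopology (selfdual_hilbert_space.S_P1 scaleC \<kappa> star P1)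
          (selfdual_hilbert_space.\<delta> scaleC \<kappa> P1)) =
      range (selfdual_hilbert_space.S_P1_ind scaleC \<kappa> star P1)"
proof -
  interpret selfdual_hilbert_space scaleC \<kappa> star P1 by fact
  show ?thesis using S_P1_eq_product orbits_eq components_eq by blast
qed

end
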